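(* Let $f(z)=\sum_{n=0}^\infty\alpha_nz^n$ be a transcendental entire solution of $$\sum_{j=0}^m a_j(z)f(q^jz)=b(z),$$ with growth given by $$\log M(r,f)\sim \frac{\sigma_k}{-2\log|q|}(\log r)^2\qquad (r\to\infty),$$ where $k\in\{1,\dots,K\}$. With this $k$, let $M,N,\rho$, the characteristic polynomial $P_k$ associated to $\sigma_k$, its roots $\lambda_1,\dots,\lambda_l$, and the number $\mu$ be as defined in the context. Suppose that the roots of $P_k$ which have modulus $\mu$ differ only by roots of unity. Then the zeros of $f$ are asymptotic to finitely many geometric progressions. More precisely, if $L\in\mathbb{N}$ with $\lambda_i^{LM}=\lambda_j^{LM}$ whenever $|\lambda_i|=|\lambda_j|=\mu$, then the set of zeros of $f$ can be written in the form $$\{z_{n,\nu}\colon \nu\in\{1,2,\dots,LM\},\ n\in\mathbb{N}\}$$ such that for each $\nu$ there exists $A_\nu\in\mathbb{C}\setminus\{0\}$ with $$z_{n,\nu}\sim A_\nu q^{-LNn}$$ as $n\to\infty$. If, in addition, all roots of $P_k$ of modulus $\mu$ are simple, then this can be improved to $$z_{n,\nu}=A_\nu q^{-LNn}\left(1+O\!\left(\left(\frac{\delta}{\mu}\right)^{n}\right)\right),$$ for any $\delta$ satisfying $$\delta>\max_{\{j\colon|\lambda_j|<\mu\}}|\lambda_j|\quad\text{and}\quad\delta>|\rho|^2\mu.$$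
   Context: Setting: $q\in\mathbb{C}$ with $0<|q|<1$; $b$ and $a_0,\dots,a_m$ are polynomials. Put $M(r,f)=\max_{|z|=r}|f(z)|$. Newton-Puiseux diagram: let $d(j)$ denote the degree of $a_j$. The diagram $P$ is the convex hull of $\bigcup_{j=0}^m\{(x,y)\in\mathbb{R}^2\colon x\ge j \text{ and } y\le d(j)\}$. Its vertices are $(j_k,d(j_k))$, $k\in\{0,\dots,K\}$, with $0=j_0<j_1<\dots<j_K\le m$. For $k\in\{1,\dots,K\}$ put $$\sigma_k=\frac{d(j_k)-d(j_{k-1})}{j_k-j_{k-1}};$$ then $\sigma_1>\sigma_2>\dots>\sigma_K>0$. (Existence of a transcendental entire solution implies $K\ge1$, and for each such solution there is a $k\in\{1,\dots,K\}$ with the growth asymptotics in the claim.) For this $k$ put $M=d(j_k)-d(j_{k-1})$, $N=j_k-j_{k-1}$ (so $\sigma_k=M/N$), and $\rho=q^{1/(2M)}$ for some fixed branch of the root. Let $I_k$ be the set of all $j\in\{0,\dots,m\}$ for which $(j,d(j))$ lies on the line through $(j_{k-1},d(j_{k-1}))$ and $(j_k,d(j_k))$. Write $a_j(z)=\sum_{i=0}^{d(j)}a_{j,i}z^i$ and put $c_{j,i}=a_{j,i}\rho^{Ni^2}q^{-ji}$. The characteristic polynomial associated to $\sigma_k$ is $$P_k(z)=\sum_{j\in I_k}c_{j,d(j)}z^{d(j)-d(j_{k-1})}.$$ It has degree $M$, and $P_k(0)=c_{j_{k-1},d(j_{k-1})}\ne0$. Let $\lambda_1,\dots,\lambda_l$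 be its roots, with multiplicities $m_1,\dots,m_l$, so that $\sum_{j=1}^l m_j=M$. The number $\mu$ is the one provided by the following result of the paper: for a solution $f$ as in the claim there exist $\mu\in\{|\lambda_j|\colon1\le j\le l\}$ and for each $j$ with $|\lambda_j|=\mu$ a polynomial $Q_j$ with $\deg Q_j\le m_j-1$, not all $Q_j$ vanishing identically, such that $$\alpha_n\rho^{-Nn^2}=\sum_{\{j\colon|\lambda_j|=\mu\}}Q_j(n)\lambda_j^n+O(\delta^n)$$ for some $\delta\in(0,\mu)$ as $n\to\infty$, and in fact for any $\delta$ with $\delta>\max_{\{j\colon|\lambda_j|<\mu\}}|\lambda_j|$ and $\delta>|\rho|^2\mu$.
   Formalization: The λ_j are taken to be the reciprocals of the roots of P_k (same multiplicities): the expansion that defines μ holds with these and fails for the roots themselves, e.g. for f(z)=∑q^{n(n-1)/2}z^n, which solves f(z)-zf(qz)=1. *)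

theory Defs
  imports "HOL-Complex_Analysis.Complex_Analysis" "HOL-Library.Landau_Symbols"
begin

definition max_modulus :: "(complex \<Rightarrow> complex) \<Rightarrow> real \<Rightarrow> real" where
  "max_modulus f r = (SUP z\<in>sphere 0 r. cmod (f z))"

definition transcendental_entire :: "(complex \<Rightarrow> complex) \<Rightarrow> bool" where
  "transcendental_entire f \<longleftrightarrow> f holomorphic_on UNIV \<and> \<not> (\<exists>p. \<forall>z. f z = poly p z)"

(* The zero polynomial has degree minus infinity in the Newton-Puiseux diagram, so indices j with
   a j = 0 contribute nothing; they are excluded because Isabelle sets degree 0 = 0. *)
definition newton_diagram :: "nat \<Rightarrow> (nat \<Rightarrow> complex poly) \<Rightarrow> (real \<times> real) set" where
  "newton_diagram m a =
     convex hull (\<Union>j\<in>{j. j \<le> m \<and> a j \<noteq> 0}. {(x, y). x \<ge> real j \<and> y \<le> real (degree (a j))})"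

definition newton_point :: "(nat \<Rightarrow> complex poly) \<Rightarrow> nat \<Rightarrow> real \<times> real" where
  "newton_point a j = (real j, real (degree (a j)))"

definition newton_vertices :: "nat \<Rightarrow> (nat \<Rightarrow> complex poly) \<Rightarrow> nat set" where
  "newton_vertices m a =
     {j. j \<le> m \<and> a j \<noteq> 0 \<and> newton_point a j extreme_point_of newton_diagram m a}"

(* The vertices are numbered j_0 < ... < j_K. *)
definition newton_index :: "nat \<Rightarrow> (nat \<Rightarrow> complex poly) \<Rightarrow> nat \<Rightarrow> nat" where
  "newton_index m a k = sorted_list_of_set (newton_vertices m a) ! k"

definition newton_K :: "nat \<Rightarrow> (nat \<Rightarrow> complex poly) \<Rightarrow> nat" where
  "newton_K m a = card (newton_vertices m a) - 1"

(* For 1 <= k <= K both differences are positive, so truncated subtraction is harmless. *)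
definition edge_M :: "nat \<Rightarrow> (nat \<Rightarrow> complex poly) \<Rightarrow> nat \<Rightarrow> nat" where
  "edge_M m a k = degree (a (newton_index m a k)) - degree (a (newton_index m a (k - 1)))"

definition edge_N :: "nat \<Rightarrow> (nat \<Rightarrow> complex poly) \<Rightarrow> nat \<Rightarrow> nat" where
  "edge_N m a k = newton_index m a k - newton_index m a (k - 1)"

definition edge_slope :: "nat \<Rightarrow> (nat \<Rightarrow> complex poly) \<Rightarrow> nat \<Rightarrow> real" where
  "edge_slope m a k = real (edge_M m a k) / real (edge_N m a k)"

definition edge_indices :: "nat \<Rightarrow> (nat \<Rightarrow> complex poly) \<Rightarrow> nat \<Rightarrow> nat set" where
  "edge_indices m a k =
     {j. j \<le> m \<and> a j \<noteq> 0 \<and>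
         newton_point a j \<in> affine hull {newton_point a (newton_index m a (k - 1)),
                                         newton_point a (newton_index m a k)}}"

definition edge_coeff ::
  "complex \<Rightarrow> complex \<Rightarrow> nat \<Rightarrow> (nat \<Rightarrow> complex poly) \<Rightarrow> nat \<Rightarrow> nat \<Rightarrow> nat \<Rightarrow> complex" where
  "edge_coeff q \<rho> m a k j i =
     coeff (a j) i * \<rho> ^ (edge_N m a k * i\<^sup>2) * q powi (- int (j * i))"

definition char_poly ::
  "complex \<Rightarrow> complex \<Rightarrow> nat \<Rightarrow> (nat \<Rightarrow> complex poly) \<Rightarrow> nat \<Rightarrow> complex poly" where
  "char_poly q \<rho> m a k =
     (\<Sum>j\<in>edge_indices m a k.
        monom (edge_coeff q \<rho> m a k j (degree (a j)))
              (degree (a j) - degree (a (newton_index m a (k - 1)))))"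

(* The characteristic numbers lambda_j (written \<kappa> below), normalised so that
     char_poly(z) = char_poly(0) * prod_j (1 - lambda_j z)^(m_j).
   Comparing coefficients in the functional equation, beta_n = alpha_n rho^(-N n^2) satisfies, up to
   exponentially small relative perturbations,
     sum_{j in I_k} c_{j,d(j)} beta_{n-d(j)} = 0,
   so the geometric sequences lambda^n solving this recurrence are those with
   char_poly(1/lambda) = 0; equivalently, lambda is a root of reflect_poly char_poly, that is, of
   the sum of the c_{j,d(j)} z^(d(j_k) - d(j)).  The roots of char_poly itself do not occur in the
   expansion of beta_n: f(z) = sum_n q^(n(n-1)/2) z^n solves f(z) - z f(qz) = 1 and has
   beta_n = rho^(-n), whereas char_poly(z) = 1 - z/rho has the root rho.  *)
definition char_roots ::
  "complex \<Rightarrow> complex \<Rightarrow> nat \<Rightarrow> (nat \<Rightarrow> complex poly) \<Rightarrow> nat \<Rightarrow> complex set" where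
  "char_roots q \<rho> m a k = {\<kappa>. \<kappa> \<noteq> 0 \<and> poly (char_poly q \<rho> m a k) (inverse \<kappa>) = 0}"

definition char_mult ::
  "complex \<Rightarrow> complex \<Rightarrow> nat \<Rightarrow> (nat \<Rightarrow> complex poly) \<Rightarrow> nat \<Rightarrow> complex \<Rightarrow> nat" where
  "char_mult q \<rho> m a k \<kappa> = order (inverse \<kappa>) (char_poly q \<rho> m a k)"

(* At most one mu satisfies this for given coefficients alpha.  The error bound is required for
   some delta < mu only, which already determines mu; that it then holds for every
   delta > |rho|^2 mu exceeding the moduli below mu is not part of the definition. *)
definition dominant_modulus ::
  "complex \<Rightarrow> complex \<Rightarrow> nat \<Rightarrow> (nat \<Rightarrow> complex poly) \<Rightarrow> nat \<Rightarrow> (nat \<Rightarrow> complex) \<Rightarrow> real \<Rightarrow> bool" where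
  "dominant_modulus q \<rho> m a k \<alpha> \<mu> \<longleftrightarrow>
     \<mu> \<in> cmod ` char_roots q \<rho> m a k \<and>
     (\<exists>Q :: complex \<Rightarrow> complex poly.
        (\<forall>\<kappa>\<in>char_roots q \<rho> m a k. cmod \<kappa> = \<mu> \<longrightarrow>
            degree (Q \<kappa>) \<le> char_mult q \<rho> m a k \<kappa> - 1) \<and>
        (\<exists>\<kappa>\<in>char_roots q \<rho> m a k. cmod \<kappa> = \<mu> \<and> Q \<kappa> \<noteq> 0) \<and>
        (\<exists>\<delta>. 0 < \<delta> \<and> \<delta> < \<mu> \<and>
           (\<lambda>n. \<alpha> n * \<rho> powi (- int (edge_N m a k * n\<^sup>2))
                - (\<Sum>\<kappa> | \<kappa> \<in> char_roots q \<rho> m a k \<and> cmod \<kappa> = \<mu>. poly (Q \<kappa>) (of_nat n) * \<kappa> ^ n))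
           \<in> O(\<lambda>n. complex_of_real (\<delta> ^ n))))"

definition asymptotic_to_geometric_progressions :: "complex set \<Rightarrow> bool" where
  "asymptotic_to_geometric_progressions S \<longleftrightarrow>
     (\<exists>(T :: nat) (z :: nat \<Rightarrow> nat \<Rightarrow> complex) (A :: nat \<Rightarrow> complex) (R :: nat \<Rightarrow> complex).
        S = {z n \<nu> | n \<nu>. \<nu> \<in> {1..T}} \<and>
        (\<forall>\<nu>\<in>{1..T}. A \<nu> \<noteq> 0 \<and> cmod (R \<nu>) > 1 \<and>
           (\<lambda>n. z n \<nu>) \<sim>[sequentially] (\<lambda>n. A \<nu> * R \<nu> ^ n)))"

end

theory Submission imports Defs begin

text \<open>
  Put \<open>\<tau> = \<rho>\<^sup>N\<close> and \<open>\<alpha>\<^sub>n = \<beta>\<^sub>n \<tau>^(n\<^sup>2)\<close>. Up to an error \<open>O(\<delta>\<^sup>n)\<close> with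
  \<open>\<delta> < \<mu>\<close>, the number \<open>\<beta>\<^sub>n\<close> is the sum of \<open>Q\<^sub>\<kappa>(n) \<kappa>\<^sup>n\<close> over the characteristic numbers
  \<open>\<kappa>\<close> of modulus \<open>\<mu>\<close>, and with \<open>T = L M\<close> all these \<open>\<kappa>\<close> have the same power \<open>\<Lambda> = \<kappa>\<^sup>T\<close>.
  So after division by \<open>n\<^sup>D\<close>, where \<open>D\<close> is the largest degree of a \<open>Q\<^sub>\<kappa>\<close>, the sequence
  \<open>\<beta>\<close> is asymptotically periodic with period \<open>T\<close> and multiplier \<open>\<Lambda>\<close>.

  Let \<open>c = \<tau>^(-2T) = q^(-LN)\<close>. Completing the square in the exponent of \<open>\<tau>\<close> shows that \<open>f (c\<^sup>n w)\<close> is an explicit factor without zeros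
  times the Laurent series \<open>G\<^sub>n(w)\<close> with the coefficients \<open>\<beta>\<close> recentred at the index \<open>nT\<close> and
  the Gaussian weights \<open>\<tau>^(h\<^sup>2)\<close> (\<open>theta_rescaling\<close>). The recentred coefficients
  converge to \<open>p\<^sub>h\<close>, the sum of \<open>q\<^sub>\<kappa> \<kappa>\<^sup>h\<close> where \<open>q\<^sub>\<kappa>\<close> is the coefficient of \<open>n\<^sup>D\<close> in \<open>Q\<^sub>\<kappa>\<close>,
  and the weights make this dominated convergence, so \<open>G\<^sub>n\<close> tends to the theta series \<open>\<Theta>\<close> of
  \<open>p\<close> uniformly on annuli (\<open>theta_series_uniform_limit\<close>). As the \<open>p\<^sub>h\<close> are power sums of
  distinct numbers they do not all vanish, and then Cauchy's inequality excludes \<open>\<Theta> = 0\<close>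
  (\<open>theta_series_nonzero\<close>).

  Because \<open>p\<close> is periodic with multiplier \<open>\<Lambda>\<close>, \<open>\<Theta>(c w)\<close> is a constant times
  \<open>w\<^sup>T \<Theta>(w)\<close>, and the argument principle gives exactly \<open>T\<close> zeros of \<open>\<Theta>\<close>, with multiplicity,
  in a fundamental annulus (\<open>quasi_periodic_zero_count\<close>). By Rouche's theorem the zeros of
  \<open>f\<close> in the \<open>n\<close>-th dilated annulus are, for large \<open>n\<close>, the numbers \<open>c\<^sup>n \<xi>\<close> with \<open>\<xi>\<close> close to a
  zero \<open>a\<close> of \<open>\<Theta>\<close>, and for each \<open>a\<close> there are at least one and at most as many different
  \<open>\<xi>\<close> as the multiplicity of \<open>a\<close> says. Distributing the \<open>T\<close> indices \<open>\<nu>\<close> over the zeros of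
  \<open>\<Theta>\<close> according to multiplicity produces the sequences (\<open>zeros_asymptotic_to_geometric\<close>).

  For the sharper error, let \<open>a\<close> have multiplicity \<open>r\<close>. Then the \<open>r\<close>-th power of the distance
  of \<open>\<xi>\<close> from \<open>a\<close> is bounded by a multiple of \<open>\<bar>G\<^sub>n - \<Theta>\<bar>\<close>. If the characteristic numbers of
  modulus \<open>\<mu>\<close> are simple, then \<open>D = 0\<close>, and since the coefficients are taken at indices
  around \<open>nT\<close>, the difference \<open>G\<^sub>n - \<Theta>\<close> is \<open>O((\<delta>/\<mu>)^(nT))\<close>. Now
  \<open>r \<le> T\<close>, so that the \<open>r\<close>-th root still leaves \<open>(\<delta>/\<mu>)\<^sup>n\<close>; multiple zeros of
  \<open>\<Theta>\<close> do no harm.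

  It remains to see that the error of \<open>\<beta>\<close> is \<open>O(\<delta>\<^sup>n)\<close> for every \<open>\<delta>\<close> that exceeds
  \<open>\<bar>\<rho>\<bar>\<^sup>2 \<mu>\<close> and the smaller moduli. Since all points of the Newton-Puiseux diagram lie
  on or below the line through the chosen edge (\<open>newton_edge\<close>), comparing coefficients in the
  functional equation gives a recurrence for \<open>\<beta>\<close> with the characteristic numbers as roots
  and a perturbation of size \<open>(\<bar>\<rho>\<bar>\<^sup>2 \<mu>)\<^sup>n\<close> (\<open>char_poly_recurrence\<close>). A solution known to be
  smaller than \<open>\<mu>\<^sup>n\<close> has no component along the roots of modulus at least \<open>\<mu>\<close>, and the remaining
  roots have modulus below \<open>\<delta>\<close> (\<open>linear_recurrence_bounded\<close>).
\<close>

section \<open>Edges of the Newton-Puiseux diagram\<close>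

lemma newton_diagram_point:
  assumes "j \<le> m" "a j \<noteq> 0" "real j \<le> x" "y \<le> real (degree (a j))"
  shows "(x, y) \<in> newton_diagram m a"
  unfolding newton_diagram_def by (rule hull_inc) (use assms in auto)

lemma convex_newton_diagram: "convex (newton_diagram m a)"
  by (simp add: newton_diagram_def)

lemma newton_vertex_not_between:
  assumes "j \<in> newton_vertices m a" "P \<in> newton_diagram m a" "R \<in> newton_diagram m a"
  shows "newton_point a j \<notin> open_segment P R"
  using assms by (auto simp: newton_vertices_def extreme_point_of_def)

text \<open>
  The diagram contains everything below each of its points, so a point above a vertex would
  put this vertex inside a vertical segment.
\<close>

lemma newton_vertex_top:
  assumes j: "j \<in> newton_vertices m a" and y: "(real j, y) \<in> newton_diagram m a"
  shows "y \<le> real (degree (a j))"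
proof (rule ccontr)
  assume "\<not> y \<le> real (degree (a j))"
  then have gt: "y > real (degree (a j))" by simp
  define d where "d = real (degree (a j))"
  \<comment> \<open>the weight for which the convex combination of \<open>d - 1\<close> and \<open>y\<close> is \<open>d\<close>\<close>
  define t where "t = 1 / (y - d + 1)"
  have t: "0 < t" "t < 1" using gt by (auto simp: t_def d_def)
  have e: "(1 - t) * (d - 1) + t * y = d"
  proof -
    have "t * (y - d + 1) = 1" using gt by (simp add: t_def d_def)
    then show ?thesis by (simp add: algebra_simps)
  qed
  have "(real j, d - 1) \<in> newton_diagram m a"
    by (rule newton_diagram_point) (use j in \<open>auto simp: newton_vertices_def d_def\<close>)
  moreover have "newton_point a j \<in> open_segment (real j, d - 1) (real j, y)"
    unfolding in_segment newton_point_def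
    using t gt e by (auto simp: d_def algebra_simps intro!: exI[of _ t])
  ultimately show False using newton_vertex_not_between[OF j] y by blast
qed

text \<open>
  By convexity the chord from \<open>i\<close> to \<open>l\<close> belongs to the diagram. Over \<open>j\<close> it passes neither above
  the vertex, by the previous lemma, nor through it, since a vertex is not an inner point of
  a segment.
\<close>

lemma newton_vertex_above_chord:
  assumes j: "j \<in> newton_vertices m a"
    and i: "i \<le> m" "a i \<noteq> 0" and l: "l \<le> m" "a l \<noteq> 0" and ijl: "i < j" "j < l"
  shows "real (degree (a i)) * (real l - real j) + real (degree (a l)) * (real j - real i)
           < real (degree (a j)) * (real l - real i)"
proof -
  define t where "t = (real j - real i) / (real l - real i)"
  have t: "0 < t" "t < 1" using ijl by (auto simp: t_def)
  have tl: "t * (real l - real i) = real j - real i" using ijl by (simp add: t_def)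
  define y where "y = (1 - t) * real (degree (a i)) + t * real (degree (a l))"
  have x: "(1 - t) * real i + t * real l = real j" using tl by (simp add: algebra_simps)
  have seg: "(real j, y) \<in> open_segment (newton_point a i) (newton_point a l)"
    unfolding in_segment newton_point_def
    using t ijl x by (auto simp: y_def intro!: exI[of _ t])
  have P: "newton_point a i \<in> newton_diagram m a" "newton_point a l \<in> newton_diagram m a"
    unfolding newton_point_def
    using newton_diagram_point[of i m a] newton_diagram_point[of l m a] i l by auto
  have "open_segment (newton_point a i) (newton_point a l) \<subseteq> newton_diagram m a"
    using convex_newton_diagram P by (metis convex_contains_open_segment)
  then have le: "y \<le> real (degree (a j))" using newton_vertex_top[OF j] seg by blast
  have "y \<noteq> real (degree (a j))"
    using newton_vertex_not_between[OF j P] seg by (auto simp: newton_point_def)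
  with le have "y < real (degree (a j))" by simp
  then have "y * (real l - real i) < real (degree (a j)) * (real l - real i)"
    using ijl by simp
  moreover have "y * (real l - real i)
      = real (degree (a i)) * ((real l - real i) - t * (real l - real i))
        + real (degree (a l)) * (t * (real l - real i))"
    by (simp add: y_def algebra_simps)
  ultimately show ?thesis unfolding tl by simp
qed

text \<open>
  The diagram extends horizontally to the right, so a vertex that is not higher than an earlier
  one would be an inner point of a horizontal segment. This is why all edges have positive
  slope.
\<close>

lemma newton_vertices_increasing:
  assumes i: "i \<in> newton_vertices m a" and j: "j \<in> newton_vertices m a" and "i < j"
  shows "degree (a i) < degree (a j)"
proof (rule ccontr)
  assume "\<not> ?thesis"
  then have le: "degree (a j) \<le> degree (a i)" by simp
  define d where "d = real (degree (a j))"
  have P: "(real i, d) \<in> newton_diagram m a" "(real j + 1, d) \<in> newton_diagram m a"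
    using i j le newton_diagram_point[of i m a] newton_diagram_point[of j m a]
    by (auto simp: newton_vertices_def d_def)
  define t where "t = (real j - real i) / (real j + 1 - real i)"
  have t: "0 < t" "t < 1" using \<open>i < j\<close> by (auto simp: t_def)
  have tl: "t * (real j + 1 - real i) = real j - real i" using \<open>i < j\<close> by (simp add: t_def)
  have "newton_point a j \<in> open_segment (real i, d) (real j + 1, d)"
    unfolding in_segment newton_point_def
    using t tl \<open>i < j\<close> by (auto simp: d_def algebra_simps intro!: exI[of _ t])
  then show False using newton_vertex_not_between[OF j P] by blast
qed

lemma finite_newton_vertices: "finite (newton_vertices m a)"
  by (rule finite_subset[of _ "{..m}"]) (auto simp: newton_vertices_def)

lemma newton_index_consecutive:
  assumes k: "k \<in> {1..newton_K m a}"
  shows "newton_index m a (k - 1) \<in> newton_vertices m a"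
    and "newton_index m a k \<in> newton_vertices m a"
    and "newton_index m a (k - 1) < newton_index m a k"
    and "\<And>j. j \<in> newton_vertices m a \<Longrightarrow>
           \<not> (newton_index m a (k - 1) < j \<and> j < newton_index m a k)"
proof -
  let ?xs = "sorted_list_of_set (newton_vertices m a)"
  have len: "length ?xs = card (newton_vertices m a)" by simp
  have set: "set ?xs = newton_vertices m a" using finite_newton_vertices by simp
  have sorted: "sorted_wrt (<) ?xs" by (rule strict_sorted_list_of_set)
  have kl: "k < length ?xs" "k - 1 < k" using k by (auto simp: newton_K_def)
  show "newton_index m a (k - 1) \<in> newton_vertices m a"
    "newton_index m a k \<in> newton_vertices m a"
    using kl set nth_mem unfolding newton_index_def by (metis less_trans)+
  show "newton_index m a (k - 1) < newton_index m a k"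
    unfolding newton_index_def using sorted kl by (simp add: sorted_wrt_nth_less)
  fix j assume "j \<in> newton_vertices m a"
  then obtain i where i: "i < length ?xs" "j = ?xs ! i" by (metis set in_set_conv_nth)
  have "i \<le> k - 1 \<or> k \<le> i" by auto
  then show "\<not> (newton_index m a (k - 1) < j \<and> j < newton_index m a k)"
  proof
    assume "i \<le> k - 1"
    then have "j \<le> newton_index m a (k - 1)"
      unfolding newton_index_def i(2) using kl sorted_nth_mono[of ?xs i "k - 1"] by simp
    then show ?thesis by simp
  next
    assume "k \<le> i"
    then have "newton_index m a k \<le> j"
      unfolding newton_index_def i(2) using i(1) sorted_nth_mono[of ?xs k i] by simp
    then show ?thesis by simp
  qed
qed

text \<open>
  A linear functional that increases upwards and to the left attains its maximum over the
  diagram at points \<open>(i, d(i))\<close>; the leftmost of these is a vertex. To see this, enclose the diagram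
  in the half-plane \<open>C\<close> that contains only the part of its boundary line from the maximal point
  to the right. This set is still convex, and the maximal point is an end of the
  boundary part.
\<close>

lemma newton_vertex_if_maximal:
  fixes s t H :: real
  assumes j: "j \<le> m" "a j \<noteq> 0" and st: "0 < s" "0 < t"
    and H: "t * real (degree (a j)) - s * real j = H"
    and le: "\<And>i. i \<le> m \<Longrightarrow> a i \<noteq> 0 \<Longrightarrow> t * real (degree (a i)) - s * real i \<le> H"
    and least: "\<And>i. i \<le> m \<Longrightarrow> a i \<noteq> 0 \<Longrightarrow> t * real (degree (a i)) - s * real i = H \<Longrightarrow> j \<le> i"
  shows "j \<in> newton_vertices m a"
proof -
  define g where "g = (\<lambda>P :: real \<times> real. t * snd P - s * fst P)"
  \<comment> \<open>an open half-plane together with a closed ray of its boundary\<close>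
  define C where "C = {P. g P < H \<or> (g P = H \<and> real j \<le> fst P)}"
  have g_lin: "g (u *\<^sub>R P + v *\<^sub>R R) = u * g P + v * g R" for u v P R
    by (simp add: g_def algebra_simps)
  have C_cases: "g P = H \<and> g R = H" if "P \<in> C" "R \<in> C" "0 < u" "0 < v" "u + v = 1"
      "u * g P + v * g R \<ge> H" for u v P R
  proof -
    have "u * g P \<le> u * H" "v * g R \<le> v * H" using that by (auto simp: C_def)
    moreover have "u * H + v * H = H" using that(5) by (metis distrib_right mult_1)
    ultimately have "u * g P = u * H" "v * g R = v * H" using that(6) by linarith+
    then show ?thesis using that by simp
  qed
  have "convex C"
  proof (rule convexI)
    fix P R :: "real \<times> real" and u v :: real
    assume PR: "P \<in> C" "R \<in> C" and uv: "0 \<le> u" "0 \<le> v" "u + v = 1"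
    consider "u = 0" | "v = 0" | "0 < u" "0 < v" using uv by linarith
    then show "u *\<^sub>R P + v *\<^sub>R R \<in> C"
    proof cases
      case 3
      show ?thesis
      proof (cases "u * g P + v * g R \<ge> H")
        case True
        with C_cases[OF PR 3 uv(3)] have e: "g P = H" "g R = H" by auto
        then have "real j \<le> fst P" "real j \<le> fst R" using PR by (auto simp: C_def)
        then have "u * real j + v * real j \<le> u * fst P + v * fst R"
          using uv by (intro add_mono mult_left_mono) auto
        then have "real j \<le> u * fst P + v * fst R"
          using uv(3) by (metis distrib_right mult_1)
        moreover have "u * g P + v * g R = H" using e uv(3) by (metis distrib_right mult_1)
        ultimately show ?thesis unfolding C_def mem_Collect_eq g_lin by simp
      next
        case False
        then show ?thesis unfolding C_def mem_Collect_eq g_lin by simp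
      qed
    qed (use PR uv in auto)
  qed
  moreover have "(\<Union>i\<in>{i. i \<le> m \<and> a i \<noteq> 0}. {(x, y). x \<ge> real i \<and> y \<le> real (degree (a i))}) \<subseteq> C"
  proof clarify
    fix i x y assume i: "i \<le> m" "a i \<noteq> 0" and xy: "real i \<le> x" "y \<le> real (degree (a i))"
    have "t * y \<le> t * real (degree (a i))" and sx: "s * real i \<le> s * x" using st xy by auto
    then have l1: "g (x, y) \<le> t * real (degree (a i)) - s * real i" by (simp add: g_def)
    have l2: "\<dots> \<le> H" using le i by blast
    show "(x, y) \<in> C"
    proof (cases "g (x, y) = H")
      case True
      then have "t * real (degree (a i)) - s * real i = H" using l1 l2 by simp
      then have "j \<le> i" using least i by blast
      then show ?thesis using True xy by (auto simp: C_def)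
    qed (use l1 l2 in \<open>auto simp: C_def\<close>)
  qed
  ultimately have sub: "newton_diagram m a \<subseteq> C"
    unfolding newton_diagram_def by (intro hull_minimal) auto
  have "newton_point a j \<notin> open_segment P R"
    if "P \<in> newton_diagram m a" "R \<in> newton_diagram m a" for P R
  proof
    assume "newton_point a j \<in> open_segment P R"
    then obtain v where v: "0 < v" "v < 1" and PR: "P \<noteq> R"
      and e: "newton_point a j = (1 - v) *\<^sub>R P + v *\<^sub>R R" by (auto simp: in_segment)
    have C: "P \<in> C" "R \<in> C" using sub that by auto
    have gj: "g (newton_point a j) = H" using H by (simp add: g_def newton_point_def)
    have "g P = H \<and> g R = H"
      by (rule C_cases[OF C, of "1 - v" v]) (use v gj e g_lin in auto)
    then have f: "real j \<le> fst P" "real j \<le> fst R" and gg: "g P = g R"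
      using C by (auto simp: C_def)
    have "real j = (1 - v) * fst P + v * fst R"
      using arg_cong[OF e, of fst] by (simp add: newton_point_def)
    then have "(1 - v) * (fst P - real j) + v * (fst R - real j) = 0"
      by (simp add: algebra_simps)
    moreover have "0 \<le> (1 - v) * (fst P - real j)" "0 \<le> v * (fst R - real j)"
      using v f by auto
    ultimately have "(1 - v) * (fst P - real j) = 0" "v * (fst R - real j) = 0" by linarith+
    then have "fst P = fst R" using v by simp
    with gg st have "snd P = snd R" by (simp add: g_def)
    with \<open>fst P = fst R\<close> PR show False by (simp add: prod_eq_iff)
  qed
  moreover have "newton_point a j \<in> newton_diagram m a"
    using j by (auto simp: newton_point_def intro!: newton_diagram_point)
  ultimately show ?thesis using j by (auto simp: newton_vertices_def extreme_point_of_def)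
qed

text \<open>
  Consecutive vertices span an edge: no point \<open>(j, d(j))\<close> lies above the line through them.
  To the left or to the right of both vertices, such a point would contradict the strict concavity
  at the nearer vertex. Strictly between them, the leftmost of the points that lie
  highest above the line would be another vertex. The differences are stated in integers because
  they become exponents of \<open>\<rho>\<close>.
\<close>

lemma newton_edge:
  fixes m a k
  defines "u \<equiv> newton_index m a (k - 1)" and "M \<equiv> edge_M m a k" and "N \<equiv> edge_N m a k"
  assumes k: "k \<in> {1..newton_K m a}"
  shows "u \<in> edge_indices m a k"
    and "newton_index m a k \<in> edge_indices m a k"
    and "0 < M" and "0 < N" and "degree (a (newton_index m a k)) = degree (a u) + M"
    and "\<And>j. j \<le> m \<Longrightarrow> a j \<noteq> 0 \<Longrightarrow>
           int N * int (degree (a j)) - int M * int j \<le> int N * int (degree (a u)) - int M * int u"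
    and "\<And>j. j \<le> m \<Longrightarrow> a j \<noteq> 0 \<Longrightarrow> j \<in> edge_indices m a k \<longleftrightarrow>
           int N * int (degree (a j)) - int M * int j = int N * int (degree (a u)) - int M * int u"
    and "\<And>j. j \<in> edge_indices m a k \<Longrightarrow> u \<le> j \<and> j \<le> newton_index m a k"
proof -
  define v where "v = newton_index m a k"
  note cons = newton_index_consecutive[OF k, folded u_def v_def]
  note uV = cons(1) and vV = cons(2) and uv = cons(3)
  have u: "u \<le> m" "a u \<noteq> 0" and v: "v \<le> m" "a v \<noteq> 0"
    using uV vV by (auto simp: newton_vertices_def)
  have du: "degree (a u) < degree (a v)" using newton_vertices_increasing[OF uV vV uv] .
  have M: "M = degree (a v) - degree (a u)" and N: "N = v - u"
    by (simp_all add: M_def N_def edge_M_def edge_N_def u_def v_def)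
  show pos: "0 < M" "0 < N" using du uv by (auto simp: M N)
  show dv: "degree (a (newton_index m a k)) = degree (a u) + M"
    using du by (simp add: M flip: v_def)
  have Mr: "real M = real (degree (a v)) - real (degree (a u))" and Nr: "real N = real v - real u"
    using du uv by (auto simp: M N)
  \<comment> \<open>the height above the line through the two vertices, up to scaling and a constant\<close>
  define \<phi> where "\<phi> = (\<lambda>j. real N * real (degree (a j)) - real M * real j)"
  have \<phi>uv: "\<phi> v = \<phi> u" by (simp add: \<phi>_def Mr Nr algebra_simps)
  have left: "\<phi> j < \<phi> u" if "j \<le> m" "a j \<noteq> 0" "j < u" for j
    using newton_vertex_above_chord[OF uV that(1,2) v that(3) uv]
    by (simp add: \<phi>_def Mr Nr algebra_simps)
  have right: "\<phi> j < \<phi> u" if "j \<le> m" "a j \<noteq> 0" "v < j" for j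
    using newton_vertex_above_chord[OF vV u that(1,2) uv that(3)]
    by (simp add: \<phi>_def Mr Nr algebra_simps)
  have max: "\<phi> j \<le> \<phi> u" if j: "j \<le> m" "a j \<noteq> 0" for j
  proof (rule ccontr)
    assume gt: "\<not> \<phi> j \<le> \<phi> u"
    define S where "S = {j. j \<le> m \<and> a j \<noteq> 0}"
    have fin: "finite S" and ne: "S \<noteq> {}" using j by (auto simp: S_def)
    define H where "H = Max (\<phi> ` S)"
    have H: "\<phi> i \<le> H" if "i \<in> S" for i using fin that by (auto simp: H_def)
    have "H \<in> \<phi> ` S" unfolding H_def using fin ne by (intro Max_in) auto
    then have ex: "\<exists>i. i \<in> S \<and> \<phi> i = H" by auto
    define w where "w = (LEAST i. i \<in> S \<and> \<phi> i = H)"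
    have w: "w \<in> S" "\<phi> w = H" using LeastI_ex[OF ex] by (auto simp: w_def)
    have least: "w \<le> i" if "i \<in> S" "\<phi> i = H" for i
      unfolding w_def using that by (intro Least_le) auto
    have "w \<in> newton_vertices m a"
      by (rule newton_vertex_if_maximal[of w m a "real M" "real N" H])
        (use w H least pos in \<open>auto simp: S_def \<phi>_def\<close>)
    moreover have "\<phi> u < \<phi> w" using gt H[of j] j w(2) by (auto simp: S_def)
    then have "u < w \<and> w < v"
      using left[of w] right[of w] w(1) \<phi>uv by (cases w u rule: linorder_cases; cases w v rule: linorder_cases) (auto simp: S_def)
    ultimately show False using cons(4) by blast
  qed
  have conv: "\<phi> j = real_of_int (int N * int (degree (a j)) - int M * int j)" for j
    by (simp add: \<phi>_def)
  show "int N * int (degree (a j)) - int M * int j \<le> int N * int (degree (a u)) - int M * int u"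
    if "j \<le> m" "a j \<noteq> 0" for j
    using max[OF that] unfolding conv by linarith
  have hull: "newton_point a j \<in> affine hull {newton_point a u, newton_point a v} \<longleftrightarrow> \<phi> j = \<phi> u" for j
  proof
    assume "newton_point a j \<in> affine hull {newton_point a u, newton_point a v}"
    then obtain t where "newton_point a j = newton_point a u + t *\<^sub>R (newton_point a v - newton_point a u)"
      unfolding affine_hull_2_alt by auto
    then have "real j = real u + t * N" "real (degree (a j)) = real (degree (a u)) + t * M"
      by (auto simp: newton_point_def Mr Nr)
    then show "\<phi> j = \<phi> u" by (simp add: \<phi>_def algebra_simps)
  next
    assume e: "\<phi> j = \<phi> u"
    define t where "t = (real j - real u) / real N"
    have t: "t * N = real j - real u" using pos by (simp add: t_def)
    have "real N * (real (degree (a j)) - real (degree (a u))) = real M * (t * N)"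
      using e unfolding t by (simp add: \<phi>_def algebra_simps)
    then have "real (degree (a j)) - real (degree (a u)) = t * M" using pos by simp
    with t have "newton_point a j = newton_point a u + t *\<^sub>R (newton_point a v - newton_point a u)"
      by (auto simp: newton_point_def Mr Nr)
    then show "newton_point a j \<in> affine hull {newton_point a u, newton_point a v}"
      unfolding affine_hull_2_alt by blast
  qed
  show iff: "j \<in> edge_indices m a k \<longleftrightarrow>
      int N * int (degree (a j)) - int M * int j = int N * int (degree (a u)) - int M * int u"
    if "j \<le> m" "a j \<noteq> 0" for j
    using that hull[of j] unfolding edge_indices_def conv of_int_eq_iff
    by (simp add: u_def v_def)
  show "u \<in> edge_indices m a k" using u iff by auto
  have "v \<in> edge_indices m a k" using v iff[OF v] \<phi>uv unfolding conv of_int_eq_iff by auto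
  then show "newton_index m a k \<in> edge_indices m a k" by (simp add: v_def)
  show "u \<le> j \<and> j \<le> newton_index m a k" if "j \<in> edge_indices m a k" for j
  proof -
    have j: "j \<le> m" "a j \<noteq> 0" using that by (auto simp: edge_indices_def)
    have "\<phi> j = \<phi> u" using iff[OF j] that unfolding conv of_int_eq_iff by simp
    then show ?thesis using left[OF j] right[OF j] by (fold v_def) force
  qed
qed

section \<open>Linear recurrences and geometric decay\<close>

text \<open>
  The constant serves all \<open>n\<close>; for positive \<open>\<delta>\<close> this is the same as \<open>O(\<delta>\<^sup>n)\<close>, but recurrences can
  be followed without keeping track of thresholds.
\<close>

definition geometrically_bounded :: "real \<Rightarrow> (nat \<Rightarrow> complex) \<Rightarrow> bool" where
  "geometrically_bounded \<delta> \<gamma> \<longleftrightarrow> (\<exists>C. \<forall>n. cmod (\<gamma> n) \<le> C * \<delta> ^ n)"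

lemma geometrically_bounded_iff_bigo:
  assumes "0 < \<delta>"
  shows "geometrically_bounded \<delta> \<gamma> \<longleftrightarrow> \<gamma> \<in> O(\<lambda>n. complex_of_real (\<delta> ^ n))"
proof
  assume "geometrically_bounded \<delta> \<gamma>"
  then obtain C where "\<And>n. cmod (\<gamma> n) \<le> C * \<delta> ^ n" by (auto simp: geometrically_bounded_def)
  then show "\<gamma> \<in> O(\<lambda>n. complex_of_real (\<delta> ^ n))"
    using assms by (intro bigoI[of _ C]) (auto simp: norm_power)
next
  assume "\<gamma> \<in> O(\<lambda>n. complex_of_real (\<delta> ^ n))"
  then obtain c where "\<forall>\<^sub>F n in sequentially. cmod (\<gamma> n) \<le> c * cmod (complex_of_real (\<delta> ^ n))"
    by (elim landau_o.bigE) auto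
  then obtain n0 where n0: "\<And>n. n \<ge> n0 \<Longrightarrow> cmod (\<gamma> n) \<le> c * \<delta> ^ n"
    using assms by (auto simp: eventually_sequentially norm_power)
  define C where "C = max c (\<Sum>n<n0. cmod (\<gamma> n) / \<delta> ^ n)"
  have "cmod (\<gamma> n) \<le> C * \<delta> ^ n" for n
  proof (cases "n < n0")
    case True
    have "cmod (\<gamma> n) / \<delta> ^ n \<le> (\<Sum>n<n0. cmod (\<gamma> n) / \<delta> ^ n)"
      using True assms by (intro member_le_sum) auto
    also have "\<dots> \<le> C" by (simp add: C_def)
    finally show ?thesis using assms by (simp add: divide_simps)
  next
    case False
    then have "cmod (\<gamma> n) \<le> c * \<delta> ^ n" using n0 by simp
    also have "\<dots> \<le> C * \<delta> ^ n" using assms by (intro mult_right_mono) (auto simp: C_def)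
    finally show ?thesis .
  qed
  then show "geometrically_bounded \<delta> \<gamma>" by (auto simp: geometrically_bounded_def)
qed

lemma geometrically_bounded_eventuallyI:
  assumes "0 < \<delta>" "\<And>n. n \<ge> n0 \<Longrightarrow> cmod (\<gamma> n) \<le> C * \<delta> ^ n"
  shows "geometrically_bounded \<delta> \<gamma>"
  unfolding geometrically_bounded_iff_bigo[OF assms(1)]
  using assms
  by (intro bigoI[of _ C]) (auto simp: norm_power eventually_sequentially intro!: exI[of _ n0])

lemma geometrically_bounded_mono:
  assumes "geometrically_bounded \<delta> \<gamma>" "0 < \<delta>" "\<delta> \<le> \<delta>'"
  shows "geometrically_bounded \<delta>' \<gamma>"
proof -
  obtain C where C: "\<And>n. cmod (\<gamma> n) \<le> C * \<delta> ^ n"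
    using assms by (auto simp: geometrically_bounded_def)
  have "0 \<le> C" using order_trans[OF norm_ge_zero C[of 0]] by simp
  then have "C * \<delta> ^ n \<le> C * \<delta>' ^ n" for n
    using assms by (intro mult_left_mono power_mono) auto
  then show ?thesis unfolding geometrically_bounded_def using C by (meson order_trans)
qed

lemma geometrically_bounded_lincomb:
  assumes "geometrically_bounded \<delta> \<gamma>" "geometrically_bounded \<delta> \<eta>" "0 < \<delta>"
  shows "geometrically_bounded \<delta> (\<lambda>n. c * \<gamma> n + d * \<eta> n)"
  using assms unfolding geometrically_bounded_iff_bigo[OF assms(3)]
  by (intro sum_in_bigo landau_o.big.mult_in_1[THEN landau_o.big.mult_in_1] ) (auto)

lemma geometrically_bounded_Suc:
  assumes "geometrically_bounded \<delta> \<gamma>"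
  shows "geometrically_bounded \<delta> (\<lambda>n. \<gamma> (Suc n))"
proof -
  obtain C where C: "\<And>n. cmod (\<gamma> n) \<le> C * \<delta> ^ n"
    using assms by (auto simp: geometrically_bounded_def)
  have "cmod (\<gamma> (Suc n)) \<le> (C * \<delta>) * \<delta> ^ n" for n using C[of "Suc n"] by (simp add: mult_ac)
  then show ?thesis unfolding geometrically_bounded_def by blast
qed

text \<open>
  For \<open>\<bar>\<kappa>\<bar> < \<delta>\<close> the recurrence is followed forwards, and the perturbation dominates. If \<open>\<bar>\<kappa>\<bar>\<close>
  exceeds \<open>\<delta>\<close> and \<open>\<delta>\<^sub>0\<close>, it is followed backwards from infinity: as long as \<open>\<bar>\<gamma>\<^sub>n\<bar>\<close> exceeds the
  bound \<open>B \<delta>\<^sup>n\<close>, the excess is multiplied by at least \<open>\<bar>\<kappa>\<bar>\<close> in each step, which contradicts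
  the growth \<open>\<delta>\<^sub>0\<^sup>n\<close> known in advance.
\<close>

lemma first_order_recurrence_bounded:
  assumes r: "geometrically_bounded \<delta> (\<lambda>n. \<gamma> (Suc n) - \<kappa> * \<gamma> n)"
    and \<gamma>: "geometrically_bounded \<delta>\<^sub>0 \<gamma>" and \<delta>: "0 < \<delta>" "0 < \<delta>\<^sub>0"
    and \<kappa>: "cmod \<kappa> < \<delta> \<or> \<delta> < cmod \<kappa> \<and> \<delta>\<^sub>0 < cmod \<kappa>"
  shows "geometrically_bounded \<delta> \<gamma>"
proof -
  obtain C where C: "\<And>n. cmod (\<gamma> (Suc n) - \<kappa> * \<gamma> n) \<le> C * \<delta> ^ n"
    using r by (auto simp: geometrically_bounded_def)
  from \<kappa> show ?thesis
  proof
    assume k: "cmod \<kappa> < \<delta>"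
    \<comment> \<open>large enough for \<open>\<bar>\<kappa>\<bar> B + C \<le> \<delta> B\<close>, so that the bound reproduces itself\<close>
    define B where "B = max (cmod (\<gamma> 0)) (C / (\<delta> - cmod \<kappa>))"
    have B: "C \<le> B * (\<delta> - cmod \<kappa>)"
    proof -
      have "C / (\<delta> - cmod \<kappa>) \<le> B" by (simp add: B_def)
      then show ?thesis using k by (simp add: pos_divide_le_eq)
    qed
    have "cmod (\<gamma> n) \<le> B * \<delta> ^ n" for n
    proof (induction n)
      case (Suc n)
      have "cmod (\<gamma> (Suc n)) \<le> cmod (\<kappa> * \<gamma> n) + cmod (\<gamma> (Suc n) - \<kappa> * \<gamma> n)"
        by (metis add.commute diff_add_cancel norm_triangle_ineq)
      also have "\<dots> \<le> cmod \<kappa> * (B * \<delta> ^ n) + C * \<delta> ^ n"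
        using Suc C[of n] by (auto simp: norm_mult intro!: add_mono mult_left_mono)
      also have "\<dots> \<le> cmod \<kappa> * (B * \<delta> ^ n) + B * (\<delta> - cmod \<kappa>) * \<delta> ^ n"
        using B \<delta> by (intro add_left_mono mult_right_mono) auto
      also have "\<dots> = B * \<delta> ^ Suc n" by (simp add: algebra_simps)
      finally show ?case .
    qed (simp add: B_def)
    then show ?thesis by (auto simp: geometrically_bounded_def)
  next
    assume k: "\<delta> < cmod \<kappa> \<and> \<delta>\<^sub>0 < cmod \<kappa>"
    obtain C0 where C0: "\<And>n. cmod (\<gamma> n) \<le> C0 * \<delta>\<^sub>0 ^ n"
      using \<gamma> by (auto simp: geometrically_bounded_def)
    have kpos: "0 < cmod \<kappa>" using k \<delta> by linarith
    \<comment> \<open>the solution of \<open>\<bar>\<kappa>\<bar> B = \<delta> B + C\<close>, for which the constant terms cancel in the step below\<close>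
    define B where "B = C / (cmod \<kappa> - \<delta>)"
    have B: "B * (cmod \<kappa> - \<delta>) = C" using k by (simp add: B_def)
    have B0: "0 \<le> B" using order_trans[OF norm_ge_zero C[of 0]] k by (simp add: B_def)
    define D where "D = (\<lambda>n. cmod (\<gamma> n) - B * \<delta> ^ n)"
    have step: "cmod \<kappa> * D n \<le> D (Suc n)" for n
    proof -
      have "cmod \<kappa> * cmod (\<gamma> n) \<le> cmod (\<gamma> (Suc n)) + cmod (\<gamma> (Suc n) - \<kappa> * \<gamma> n)"
        by (metis norm_minus_commute norm_mult norm_triangle_sub)
      also have "\<dots> \<le> cmod (\<gamma> (Suc n)) + B * (cmod \<kappa> - \<delta>) * \<delta> ^ n" using C B by simp
      finally show ?thesis by (simp add: D_def algebra_simps)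
    qed
    have iter: "cmod \<kappa> ^ h * D n \<le> D (n + h)" for n h
    proof (induction h)
      case (Suc h)
      have "cmod \<kappa> ^ Suc h * D n = cmod \<kappa> * (cmod \<kappa> ^ h * D n)" by simp
      also have "\<dots> \<le> cmod \<kappa> * D (n + h)" using Suc by (intro mult_left_mono) auto
      also have "\<dots> \<le> D (n + Suc h)" using step by simp
      finally show ?case .
    qed simp
    have "D n \<le> 0" for n
    proof (rule LIMSEQ_le_const)
      have "(\<lambda>h. C0 * \<delta>\<^sub>0 ^ n * (\<delta>\<^sub>0 / cmod \<kappa>) ^ h) \<longlonglongrightarrow> C0 * \<delta>\<^sub>0 ^ n * 0"
        using k \<delta> kpos by (intro tendsto_intros LIMSEQ_power_zero) auto
      then show "(\<lambda>h. C0 * \<delta>\<^sub>0 ^ n * (\<delta>\<^sub>0 / cmod \<kappa>) ^ h) \<longlonglongrightarrow> 0" by simp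
      have "D n \<le> C0 * \<delta>\<^sub>0 ^ n * (\<delta>\<^sub>0 / cmod \<kappa>) ^ h" for h
      proof -
        have "cmod \<kappa> ^ h * D n \<le> cmod (\<gamma> (n + h))" using iter[of h n] B0 \<delta>
          by (simp add: D_def) (smt (verit, best) mult_nonneg_nonneg zero_le_power)
        also have "\<dots> \<le> C0 * \<delta>\<^sub>0 ^ (n + h)" by (rule C0)
        finally show ?thesis using kpos by (simp add: field_simps power_add)
      qed
      then show "\<exists>N. \<forall>h\<ge>N. D n \<le> C0 * \<delta>\<^sub>0 ^ n * (\<delta>\<^sub>0 / cmod \<kappa>) ^ h" by blast
    qed
    then show ?thesis unfolding geometrically_bounded_def D_def by (auto intro!: exI[of _ B])
  qed
qed

text \<open>
  The polynomial \<open>R\<close> evaluated at the shift \<open>\<gamma> \<mapsto> (\<lambda>n. \<gamma> (n + 1))\<close>.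
\<close>

definition shift_operator :: "complex poly \<Rightarrow> (nat \<Rightarrow> complex) \<Rightarrow> nat \<Rightarrow> complex" where
  "shift_operator R \<gamma> n = (\<Sum>t\<le>degree R. coeff R t * \<gamma> (n + t))"

lemma shift_operator_cutoff:
  assumes "degree R \<le> K"
  shows "shift_operator R \<gamma> n = (\<Sum>t\<le>K. coeff R t * \<gamma> (n + t))"
  unfolding shift_operator_def
  by (rule sum.mono_neutral_left) (use assms in \<open>auto simp: coeff_eq_0\<close>)

text \<open>
  Products of polynomials become compositions of operators, so a recurrence can be resolved
  one root at a time.
\<close>

lemma shift_operator_linear_factor:
  "shift_operator ([:-\<kappa>, 1:] * R) \<gamma> n = shift_operator R \<gamma> (Suc n) - \<kappa> * shift_operator R \<gamma> n"
proof -
  have deg: "degree ([:-\<kappa>, 1:] * R) \<le> Suc (degree R)"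
    by (rule order_trans[OF degree_mult_le]) simp
  have c: "coeff ([:-\<kappa>, 1:] * R) t = (case t of 0 \<Rightarrow> 0 | Suc s \<Rightarrow> coeff R s) - \<kappa> * coeff R t" for t
    by (simp add: coeff_pCons split: nat.split)
  have "shift_operator ([:-\<kappa>, 1:] * R) \<gamma> n =
      (\<Sum>t\<le>Suc (degree R). (case t of 0 \<Rightarrow> 0 | Suc s \<Rightarrow> coeff R s) * \<gamma> (n + t))
      - \<kappa> * (\<Sum>t\<le>Suc (degree R). coeff R t * \<gamma> (n + t))"
    unfolding shift_operator_cutoff[OF deg] c
    by (simp add: algebra_simps sum_subtractf sum_distrib_left del: sum.atMost_Suc)
  also have "(\<Sum>t\<le>Suc (degree R). (case t of 0 \<Rightarrow> 0 | Suc s \<Rightarrow> coeff R s) * \<gamma> (n + t))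
      = shift_operator R \<gamma> (Suc n)"
    unfolding sum.atMost_Suc_shift by (simp add: shift_operator_def)
  also have "(\<Sum>t\<le>Suc (degree R). coeff R t * \<gamma> (n + t)) = shift_operator R \<gamma> n"
    by (rule shift_operator_cutoff[symmetric]) simp
  finally show ?thesis .
qed

lemma shift_operator_bounded:
  assumes "geometrically_bounded \<delta> \<gamma>" "0 < \<delta>"
  shows "geometrically_bounded \<delta> (shift_operator R \<gamma>)"
proof -
  have "geometrically_bounded \<delta> (\<lambda>n. \<gamma> (n + t))" for t
    by (induction t) (use assms in \<open>auto dest: geometrically_bounded_Suc\<close>)
  then show ?thesis
    unfolding geometrically_bounded_iff_bigo[OF assms(2)] shift_operator_def
    by (intro big_sum_in_bigo) (auto)
qed

text \<open>
  Split off a root of \<open>R\<close>. The remaining operator applied to \<open>\<gamma>\<close> is still bounded by a multiple of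
  \<open>\<delta>\<^sub>0\<^sup>n\<close> and solves a first-order recurrence, hence is bounded by a multiple of \<open>\<delta>\<^sup>n\<close>, and
  the degree has dropped.
\<close>

lemma linear_recurrence_bounded:
  assumes "R \<noteq> 0" and \<gamma>: "geometrically_bounded \<delta>\<^sub>0 \<gamma>" and \<delta>: "0 < \<delta>" "0 < \<delta>\<^sub>0"
    and r: "geometrically_bounded \<delta> (shift_operator R \<gamma>)"
    and roots: "\<And>\<kappa>. poly R \<kappa> = 0 \<Longrightarrow> cmod \<kappa> < \<delta> \<or> \<delta> < cmod \<kappa> \<and> \<delta>\<^sub>0 < cmod \<kappa>"
  shows "geometrically_bounded \<delta> \<gamma>"
  using assms(1) r roots
proof (induction "degree R" arbitrary: R)
  case 0
  then obtain c where c: "R = [:c:]" "c \<noteq> 0" by (metis degree_eq_zeroE pCons_0_0)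
  then have "shift_operator R \<gamma> = (\<lambda>n. c * \<gamma> n)" by (auto simp: shift_operator_def)
  then show ?case
    using 0 c unfolding geometrically_bounded_iff_bigo[OF \<delta>(1)] by simp
next
  case (Suc d)
  then have "coeff R (degree R) \<noteq> 0" "degree R \<in> {1..degree R}" by auto
  then obtain \<kappa> where "(\<Sum>i\<le>degree R. coeff R i * \<kappa> ^ i) = 0"
    using Cauchy_Integral_Formula.fundamental_theorem_of_algebra[of "coeff R" "degree R"] by blast
  then have \<kappa>: "poly R \<kappa> = 0" by (simp add: poly_altdef)
  then obtain R' where R: "R = [:-\<kappa>, 1:] * R'" by (metis dvdE poly_eq_0_iff_dvd)
  have R'0: "R' \<noteq> 0" using R Suc.prems by auto
  have "degree R = degree [:-\<kappa>, 1:] + degree R'"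
    unfolding R by (rule degree_mult_eq) (use R'0 in auto)
  then have d: "d = degree R'" using Suc.hyps by simp
  have "geometrically_bounded \<delta> (shift_operator R' \<gamma>)"
  proof (rule first_order_recurrence_bounded)
    show "geometrically_bounded \<delta> (\<lambda>n. shift_operator R' \<gamma> (Suc n) - \<kappa> * shift_operator R' \<gamma> n)"
      using Suc.prems(2) unfolding R
      by (subst (asm) shift_operator_linear_factor[abs_def]) simp
    show "geometrically_bounded \<delta>\<^sub>0 (shift_operator R' \<gamma>)"
      by (rule shift_operator_bounded) fact+
  qed (use \<delta> Suc.prems(3)[OF \<kappa>] in auto)
  then show ?case
    using Suc.hyps(1)[OF d R'0] Suc.prems(3) unfolding R by auto
qed

lemma shift_operator_geometric:
  "shift_operator R (\<lambda>n. c * \<kappa> ^ n) n = c * \<kappa> ^ n * poly R \<kappa>"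
  by (simp add: shift_operator_def poly_altdef sum_distrib_left power_add mult_ac)

section \<open>The recurrence of the Taylor coefficients\<close>

lemma has_fps_expansion_if_sums:
  fixes g :: "complex \<Rightarrow> complex"
  assumes "\<And>z. (\<lambda>n. c n * z ^ n) sums g z"
  shows "g has_fps_expansion Abs_fps c"
proof -
  have "conv_radius c = \<infinity>"
    by (rule conv_radius_inftyI'') (use assms sums_summable in blast)
  moreover have "eval_fps (Abs_fps c) = g"
    using assms by (auto simp: eval_fps_def fun_eq_iff sums_iff)
  ultimately show ?thesis
    by (simp add: has_fps_expansion_def fps_conv_radius_def)
qed

lemma sums_poly:
  fixes p :: "complex poly"
  shows "(\<lambda>n. coeff p n * z ^ n) sums poly p z"
  unfolding poly_altdef
  by (rule sums_finite) (auto simp: coeff_eq_0)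

lemma functional_equation_coeffs:
  fixes f :: "complex \<Rightarrow> complex"
  assumes f: "\<And>z. (\<lambda>n. \<alpha> n * z ^ n) sums f z"
    and eq: "\<And>z. (\<Sum>j\<le>m. poly (a j) z * f (q ^ j * z)) = poly b z"
  shows "(\<Sum>j\<le>m. \<Sum>i\<le>n. coeff (a j) i * (q ^ (j * (n - i)) * \<alpha> (n - i))) = coeff b n"
proof -
  have "(\<lambda>n. (q ^ (j * n) * \<alpha> n) * z ^ n) = (\<lambda>n. \<alpha> n * (q ^ j * z) ^ n)" for j z
    by (simp add: power_mult_distrib power_mult fun_eq_iff)
  then have "(\<lambda>n. (q ^ (j * n) * \<alpha> n) * z ^ n) sums f (q ^ j * z)" for j z
    using f[of "q ^ j * z"] by (simp only:)
  then have "(\<lambda>z. f (q ^ j * z)) has_fps_expansion Abs_fps (\<lambda>n. q ^ (j * n) * \<alpha> n)" for j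
    by (rule has_fps_expansion_if_sums)
  then have "(\<lambda>z. \<Sum>j\<le>m. poly (a j) z * f (q ^ j * z)) has_fps_expansion
      (\<Sum>j\<le>m. Abs_fps (coeff (a j)) * Abs_fps (\<lambda>n. q ^ (j * n) * \<alpha> n))"
    by (intro has_fps_expansion_sum has_fps_expansion_mult has_fps_expansion_if_sums[OF sums_poly])
  moreover have "(\<lambda>z. \<Sum>j\<le>m. poly (a j) z * f (q ^ j * z)) has_fps_expansion Abs_fps (coeff b)"
    unfolding eq by (intro has_fps_expansion_if_sums[OF sums_poly])
  ultimately have "(\<Sum>j\<le>m. Abs_fps (coeff (a j)) * Abs_fps (\<lambda>n. q ^ (j * n) * \<alpha> n)) = Abs_fps (coeff b)"
    by (rule fps_expansion_unique_complex)
  from arg_cong[OF this, of "\<lambda>F. fps_nth F n"] show ?thesis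
    by (simp add: fps_sum_nth fps_mult_nth atLeast0AtMost)
qed

text \<open>
  On the edge \<open>N (d(j) - d(u)) = M (j - u)\<close> with \<open>0 \<le> j - u \<le> N\<close>, so degrees increase strictly from
  the left end to the right end.
\<close>

lemma edge_indices_degree:
  assumes k: "k \<in> {1..newton_K m a}" and j: "j \<in> edge_indices m a k"
  defines "u \<equiv> newton_index m a (k - 1)"
  shows "degree (a u) \<le> degree (a j)" "degree (a j) \<le> degree (a u) + edge_M m a k"
    and "degree (a j) = degree (a u) \<longleftrightarrow> j = u"
    and "degree (a j) = degree (a u) + edge_M m a k \<longleftrightarrow> j = newton_index m a k"
proof -
  define M N v where "M = int (edge_M m a k)" and "N = int (edge_N m a k)" and "v = newton_index m a k"
  note edge = newton_edge[OF k, folded u_def v_def]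
  have M: "0 < M" and N: "0 < N" using edge(3,4) by (simp_all add: M_def N_def)
  have v: "int v = int u + N"
    using edge(4) newton_index_consecutive(3)[OF k] by (simp add: N_def u_def v_def edge_N_def)
  have jm: "j \<le> m" "a j \<noteq> 0" using j by (auto simp: edge_indices_def)
  have e: "N * (int (degree (a j)) - int (degree (a u))) = M * (int j - int u)"
    using edge(7)[OF jm] j by (simp add: M_def N_def algebra_simps)
  have uj: "0 \<le> int j - int u" "int j - int u \<le> N" using edge(8)[OF j] v by auto
  have "0 \<le> N * (int (degree (a j)) - int (degree (a u)))" unfolding e using uj M by simp
  then show "degree (a u) \<le> degree (a j)" using N by (simp add: zero_le_mult_iff)
  have "N * (int (degree (a j)) - int (degree (a u))) \<le> N * M"
    unfolding e using uj M by (subst (2) mult.commute) (intro mult_left_mono, auto)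
  then show "degree (a j) \<le> degree (a u) + edge_M m a k" using N by (simp add: M_def)
  show "degree (a j) = degree (a u) \<longleftrightarrow> j = u" using e M N by auto
  show "degree (a j) = degree (a u) + edge_M m a k \<longleftrightarrow> j = newton_index m a k"
  proof
    assume "degree (a j) = degree (a u) + edge_M m a k"
    then have "N * M = M * (int j - int u)" using e by (simp add: M_def)
    then have "N = int j - int u" using M by simp
    then show "j = newton_index m a k" using v by (simp add: v_def)
  next
    assume "j = newton_index m a k"
    then have "N * (int (degree (a j)) - int (degree (a u))) = N * M" using e v by (simp add: v_def)
    then show "degree (a j) = degree (a u) + edge_M m a k" using N by (simp add: M_def)
  qed
qed

lemma finite_edge_indices: "finite (edge_indices m a k)"
  by (rule finite_subset[of _ "{..m}"]) (auto simp: edge_indices_def)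

lemma edge_coeff_lead_nonzero:
  assumes "q \<noteq> 0" "\<rho> \<noteq> 0" "j \<in> edge_indices m a k"
  shows "edge_coeff q \<rho> m a k j (degree (a j)) \<noteq> 0"
  using assms by (auto simp: edge_coeff_def edge_indices_def)

text \<open>
  The two ends of the edge are the only indices that contribute to the constant and to the
  leading coefficient.
\<close>

lemma
  assumes k: "k \<in> {1..newton_K m a}" and q: "q \<noteq> 0" "\<rho> \<noteq> 0"
  shows coeff_char_poly_0: "coeff (char_poly q \<rho> m a k) 0 \<noteq> 0"
    and degree_char_poly: "degree (char_poly q \<rho> m a k) = edge_M m a k"
proof -
  define u where "u = newton_index m a (k - 1)"
  define v where "v = newton_index m a k"
  note edge = newton_edge[OF k, folded u_def v_def]
  note deg = edge_indices_degree[OF k, folded u_def v_def]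
  have c: "coeff (char_poly q \<rho> m a k) s =
      (\<Sum>j\<in>edge_indices m a k. if degree (a j) - degree (a u) = s then edge_coeff q \<rho> m a k j (degree (a j)) else 0)" for s
    by (simp add: char_poly_def coeff_sum u_def)
  have "coeff (char_poly q \<rho> m a k) 0 =
      (\<Sum>j\<in>edge_indices m a k. if j = u then edge_coeff q \<rho> m a k j (degree (a j)) else 0)"
    unfolding c
  proof (intro sum.cong refl)
    fix j assume j: "j \<in> edge_indices m a k"
    then have "degree (a j) - degree (a u) = 0 \<longleftrightarrow> j = u"
      using deg(1,3)[OF j] by (metis diff_is_0_eq le_antisym order_refl)
    then show "(if degree (a j) - degree (a u) = 0 then edge_coeff q \<rho> m a k j (degree (a j)) else 0) =
        (if j = u then edge_coeff q \<rho> m a k j (degree (a j)) else 0)" by simp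
  qed
  also have "\<dots> = edge_coeff q \<rho> m a k u (degree (a u))"
    using edge(1) finite_edge_indices by simp
  finally show c0: "coeff (char_poly q \<rho> m a k) 0 \<noteq> 0" using edge_coeff_lead_nonzero[OF q edge(1)] by simp
  have "coeff (char_poly q \<rho> m a k) (edge_M m a k) =
      (\<Sum>j\<in>edge_indices m a k. if j = v then edge_coeff q \<rho> m a k j (degree (a j)) else 0)"
    unfolding c
  proof (intro sum.cong refl)
    fix j assume j: "j \<in> edge_indices m a k"
    then have "degree (a j) - degree (a u) = edge_M m a k \<longleftrightarrow> j = v"
      using deg(1,4)[OF j] by auto
    then show "(if degree (a j) - degree (a u) = edge_M m a k then edge_coeff q \<rho> m a k j (degree (a j)) else 0) =
        (if j = v then edge_coeff q \<rho> m a k j (degree (a j)) else 0)" by simp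
  qed
  also have "\<dots> = edge_coeff q \<rho> m a k v (degree (a v))"
    using edge(2) finite_edge_indices by simp
  finally have cM: "coeff (char_poly q \<rho> m a k) (edge_M m a k) \<noteq> 0"
    using edge_coeff_lead_nonzero[OF q edge(2)] by simp
  have "degree (char_poly q \<rho> m a k) \<le> edge_M m a k"
    unfolding char_poly_def
    by (intro degree_sum_le finite_edge_indices order_trans[OF degree_monom_le])
      (use deg(2) in \<open>auto simp: u_def le_diff_conv add.commute[of "edge_M m a k"]\<close>)
  then show "degree (char_poly q \<rho> m a k) = edge_M m a k"
    using le_degree[OF cM] by simp
qed

lemma char_roots_iff:
  assumes "k \<in> {1..newton_K m a}" "q \<noteq> 0" "\<rho> \<noteq> 0"
  shows "\<kappa> \<in> char_roots q \<rho> m a k \<longleftrightarrow> poly (reflect_poly (char_poly q \<rho> m a k)) \<kappa> = 0"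
proof -
  have "poly (reflect_poly (char_poly q \<rho> m a k)) 0 \<noteq> 0"
    using coeff_char_poly_0[OF assms] by (auto simp: poly_0_coeff_0)
  then show ?thesis
    by (cases "\<kappa> = 0") (auto simp: char_roots_def poly_reflect_poly_nz)
qed

lemma finite_char_roots:
  assumes "k \<in> {1..newton_K m a}" "q \<noteq> 0" "\<rho> \<noteq> 0"
  shows "finite (char_roots q \<rho> m a k)"
proof -
  have "reflect_poly (char_poly q \<rho> m a k) \<noteq> 0"
    using coeff_char_poly_0[OF assms] by auto
  then have "finite {\<kappa>. poly (reflect_poly (char_poly q \<rho> m a k)) \<kappa> = 0}"
    by (rule poly_roots_finite)
  moreover have "char_roots q \<rho> m a k = {\<kappa>. poly (reflect_poly (char_poly q \<rho> m a k)) \<kappa> = 0}"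
    using char_roots_iff[OF assms] by blast
  ultimately show ?thesis by simp
qed

text \<open>
  Substitute \<open>\<alpha>\<^sub>n = \<beta>\<^sub>n \<rho>^(N n\<^sup>2)\<close> in the comparison of coefficients. Apart from a
  power of \<open>\<rho>\<close> common to all terms, the coefficient \<open>a\<^sub>j\<^sub>,\<^sub>i\<close> then contributes
  \<open>c\<^sub>j\<^sub>,\<^sub>i \<rho>^(2n(Mj - Ni)) \<beta>\<^sub>n\<^sub>-\<^sub>i\<close>. By \<open>newton_edge\<close> the number \<open>Mj - Ni\<close> is
  smallest precisely for \<open>i = d(j)\<close> with \<open>j\<close> on the edge. These terms make up the operator of the
  reflected characteristic polynomial, and all others are smaller at least by a factor
  \<open>\<bar>\<rho>\<bar>^(2n)\<close>.
\<close>

lemma char_poly_recurrence: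
  fixes \<beta> :: "nat \<Rightarrow> complex" and \<rho> q :: complex
  assumes k: "k \<in> {1..newton_K m a}" and q: "q \<noteq> 0" "cmod q < 1"
    and rho: "\<rho> ^ (2 * edge_M m a k) = q"
    and f: "\<And>z. (\<lambda>n. \<alpha> n * z ^ n) sums f z"
    and eq: "\<And>z. (\<Sum>j\<le>m. poly (a j) z * f (q ^ j * z)) = poly b z"
    and \<beta>: "\<And>n. \<alpha> n = \<beta> n * \<rho> ^ (edge_N m a k * n\<^sup>2)"
    and \<mu>: "0 < \<mu>" "geometrically_bounded \<mu> \<beta>"
  shows "geometrically_bounded ((cmod \<rho>)\<^sup>2 * \<mu>) (shift_operator (reflect_poly (char_poly q \<rho> m a k)) \<beta>)"
proof -
  define M N where "M = edge_M m a k" and "N = edge_N m a k"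
  define u where "u = newton_index m a (k - 1)"
  define P where "P = char_poly q \<rho> m a k"
  note edge = newton_edge[OF k, folded u_def M_def N_def]
  note deg = edge_indices_degree[OF k, folded u_def M_def]
  have rho0: "\<rho> \<noteq> 0" using rho q edge(3) by (auto simp: power_0_left M_def)
  have "cmod \<rho> ^ (2 * M) < 1" using q(2) rho by (simp add: M_def flip: norm_power)
  then have rho1: "cmod \<rho> < 1" using edge(3) by (simp add: power_less_one_iff)
  define A where "A = (SIGMA j:{j. j \<le> m \<and> a j \<noteq> 0}. {..degree (a j)})"
  define A0 where "A0 = (\<lambda>j. (j, degree (a j))) ` edge_indices m a k"
  define c where "c = (\<lambda>(j, i). edge_coeff q \<rho> m a k j i)"
  \<comment> \<open>the excess of \<open>Mj - Ni\<close> over its minimum, which is attained at the left end \<open>u\<close> of the edge\<close>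
  define e where "e = (\<lambda>(j, i). nat (int M * int j - int N * int i - (int M * int u - int N * int (degree (a u)))))"
  have finA: "finite A" by (auto simp: A_def)
  have A0A: "A0 \<subseteq> A" by (auto simp: A0_def A_def edge_indices_def)
  have e_nonneg: "0 \<le> int M * int j - int N * int i - (int M * int u - int N * int (degree (a u)))"
    and e_zero: "e (j, i) = 0 \<Longrightarrow> (j, i) \<in> A0" if "(j, i) \<in> A" for j i
  proof -
    have j: "j \<le> m" "a j \<noteq> 0" and i: "i \<le> degree (a j)" using that by (auto simp: A_def)
    have l1: "int N * int i \<le> int N * int (degree (a j))" using i by (intro mult_left_mono) auto
    with edge(6)[OF j]
    show nn: "0 \<le> int M * int j - int N * int i - (int M * int u - int N * int (degree (a u)))" by linarith
    assume "e (j, i) = 0"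
    then have z: "int M * int j - int N * int i - (int M * int u - int N * int (degree (a u))) = 0"
      using nn by (simp add: e_def)
    then have "int N * int i = int N * int (degree (a j))"
      using l1 edge(6)[OF j] by linarith
    then have "i = degree (a j)" using edge(4) by simp
    moreover have "j \<in> edge_indices m a k" using z l1 edge(6)[OF j] unfolding edge(7)[OF j] by linarith
    ultimately show "(j, i) \<in> A0" by (auto simp: A0_def)
  qed
  have e_int: "int (e (j, i)) = int M * int j - int N * int i - (int M * int u - int N * int (degree (a u)))"
    if "(j, i) \<in> A" for j i
    using e_nonneg[OF that] by (simp add: e_def)
  have e_A0: "e x = 0" if x: "x \<in> A0" for x
  proof -
    obtain j where j: "j \<in> edge_indices m a k" "x = (j, degree (a j))" using x unfolding A0_def by blast
    then have "j \<le> m" "a j \<noteq> 0" by (auto simp: edge_indices_def)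
    then show ?thesis using edge(7) j by (simp add: e_def)
  qed
  define dmax where "dmax = Max (insert 0 ((\<lambda>j. degree (a j)) ` {..m}))"
  have dmax: "degree (a j) \<le> dmax" if "j \<le> m" for j
    unfolding dmax_def using that by (intro Max_ge) auto
  define E where "E = int M * int u - int N * int (degree (a u))"
  have summand: "coeff (a j) i * (q ^ (j * (n - i)) * \<alpha> (n - i)) =
      \<rho> powi (int N * int n ^ 2 + 2 * int n * E) * (c (j, i) * \<rho> ^ (2 * n * e (j, i)) * \<beta> (n - i))"
    if "(j, i) \<in> A" "i \<le> n" for j i n
  proof -
    have q_powi: "q ^ x = \<rho> powi (2 * int M * int x)" for x
    proof -
      have "q ^ x = \<rho> ^ (2 * M * x)" by (simp add: power_mult M_def flip: rho)
      also have "\<dots> = \<rho> powi int (2 * M * x)" by (simp only: power_int_of_nat)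
      finally show ?thesis by simp
    qed
    have qi: "q powi (- int (j * i)) = \<rho> powi (- (2 * int M * int (j * i)))"
      unfolding power_int_minus power_int_of_nat q_powi by simp
    have l: "q ^ (j * (n - i)) * \<rho> ^ (N * (n - i)\<^sup>2)
        = \<rho> powi (2 * int M * int (j * (n - i)) + int (N * (n - i)\<^sup>2))"
      using rho0 by (simp only: q_powi power_int_add power_int_of_nat simp_thms)
    have ni: "int (n - i) = int n - int i" using that by simp
    have ex: "2 * int M * int (j * (n - i)) + int (N * (n - i)\<^sup>2)
      = (int N * int n ^ 2 + 2 * int n * E) + (int (N * i\<^sup>2) + - (2 * int M * int (j * i)) + int (2 * n * e (j, i)))"
      unfolding of_nat_mult of_nat_power ni e_int[OF that(1)] E_def
      by (simp add: algebra_simps power2_eq_square)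
    have r: "\<rho> powi (2 * int M * int (j * (n - i)) + int (N * (n - i)\<^sup>2)) =
        \<rho> powi (int N * int n ^ 2 + 2 * int n * E) *
          (\<rho> ^ (N * i\<^sup>2) * q powi (- int (j * i)) * \<rho> ^ (2 * n * e (j, i)))"
      unfolding ex qi using rho0 by (simp only: power_int_add power_int_of_nat simp_thms)
    have "coeff (a j) i * (q ^ (j * (n - i)) * \<alpha> (n - i)) =
        coeff (a j) i * \<beta> (n - i) * (q ^ (j * (n - i)) * \<rho> ^ (N * (n - i)\<^sup>2))"
      by (simp add: \<beta> N_def)
    also have "\<dots> = \<rho> powi (int N * int n ^ 2 + 2 * int n * E) * (c (j, i) * \<rho> ^ (2 * n * e (j, i)) * \<beta> (n - i))"
      unfolding l r by (simp add: c_def edge_coeff_def N_def mult_ac)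
    finally show ?thesis .
  qed
  have rec: "(\<Sum>x\<in>A. c x * \<rho> ^ (2 * n * e x) * \<beta> (n - snd x)) = 0" if n: "n \<ge> dmax" "n > degree b" for n
  proof -
    have "0 = (\<Sum>j\<le>m. \<Sum>i\<le>n. coeff (a j) i * (q ^ (j * (n - i)) * \<alpha> (n - i)))"
      using functional_equation_coeffs[OF f eq, of n] n by (simp add: coeff_eq_0)
    also have "\<dots> = (\<Sum>j\<in>{j. j \<le> m \<and> a j \<noteq> 0}. \<Sum>i\<le>n. coeff (a j) i * (q ^ (j * (n - i)) * \<alpha> (n - i)))"
      by (rule sum.mono_neutral_right) auto
    also have "\<dots> = (\<Sum>j\<in>{j. j \<le> m \<and> a j \<noteq> 0}. \<Sum>i\<le>degree (a j). coeff (a j) i * (q ^ (j * (n - i)) * \<alpha> (n - i)))"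
    proof (rule sum.cong[OF refl], rule sum.mono_neutral_right)
      fix j assume "j \<in> {j. j \<le> m \<and> a j \<noteq> 0}"
      then show "{..degree (a j)} \<subseteq> {..n}" using dmax[of j] n by auto
    qed (auto simp: coeff_eq_0)
    also have "\<dots> = (\<Sum>x\<in>A. coeff (a (fst x)) (snd x) * (q ^ (fst x * (n - snd x)) * \<alpha> (n - snd x)))"
      unfolding A_def by (subst sum.Sigma) (auto simp: case_prod_beta)
    also have "\<dots> = (\<Sum>x\<in>A. \<rho> powi (int N * int n ^ 2 + 2 * int n * E) * (c x * \<rho> ^ (2 * n * e x) * \<beta> (n - snd x)))"
    proof (intro sum.cong refl)
      fix x assume x: "x \<in> A"
      obtain j i where ji: "x = (j, i)" by force
      have "i \<le> n" using x dmax[of j] n unfolding ji by (auto simp: A_def)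
      then show "coeff (a (fst x)) (snd x) * (q ^ (fst x * (n - snd x)) * \<alpha> (n - snd x)) =
          \<rho> powi (int N * int n ^ 2 + 2 * int n * E) * (c x * \<rho> ^ (2 * n * e x) * \<beta> (n - snd x))"
        using summand[of j i n] x unfolding ji by simp
    qed
    finally show ?thesis using rho0 by (simp flip: sum_distrib_left)
  qed
  have main: "shift_operator (reflect_poly P) \<beta> n = (\<Sum>x\<in>A0. c x * \<beta> (n + M + degree (a u) - snd x))" for n
  proof -
    have degR: "degree (reflect_poly P) \<le> M"
      using degree_reflect_poly_le[of P] degree_char_poly[OF k q(1) rho0] by (simp add: P_def M_def)
    have degP: "degree P = M" using degree_char_poly[OF k q(1) rho0] by (simp add: P_def M_def)
    have "shift_operator (reflect_poly P) \<beta> n = (\<Sum>t\<le>M. coeff P (M - t) * \<beta> (n + t))"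
      unfolding shift_operator_cutoff[OF degR] by (intro sum.cong refl) (auto simp: coeff_reflect_poly degP)
    also have "\<dots> = (\<Sum>s\<le>M. coeff P s * \<beta> (n + M - s))"
      by (rule sum.reindex_bij_witness[of _ "\<lambda>s. M - s" "\<lambda>s. M - s"]) auto
    also have "\<dots> = (\<Sum>s\<le>M. \<Sum>j\<in>edge_indices m a k.
        if degree (a j) - degree (a u) = s then c (j, degree (a j)) * \<beta> (n + M - s) else 0)"
      unfolding P_def char_poly_def
      by (simp add: coeff_sum sum_distrib_right u_def c_def if_distrib[of "\<lambda>x. x * _"] cong: if_cong)
    also have "\<dots> = (\<Sum>j\<in>edge_indices m a k. \<Sum>s\<le>M.
        if degree (a j) - degree (a u) = s then c (j, degree (a j)) * \<beta> (n + M - s) else 0)"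
      by (rule sum.swap)
    also have "\<dots> = (\<Sum>j\<in>edge_indices m a k. c (j, degree (a j)) * \<beta> (n + M + degree (a u) - degree (a j)))"
    proof (intro sum.cong refl)
      fix j assume j: "j \<in> edge_indices m a k"
      have "degree (a j) - degree (a u) \<in> {..M}" using deg(2)[OF j] by (simp add: le_diff_conv add.commute)
      then have "(\<Sum>s\<le>M. if degree (a j) - degree (a u) = s then c (j, degree (a j)) * \<beta> (n + M - s) else 0)
          = c (j, degree (a j)) * \<beta> (n + M - (degree (a j) - degree (a u)))" by simp
      also have "n + M - (degree (a j) - degree (a u)) = n + M + degree (a u) - degree (a j)"
        using deg(1)[OF j] by simp
      finally show "(\<Sum>s\<le>M. if degree (a j) - degree (a u) = s then c (j, degree (a j)) * \<beta> (n + M - s) else 0)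
          = c (j, degree (a j)) * \<beta> (n + M + degree (a u) - degree (a j))" .
    qed
    also have "\<dots> = (\<Sum>x\<in>A0. c x * \<beta> (n + M + degree (a u) - snd x))"
      unfolding A0_def by (subst sum.reindex) (auto simp: inj_on_def)
    finally show ?thesis .
  qed
  obtain C where C: "\<And>n. cmod (\<beta> n) \<le> C * \<mu> ^ n" using \<mu>(2) by (auto simp: geometrically_bounded_def)
  \<comment> \<open>the operator at \<open>n\<close> belongs to the coefficient of index \<open>n + s\<close> in the functional equation\<close>
  define s where "s = M + degree (a u)"
  define r where "r = (cmod \<rho>)\<^sup>2"
  have r: "0 < r" "r < 1" using rho0 rho1 by (auto simp: r_def power_less_one_iff)
  define B where "B = (\<Sum>x\<in>A - A0. cmod (c x) * C * r ^ s * \<mu> ^ s / \<mu> ^ snd x)"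
  show ?thesis
  proof (rule geometrically_bounded_eventuallyI, fold P_def r_def)
    show "0 < r * \<mu>" using r \<mu> by simp
    fix n assume n: "n \<ge> dmax + degree b + 1"
    have "0 = (\<Sum>x\<in>A0. c x * \<rho> ^ (2 * (n + s) * e x) * \<beta> (n + s - snd x)) +
        (\<Sum>x\<in>A - A0. c x * \<rho> ^ (2 * (n + s) * e x) * \<beta> (n + s - snd x))"
      using rec[of "n + s"] n sum.subset_diff[OF A0A finA, of "\<lambda>x. c x * \<rho> ^ (2 * (n + s) * e x) * \<beta> (n + s - snd x)"]
      by (simp add: add.commute)
    also have "(\<Sum>x\<in>A0. c x * \<rho> ^ (2 * (n + s) * e x) * \<beta> (n + s - snd x)) = shift_operator (reflect_poly P) \<beta> n"
      unfolding main by (intro sum.cong refl) (simp add: e_A0 s_def add.assoc)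
    finally have "shift_operator (reflect_poly P) \<beta> n = - (\<Sum>x\<in>A - A0. c x * \<rho> ^ (2 * (n + s) * e x) * \<beta> (n + s - snd x))"
      by (simp add: eq_neg_iff_add_eq_0)
    then have "cmod (shift_operator (reflect_poly P) \<beta> n) \<le>
        (\<Sum>x\<in>A - A0. cmod (c x * \<rho> ^ (2 * (n + s) * e x) * \<beta> (n + s - snd x)))"
      by (simp add: norm_sum)
    also have "\<dots> \<le> (\<Sum>x\<in>A - A0. cmod (c x) * C * r ^ s * \<mu> ^ s / \<mu> ^ snd x * (r * \<mu>) ^ n)"
    proof (intro sum_mono)
      fix x assume x: "x \<in> A - A0"
      obtain j i where ji: "x = (j, i)" by force
      have "e x \<ge> 1" using x e_zero[of j i] unfolding ji by fastforce
      have "i \<le> n" using x dmax[of j] n unfolding ji by (auto simp: A_def)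
      have "cmod (\<rho> ^ (2 * (n + s) * e x)) = (r ^ e x) ^ (n + s)"
        by (simp add: r_def norm_power mult_ac flip: power_mult)
      also have "\<dots> \<le> r ^ (n + s)"
        using \<open>e x \<ge> 1\<close> r by (intro power_mono) (metis less_imp_le power_decreasing power_one_right, simp)
      finally have 1: "cmod (\<rho> ^ (2 * (n + s) * e x)) \<le> r ^ (n + s)" .
      have 2: "cmod (\<beta> (n + s - snd x)) \<le> C * (\<mu> ^ (n + s) / \<mu> ^ snd x)"
        using C[of "n + s - i"] \<mu> \<open>i \<le> n\<close> unfolding ji by (simp add: power_diff)
      have "cmod (c x * \<rho> ^ (2 * (n + s) * e x) * \<beta> (n + s - snd x)) \<le>
          cmod (c x) * r ^ (n + s) * (C * (\<mu> ^ (n + s) / \<mu> ^ snd x))"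
        unfolding norm_mult using 1 2 r by (intro mult_mono mult_left_mono) auto
      also have "\<dots> = cmod (c x) * C * r ^ s * \<mu> ^ s / \<mu> ^ snd x * (r * \<mu>) ^ n"
        by (simp add: power_add power_mult_distrib)
      finally show "cmod (c x * \<rho> ^ (2 * (n + s) * e x) * \<beta> (n + s - snd x)) \<le>
          cmod (c x) * C * r ^ s * \<mu> ^ s / \<mu> ^ snd x * (r * \<mu>) ^ n" .
    qed
    also have "\<dots> = B * (r * \<mu>) ^ n" unfolding B_def by (simp only: sum_distrib_right)
    finally show "cmod (shift_operator (reflect_poly P) \<beta> n) \<le> B * (r * \<mu>) ^ n" .
  qed
qed

section \<open>Bilateral theta series\<close>

text \<open>
  For constant \<open>p\<close> this is Jacobi's theta function. The Gaussian weights make the series converge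
  on the punctured plane whenever \<open>p\<close> grows at most geometrically in both directions.
\<close>

definition theta_series :: "complex \<Rightarrow> (int \<Rightarrow> complex) \<Rightarrow> complex \<Rightarrow> complex" where
  "theta_series \<tau> p w = (\<Sum>\<^sub>\<infinity>h. p h * \<tau> powi h\<^sup>2 * w powi h)"

text \<open>
  With \<open>C\<close> and \<open>B\<close> shared by a whole family of coefficient sequences, this provides the common
  summable majorant of their theta series on an annulus.
\<close>

definition coeff_bounded :: "real \<Rightarrow> real \<Rightarrow> (int \<Rightarrow> complex) \<Rightarrow> bool" where
  "coeff_bounded C B p \<longleftrightarrow> (\<forall>h. cmod (p h) \<le> C * B ^ nat \<bar>h\<bar>)"

text \<open>
  The term of index \<open>\<plusminus>n\<close> is \<open>(t\<^sup>n Y)\<^sup>n\<close>, and \<open>t\<^sup>n Y\<close> tends to zero.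
\<close>

lemma gaussian_summable:
  fixes t Y :: real
  assumes t: "0 < t" "t < 1" and Y: "0 \<le> Y"
  shows "(\<lambda>h::int. t powi h\<^sup>2 * Y ^ nat \<bar>h\<bar>) summable_on UNIV"
proof -
  define g where "g = (\<lambda>h::int. t powi h\<^sup>2 * Y ^ nat \<bar>h\<bar>)"
  have e: "g (int n) = (t ^ n * Y) ^ n" "g (- int n) = (t ^ n * Y) ^ n" for n
  proof -
    have "(int n)\<^sup>2 = int (n * n)" by (simp add: power2_eq_square)
    then have "t powi (int n)\<^sup>2 = (t ^ n) ^ n" by (simp only: power_int_of_nat power_mult)
    then show "g (int n) = (t ^ n * Y) ^ n" "g (- int n) = (t ^ n * Y) ^ n"
      by (simp_all add: g_def power_mult_distrib)
  qed
  have "(\<lambda>n. t ^ n * Y) \<longlonglongrightarrow> 0 * Y" using t by (intro tendsto_intros LIMSEQ_power_zero) auto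
  then have "\<forall>\<^sub>F n in sequentially. t ^ n * Y < 1 / 2" by (rule order_tendstoD) simp
  then have "\<forall>\<^sub>F n in sequentially. norm ((t ^ n * Y) ^ n) \<le> (1 / 2) ^ n"
    by eventually_elim (use t Y in \<open>auto simp: norm_power intro!: power_mono\<close>)
  then have "summable (\<lambda>n. (t ^ n * Y) ^ n)"
    by (rule summable_comparison_test_ev) (simp add: summable_geometric)
  then have s: "(\<lambda>n. (t ^ n * Y) ^ n) summable_on UNIV"
    using t Y by (subst summable_on_UNIV_nonneg_real_iff) auto
  have "g summable_on range int"
    using s by (subst summable_on_reindex) (auto simp: o_def e inj_on_def)
  moreover have "g summable_on range (\<lambda>n. - int n)"
    using s by (subst summable_on_reindex) (auto simp: o_def e inj_on_def)
  ultimately have "g summable_on (range int \<union> range (\<lambda>n. - int n))"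
    by (rule summable_on_union)
  also have "range int \<union> range (\<lambda>n. - int n) = UNIV"
    by (auto intro: int_cases2)
  finally show ?thesis unfolding g_def .
qed

lemma norm_powi_le:
  assumes "1 \<le> Y" "1 / Y \<le> cmod w" "cmod w \<le> Y"
  shows "cmod (w powi h) \<le> Y ^ nat \<bar>h\<bar>"
proof (cases "0 \<le> h")
  case True
  then show ?thesis using assms by (simp add: power_int_def norm_power power_mono)
next
  case False
  have "0 < cmod w" using assms by (smt (verit) divide_pos_pos)
  then have "inverse (cmod w) \<le> Y" using assms by (simp add: field_simps)
  then show ?thesis using False \<open>0 < cmod w\<close>
    by (simp add: power_int_def norm_power norm_inverse power_mono)
qed

lemma theta_summable:
  assumes \<tau>: "0 < cmod \<tau>" "cmod \<tau> < 1" and p: "coeff_bounded C B p" and B: "0 \<le> B" and w: "w \<noteq> 0"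
  shows "(\<lambda>h. norm (p h * \<tau> powi h\<^sup>2 * w powi h)) summable_on UNIV"
proof (rule summable_on_comparison_test)
  define Y where "Y = max (cmod w) (1 / cmod w)"
  have Y: "1 \<le> Y" "1 / Y \<le> cmod w" "cmod w \<le> Y"
  proof -
    have pos: "0 < cmod w" using w by simp
    show "1 \<le> Y" unfolding Y_def using pos by (cases "1 \<le> cmod w") (auto simp: le_max_iff_disj field_simps)
    then have "0 < Y" by linarith
    have "1 / cmod w \<le> Y" by (simp add: Y_def)
    then show "1 / Y \<le> cmod w" using pos \<open>0 < Y\<close> by (simp add: field_simps)
  qed (simp add: Y_def)
  show "(\<lambda>h. C * (cmod \<tau> powi h\<^sup>2 * (B * Y) ^ nat \<bar>h\<bar>)) summable_on UNIV"
    using \<tau> B Y by (intro summable_on_cmult_right gaussian_summable) auto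
  have C: "0 \<le> C" using order_trans[OF norm_ge_zero, of "p 0" C] p by (auto simp: coeff_bounded_def dest: spec[of _ 0])
  fix h :: int
  have "norm (p h * \<tau> powi h\<^sup>2 * w powi h) = cmod (p h) * cmod \<tau> powi h\<^sup>2 * cmod (w powi h)"
    by (simp add: norm_mult norm_power_int)
  also have "\<dots> \<le> (C * B ^ nat \<bar>h\<bar>) * cmod \<tau> powi h\<^sup>2 * Y ^ nat \<bar>h\<bar>"
    using p \<tau> norm_powi_le[OF Y] C B by (intro mult_mono) (auto simp: coeff_bounded_def)
  also have "\<dots> = C * (cmod \<tau> powi h\<^sup>2 * (B * Y) ^ nat \<bar>h\<bar>)"
    by (simp add: power_mult_distrib)
  finally show "norm (p h * \<tau> powi h\<^sup>2 * w powi h) \<le> C * (cmod \<tau> powi h\<^sup>2 * (B * Y) ^ nat \<bar>h\<bar>)" .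
qed simp

text \<open>
  Shift the summation index by \<open>T\<close> and complete the square: \<open>h\<^sup>2 - 2Th = (h - T)\<^sup>2 - T\<^sup>2\<close>.
\<close>

lemma theta_quasi_periodic:
  assumes \<tau>: "\<tau> \<noteq> 0" and w: "w \<noteq> 0" and p: "\<And>h. p (h + int T) = \<Lambda> * p h"
  shows "theta_series \<tau> p (\<tau> powi (- 2 * int T) * w) = \<tau> powi (- (int T)\<^sup>2) * \<Lambda> * w ^ T * theta_series \<tau> p w"
proof -
  define K where "K = \<tau> powi (- (int T)\<^sup>2) * \<Lambda> * w ^ T"
  define g where "g = (\<lambda>h. p h * \<tau> powi h\<^sup>2 * w powi h)"
  have e: "p h * \<tau> powi h\<^sup>2 * (\<tau> powi (- 2 * int T) * w) powi h = K * g (h - int T)" for h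
  proof -
    have "\<tau> powi h\<^sup>2 * (\<tau> powi (- 2 * int T)) powi h = \<tau> powi (h\<^sup>2 + (- 2 * int T) * h)"
      using \<tau> by (simp only: power_int_add power_int_mult simp_thms)
    also have "h\<^sup>2 + (- 2 * int T) * h = - (int T)\<^sup>2 + (h - int T)\<^sup>2"
      by (simp add: power2_eq_square algebra_simps)
    also have "\<tau> powi \<dots> = \<tau> powi (- (int T)\<^sup>2) * \<tau> powi (h - int T)\<^sup>2"
      using \<tau> by (simp only: power_int_add simp_thms)
    finally have 1: "\<tau> powi h\<^sup>2 * (\<tau> powi (- 2 * int T)) powi h = \<tau> powi (- (int T)\<^sup>2) * \<tau> powi (h - int T)\<^sup>2" .
    have "w powi h = w powi (int T + (h - int T))" by simp
    also have "\<dots> = w ^ T * w powi (h - int T)" using w by (subst power_int_add) auto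
    finally have 2: "w powi h = w ^ T * w powi (h - int T)" .
    have "p h = \<Lambda> * p (h - int T)" using p[of "h - int T"] by simp
    then have "p h * \<tau> powi h\<^sup>2 * (\<tau> powi (- 2 * int T) * w) powi h
        = \<Lambda> * p (h - int T) * (\<tau> powi h\<^sup>2 * (\<tau> powi (- 2 * int T)) powi h) * w powi h"
      by (simp add: power_int_mult_distrib mult_ac)
    also have "\<dots> = K * g (h - int T)" unfolding 1 2 by (simp add: K_def g_def mult_ac)
    finally show ?thesis .
  qed
  have "theta_series \<tau> p (\<tau> powi (- 2 * int T) * w) = (\<Sum>\<^sub>\<infinity>h. K * g (h - int T))"
    unfolding theta_series_def e ..
  also have "\<dots> = (\<Sum>\<^sub>\<infinity>h. K * g h)"
    by (rule infsum_reindex_bij_witness[of _ "\<lambda>h. h + int T" "\<lambda>h. h - int T"]) auto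
  also have "\<dots> = K * theta_series \<tau> p w" by (simp add: infsum_cmult_right' theta_series_def g_def)
  finally show ?thesis by (simp add: K_def)
qed

lemma theta_series_diff_bound:
  assumes \<tau>: "0 < cmod \<tau>" "cmod \<tau> < 1"
    and p: "coeff_bounded C B p" "coeff_bounded C B p'" and B: "0 \<le> B"
    and Y: "1 \<le> Y" "1 / Y \<le> cmod w" "cmod w \<le> Y"
    and g: "\<And>h. cmod (p h - p' h) \<le> g h" "(\<lambda>h. g h * cmod \<tau> powi h\<^sup>2 * Y ^ nat \<bar>h\<bar>) summable_on UNIV"
  shows "cmod (theta_series \<tau> p w - theta_series \<tau> p' w) \<le> (\<Sum>\<^sub>\<infinity>h. g h * cmod \<tau> powi h\<^sup>2 * Y ^ nat \<bar>h\<bar>)"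
proof -
  have "w \<noteq> 0" using Y by auto
  note s = abs_summable_summable[OF theta_summable[OF \<tau> p(1) B this]]
    abs_summable_summable[OF theta_summable[OF \<tau> p(2) B this]]
  have "((\<lambda>h. p h * \<tau> powi h\<^sup>2 * w powi h - p' h * \<tau> powi h\<^sup>2 * w powi h) has_sum
      (theta_series \<tau> p w - theta_series \<tau> p' w)) UNIV"
    unfolding theta_series_def using has_sum_add[OF has_sum_infsum[OF s(1)] has_sum_uminusI[OF has_sum_infsum[OF s(2)]]] by simp
  then show ?thesis
  proof (rule norm_infsum_le)
    show "((\<lambda>h. g h * cmod \<tau> powi h\<^sup>2 * Y ^ nat \<bar>h\<bar>) has_sum (\<Sum>\<^sub>\<infinity>h. g h * cmod \<tau> powi h\<^sup>2 * Y ^ nat \<bar>h\<bar>)) UNIV"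
      using g(2) by (rule has_sum_infsum)
    fix h :: int
    have "p h * \<tau> powi h\<^sup>2 * w powi h - p' h * \<tau> powi h\<^sup>2 * w powi h = (p h - p' h) * \<tau> powi h\<^sup>2 * w powi h"
      by (simp add: algebra_simps)
    then have "cmod (p h * \<tau> powi h\<^sup>2 * w powi h - p' h * \<tau> powi h\<^sup>2 * w powi h)
        = cmod (p h - p' h) * cmod \<tau> powi h\<^sup>2 * cmod (w powi h)"
      by (simp add: norm_mult norm_power_int)
    also have "\<dots> \<le> g h * cmod \<tau> powi h\<^sup>2 * Y ^ nat \<bar>h\<bar>"
      using g(1)[of h] order_trans[OF norm_ge_zero g(1)[of h]] \<tau> norm_powi_le[OF Y]
      by (intro mult_mono) auto
    finally show "cmod (p h * \<tau> powi h\<^sup>2 * w powi h - p' h * \<tau> powi h\<^sup>2 * w powi h) \<le> g h * cmod \<tau> powi h\<^sup>2 * Y ^ nat \<bar>h\<bar>" .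
  qed
qed

text \<open>
  Tannery's theorem for unordered sums: off a finite set the tail of the majorant is small,
  and on that set the limit is taken term by term.
\<close>

lemma dominated_infsum_tendsto_0:
  fixes g :: "nat \<Rightarrow> 'a \<Rightarrow> real"
  assumes b: "b summable_on UNIV" and g: "\<And>n x. 0 \<le> g n x" "\<And>n x. g n x \<le> b x"
    and lim: "\<And>x. (\<lambda>n. g n x) \<longlonglongrightarrow> 0"
  shows "(\<lambda>n. \<Sum>\<^sub>\<infinity>x. g n x) \<longlonglongrightarrow> 0"
proof (rule LIMSEQ_I)
  fix \<epsilon> :: real assume \<epsilon>: "0 < \<epsilon>"
  obtain F where F: "finite F" "dist (sum b F) (infsum b UNIV) \<le> \<epsilon> / 2"
    using infsum_finite_approximation[OF b, of "\<epsilon> / 2"] \<epsilon> by auto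
  have gs: "g n summable_on A" for n A
    by (rule summable_on_comparison_test[of b]) (use g in \<open>auto intro: summable_on_subset[OF b]\<close>)
  have bs: "b summable_on A" for A by (rule summable_on_subset[OF b]) auto
  have split: "infsum h UNIV = sum h F + infsum h (- F)" if "\<And>A. h summable_on A" for h :: "'a \<Rightarrow> real"
    using infsum_Un_disjoint[of h F "- F"] that F(1) by simp
  have tail: "infsum b (- F) \<le> \<epsilon> / 2" using F(2) split[of b] bs by (simp add: dist_real_def)
  have "(\<lambda>n. \<Sum>x\<in>F. g n x) \<longlonglongrightarrow> (\<Sum>x\<in>F. 0)" by (intro tendsto_sum lim)
  then have "\<forall>\<^sub>F n in sequentially. (\<Sum>x\<in>F. g n x) < \<epsilon> / 2"
    using \<epsilon> by (intro order_tendstoD) auto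
  then obtain n0 where n0: "\<And>n. n \<ge> n0 \<Longrightarrow> (\<Sum>x\<in>F. g n x) < \<epsilon> / 2"
    by (auto simp: eventually_sequentially)
  show "\<exists>n0. \<forall>n\<ge>n0. norm ((\<Sum>\<^sub>\<infinity>x. g n x) - 0) < \<epsilon>"
  proof (intro exI allI impI)
    fix n assume "n \<ge> n0"
    have "0 \<le> infsum (g n) UNIV" by (rule infsum_nonneg) (rule g)
    moreover have "infsum (g n) (- F) \<le> infsum b (- F)"
      by (intro infsum_mono gs bs g)
    ultimately show "norm ((\<Sum>\<^sub>\<infinity>x. g n x) - 0) < \<epsilon>"
      using split[of "g n", OF gs] tail n0[OF \<open>n \<ge> n0\<close>] by simp
  qed
qed

lemma theta_series_uniform_limit:
  assumes \<tau>: "0 < cmod \<tau>" "cmod \<tau> < 1" and B: "0 \<le> B"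
    and p: "coeff_bounded C B p" and v: "\<And>n. coeff_bounded C B (v n)"
    and lim: "\<And>h. (\<lambda>n. v n h) \<longlonglongrightarrow> p h" and Y: "1 \<le> Y"
  shows "uniform_limit {w. 1 / Y \<le> cmod w \<and> cmod w \<le> Y}
           (\<lambda>n. theta_series \<tau> (v n)) (theta_series \<tau> p) sequentially"
proof -
  define g where "g = (\<lambda>n h. cmod (v n h - p h) * cmod \<tau> powi h\<^sup>2 * Y ^ nat \<bar>h\<bar>)"
  define b where "b = (\<lambda>h. 2 * C * (cmod \<tau> powi h\<^sup>2 * (B * Y) ^ nat \<bar>h\<bar>))"
  have b: "b summable_on UNIV"
    unfolding b_def using \<tau> B Y by (intro summable_on_cmult_right gaussian_summable) auto
  have gb: "g n h \<le> b h" for n h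
  proof -
    have "cmod (v n h - p h) \<le> 2 * C * B ^ nat \<bar>h\<bar>"
    proof -
      have "cmod (v n h) \<le> C * B ^ nat \<bar>h\<bar>" "cmod (p h) \<le> C * B ^ nat \<bar>h\<bar>"
        using p v by (auto simp: coeff_bounded_def)
      then show ?thesis using norm_triangle_ineq4[of "v n h" "p h"] by simp
    qed
    then have "g n h \<le> 2 * C * B ^ nat \<bar>h\<bar> * cmod \<tau> powi h\<^sup>2 * Y ^ nat \<bar>h\<bar>"
      unfolding g_def using Y by (intro mult_right_mono) auto
    then show ?thesis by (simp add: b_def power_mult_distrib mult_ac)
  qed
  have g0: "0 \<le> g n h" for n h using Y by (simp add: g_def)
  have lim0: "(\<lambda>n. infsum (g n) UNIV) \<longlonglongrightarrow> 0"
  proof (rule dominated_infsum_tendsto_0[OF b g0 gb])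
    fix h
    have "(\<lambda>n. g n h) \<longlonglongrightarrow> cmod (p h - p h) * cmod \<tau> powi h\<^sup>2 * Y ^ nat \<bar>h\<bar>"
      unfolding g_def by (intro tendsto_intros lim)
    then show "(\<lambda>n. g n h) \<longlonglongrightarrow> 0" by simp
  qed
  have gs: "g n summable_on UNIV" for n
    by (rule summable_on_comparison_test[OF b]) (use gb g0 in auto)
  have le: "cmod (theta_series \<tau> (v n) w - theta_series \<tau> p w) \<le> infsum (g n) UNIV"
    if "1 / Y \<le> cmod w" "cmod w \<le> Y" for n w
    unfolding g_def
    by (rule theta_series_diff_bound[OF \<tau> v p B Y that order_refl gs[unfolded g_def]])
  show ?thesis
    unfolding uniform_limit_iff dist_norm
  proof (intro allI impI)
    fix e :: real assume "0 < e"
    then have "\<forall>\<^sub>F n in sequentially. infsum (g n) UNIV < e"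
      by (intro order_tendstoD[OF lim0])
    then show "\<forall>\<^sub>F n in sequentially. \<forall>w\<in>{w. 1 / Y \<le> cmod w \<and> cmod w \<le> Y}.
        cmod (theta_series \<tau> (v n) w - theta_series \<tau> p w) < e"
      by eventually_elim (auto intro: le_less_trans[OF le])
  qed
qed

text \<open>
  The Gaussian weights absorb the factor \<open>\<delta>\<^sup>h\<close>, so that a rate in \<open>n\<close> is inherited from the
  coefficients.
\<close>

lemma theta_series_rate:
  assumes \<tau>: "0 < cmod \<tau>" "cmod \<tau> < 1" and B: "0 \<le> B"
    and p: "coeff_bounded C B p" and v: "\<And>n. coeff_bounded C B (v n)"
    and rate: "\<And>n h. cmod (v n h - p h) \<le> K * \<theta> ^ n * \<delta> powi h" and \<delta>: "0 < \<delta>" and Y: "1 \<le> Y"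
  shows "\<exists>K'. \<forall>n w. 1 / Y \<le> cmod w \<longrightarrow> cmod w \<le> Y \<longrightarrow>
           cmod (theta_series \<tau> (v n) w - theta_series \<tau> p w) \<le> K' * \<theta> ^ n"
proof -
  define Z where "Z = max \<delta> (1 / \<delta>)"
  have Z: "\<delta> powi h \<le> Z ^ nat \<bar>h\<bar>" "0 \<le> Z" for h
  proof -
    have Z1: "1 \<le> Z"
      unfolding Z_def using \<delta> by (cases "1 \<le> \<delta>") (auto simp: le_max_iff_disj field_simps)
    then have "0 < Z" by linarith
    have "1 / \<delta> \<le> Z" by (simp add: Z_def)
    then have "1 / Z \<le> \<delta>" using \<delta> \<open>0 < Z\<close> by (simp add: field_simps)
    then show "\<delta> powi h \<le> Z ^ nat \<bar>h\<bar>"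
      using norm_powi_le[of Z "complex_of_real \<delta>" h] Z1 \<delta> by (simp add: norm_power_int Z_def)
    show "0 \<le> Z" using \<open>0 < Z\<close> by simp
  qed
  define s where "s = (\<lambda>h. \<delta> powi h * cmod \<tau> powi h\<^sup>2 * Y ^ nat \<bar>h\<bar>)"
  have s: "s summable_on UNIV"
  proof (rule summable_on_comparison_test)
    show "(\<lambda>h. cmod \<tau> powi h\<^sup>2 * (Z * Y) ^ nat \<bar>h\<bar>) summable_on UNIV"
      using \<tau> Y Z by (intro gaussian_summable) auto
    fix h :: int
    have "s h \<le> Z ^ nat \<bar>h\<bar> * cmod \<tau> powi h\<^sup>2 * Y ^ nat \<bar>h\<bar>"
      unfolding s_def using Z Y by (intro mult_right_mono) auto
    then show "s h \<le> cmod \<tau> powi h\<^sup>2 * (Z * Y) ^ nat \<bar>h\<bar>" by (simp add: power_mult_distrib mult_ac)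
    show "0 \<le> s h" using \<delta> Y by (simp add: s_def)
  qed
  have "cmod (theta_series \<tau> (v n) w - theta_series \<tau> p w) \<le> K * infsum s UNIV * \<theta> ^ n"
    if w: "1 / Y \<le> cmod w" "cmod w \<le> Y" for n w
  proof -
    have e: "K * \<theta> ^ n * \<delta> powi h * cmod \<tau> powi h\<^sup>2 * Y ^ nat \<bar>h\<bar> = (K * \<theta> ^ n) * s h" for h
      by (simp add: s_def)
    have "cmod (theta_series \<tau> (v n) w - theta_series \<tau> p w) \<le>
        (\<Sum>\<^sub>\<infinity>h. K * \<theta> ^ n * \<delta> powi h * cmod \<tau> powi h\<^sup>2 * Y ^ nat \<bar>h\<bar>)"
      by (rule theta_series_diff_bound[OF \<tau> v p B Y w rate])
        (unfold e, intro summable_on_cmult_right s)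
    also have "\<dots> = (K * \<theta> ^ n) * infsum s UNIV" unfolding e by (simp add: infsum_cmult_right')
    finally show ?thesis by (simp add: mult_ac)
  qed
  then show ?thesis by blast
qed

section \<open>Rescaling a power series with Gaussian coefficients\<close>

text \<open>
  For \<open>j = nT + h\<close> the exponent \<open>j\<^sup>2 - 2Tnj\<close> of \<open>\<tau>\<close> equals \<open>h\<^sup>2 - (nT)\<^sup>2\<close>: dilation by the
  \<open>n\<close>-th power of \<open>\<tau>^(-2T)\<close> moves the peak of the Gaussian weights to the
  index \<open>nT\<close>.
\<close>

lemma theta_rescaling_term:
  fixes \<tau> \<Lambda> w :: complex and h :: int
  assumes \<tau>: "\<tau> \<noteq> 0" and \<Lambda>: "\<Lambda> \<noteq> 0" and s: "s \<noteq> 0" and w: "w \<noteq> 0"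
    and \<alpha>: "\<And>j. \<alpha> j = \<beta> j * \<tau> ^ j\<^sup>2" and j: "int j = int (n * T) + h"
  shows "\<alpha> j * ((\<tau> powi (- 2 * int T)) ^ n * w) ^ j =
    (s * \<Lambda> ^ n * \<tau> powi (- (int (n * T))\<^sup>2) * w ^ (n * T)) * (\<beta> j / (s * \<Lambda> ^ n) * \<tau> powi h\<^sup>2 * w powi h)"
proof -
  have "\<tau> ^ j\<^sup>2 * ((\<tau> powi (- 2 * int T)) ^ n) ^ j = \<tau> powi ((int j)\<^sup>2 + (- 2 * int T) * int n * int j)"
    using \<tau> by (simp only: power_int_add power_int_mult power_int_of_nat of_nat_power simp_thms flip: of_nat_power)
  also have "(int j)\<^sup>2 + (- 2 * int T) * int n * int j = - (int (n * T))\<^sup>2 + h\<^sup>2"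
    unfolding j by (simp add: power2_eq_square algebra_simps)
  also have "\<tau> powi \<dots> = \<tau> powi (- (int (n * T))\<^sup>2) * \<tau> powi h\<^sup>2"
    using \<tau> by (simp only: power_int_add simp_thms)
  finally have 1: "\<tau> ^ j\<^sup>2 * ((\<tau> powi (- 2 * int T)) ^ n) ^ j = \<tau> powi (- (int (n * T))\<^sup>2) * \<tau> powi h\<^sup>2" .
  have "w ^ j = w powi (int (n * T) + h)" by (simp only: power_int_of_nat flip: j)
  also have "\<dots> = w ^ (n * T) * w powi h"
    using w by (simp only: power_int_add power_int_of_nat simp_thms)
  finally have 2: "w ^ j = w ^ (n * T) * w powi h" .
  have "\<alpha> j * ((\<tau> powi (- 2 * int T)) ^ n * w) ^ j
      = \<beta> j * (\<tau> ^ j\<^sup>2 * ((\<tau> powi (- 2 * int T)) ^ n) ^ j) * w ^ j"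
    by (simp add: \<alpha> power_mult_distrib)
  also have "\<dots> = (s * \<Lambda> ^ n * \<tau> powi (- (int (n * T))\<^sup>2) * w ^ (n * T)) * (\<beta> j / (s * \<Lambda> ^ n) * \<tau> powi h\<^sup>2 * w powi h)"
    unfolding 1 2 using \<Lambda> s by simp
  finally show ?thesis .
qed

text \<open>
  The normalisation \<open>s\<^sub>n \<Lambda>\<^sup>n\<close> is arbitrary here; it is chosen later to make the recentred
  coefficients converge. Indices below zero are filled up with zeros.
\<close>

lemma theta_rescaling:
  fixes \<tau> \<Lambda> w :: complex and f :: "complex \<Rightarrow> complex"
  assumes \<tau>: "\<tau> \<noteq> 0" and \<Lambda>: "\<Lambda> \<noteq> 0" and s: "s \<noteq> 0" and w: "w \<noteq> 0"
    and f: "\<And>z. (\<lambda>n. \<alpha> n * z ^ n) sums f z" and \<alpha>: "\<And>j. \<alpha> j = \<beta> j * \<tau> ^ j\<^sup>2"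
    and v: "\<And>h. v h = (if 0 \<le> int (n * T) + h then \<beta> (nat (int (n * T) + h)) / (s * \<Lambda> ^ n) else 0)"
  shows "f ((\<tau> powi (- 2 * int T)) ^ n * w) =
    (s * \<Lambda> ^ n * \<tau> powi (- (int (n * T))\<^sup>2) * w ^ (n * T)) * theta_series \<tau> v w"
proof -
  define K where "K = s * \<Lambda> ^ n * \<tau> powi (- (int (n * T))\<^sup>2) * w ^ (n * T)"
  define z where "z = (\<tau> powi (- 2 * int T)) ^ n * w"
  have z: "z \<noteq> 0" using \<tau> w by (simp add: z_def)
  have "summable (\<lambda>j. norm (\<alpha> j * z ^ j))"
    by (rule powser_insidea[of \<alpha> "2 * z"]) (use f[of "2 * z", THEN sums_summable] z in \<open>simp_all add: norm_mult\<close>)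
  then have "((\<lambda>j. \<alpha> j * z ^ j) has_sum f z) UNIV"
    using f[of z] by (rule norm_summable_imp_has_sum)
  also have "?this \<longleftrightarrow> ((\<lambda>h. K * (v h * \<tau> powi h\<^sup>2 * w powi h)) has_sum f z) {- int (n * T)..}"
  proof (rule has_sum_reindex_bij_witness[of _ "\<lambda>h. nat (int (n * T) + h)" "\<lambda>j. int j - int (n * T)"])
    fix j :: nat
    show "K * (v (int j - int (n * T)) * \<tau> powi (int j - int (n * T))\<^sup>2 * w powi (int j - int (n * T))) = \<alpha> j * z ^ j"
      using theta_rescaling_term[where \<alpha> = \<alpha> and \<beta> = \<beta> and j = j and T = T and n = n
        and h = "int j - int (n * T)", OF \<tau> \<Lambda> s w \<alpha>]
      by (simp add: K_def z_def v)
  qed auto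
  also have "\<dots> \<longleftrightarrow> ((\<lambda>h. K * (v h * \<tau> powi h\<^sup>2 * w powi h)) has_sum f z) UNIV"
    by (rule has_sum_cong_neutral) (auto simp: v)
  finally have "f z = (\<Sum>\<^sub>\<infinity>h. K * (v h * \<tau> powi h\<^sup>2 * w powi h))" by (simp add: infsumI)
  also have "\<dots> = K * theta_series \<tau> v w" by (simp add: infsum_cmult_right' theta_series_def)
  finally show ?thesis by (simp add: K_def z_def)
qed

lemma norm_coeff_le:
  fixes f :: "complex \<Rightarrow> complex"
  assumes f: "\<And>z. (\<lambda>n. \<alpha> n * z ^ n) sums f z" and hol: "f holomorphic_on UNIV"
    and r: "0 < r" and B: "\<And>z. cmod z = r \<Longrightarrow> cmod (f z) \<le> B"
  shows "cmod (\<alpha> j) * r ^ j \<le> B"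
proof -
  have "\<alpha> j = (deriv ^^ j) f 0 / fact j"
    using fps_nth_fps_expansion[OF has_fps_expansion_if_sums[OF f], of j] by simp
  moreover have "cmod ((deriv ^^ j) f 0) \<le> fact j * B / r ^ j"
    by (rule Cauchy_inequality)
      (use hol r B in \<open>auto intro: holomorphic_on_subset holomorphic_on_imp_continuous_on\<close>)
  then have "cmod ((deriv ^^ j) f 0) / fact j * r ^ j \<le> B"
    using r by (simp add: pos_le_divide_eq pos_divide_le_eq mult_ac)
  ultimately show ?thesis by (simp add: norm_divide)
qed

text \<open>
  If \<open>\<Theta>\<close> vanished on the unit circle, then on the circle of radius \<open>\<bar>\<tau>\<bar>^(-2Tn)\<close> the function \<open>f\<close> would be
  small compared to its normalising factor, and Cauchy's inequality for the coefficient of index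
  \<open>nT + h\<^sub>0\<close> would show that \<open>v\<^sub>n(h\<^sub>0)\<close> tends to zero.
\<close>

lemma theta_series_nonzero:
  fixes \<tau> \<Lambda> :: complex and f :: "complex \<Rightarrow> complex"
  assumes \<tau>: "\<tau> \<noteq> 0" and \<Lambda>: "\<Lambda> \<noteq> 0" and s: "\<And>n. s n \<noteq> 0" and T: "0 < T"
    and f: "\<And>z. (\<lambda>n. \<alpha> n * z ^ n) sums f z" and hol: "f holomorphic_on UNIV"
    and \<alpha>: "\<And>j. \<alpha> j = \<beta> j * \<tau> ^ j\<^sup>2"
    and v: "\<And>n h. v n h = (if 0 \<le> int (n * T) + h then \<beta> (nat (int (n * T) + h)) / (s n * \<Lambda> ^ n) else 0)"
    and lim: "(\<lambda>n. v n h\<^sub>0) \<longlonglongrightarrow> p h\<^sub>0" and h0: "p h\<^sub>0 \<noteq> 0"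
    and unif: "uniform_limit (sphere 0 1) (\<lambda>n. theta_series \<tau> (v n)) (theta_series \<tau> p) sequentially"
  shows "\<exists>w. w \<noteq> 0 \<and> theta_series \<tau> p w \<noteq> 0"
proof (rule ccontr)
  assume "\<not> ?thesis"
  then have zero: "theta_series \<tau> p w = 0" if "cmod w = 1" for w using that by (cases "w = 0") auto
  define t where "t = cmod (\<tau> powi h\<^sub>0\<^sup>2)"
  have t: "0 < t" using \<tau> by (simp add: t_def)
  have "\<forall>\<^sub>F n in sequentially. \<forall>w\<in>sphere 0 1. dist (theta_series \<tau> (v n) w) (theta_series \<tau> p w) < cmod (p h\<^sub>0) / 2 * t"
    using unif[unfolded uniform_limit_iff, rule_format, of "cmod (p h\<^sub>0) / 2 * t"] t h0 by simp
  moreover have "\<forall>\<^sub>F n in sequentially. cmod (v n h\<^sub>0) > cmod (p h\<^sub>0) / 2"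
    by (rule order_tendstoD(1)[OF tendsto_norm[OF lim]]) (use h0 in simp)
  moreover have "\<forall>\<^sub>F n in sequentially. nat \<bar>h\<^sub>0\<bar> \<le> n" by (rule eventually_ge_at_top)
  ultimately have "\<forall>\<^sub>F n in sequentially. False"
  proof eventually_elim
    case (elim n)
    define c where "c = (\<tau> powi (- 2 * int T)) ^ n"
    define K where "K = s n * \<Lambda> ^ n * \<tau> powi (- (int (n * T))\<^sup>2)"
    define j where "j = nat (int (n * T) + h\<^sub>0)"
    have "n \<le> n * T" using T by simp
    then have "\<bar>h\<^sub>0\<bar> \<le> int (n * T)" using elim(3) by linarith
    then have j: "int j = int (n * T) + h\<^sub>0" by (simp add: j_def)
    have vj: "v n h\<^sub>0 = \<beta> j / (s n * \<Lambda> ^ n)" 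
      unfolding v j_def using of_nat_0_le_iff[of j, where 'a = int] unfolding j by (simp only: if_True simp_thms)
    have c0: "c \<noteq> 0" using \<tau> by (simp add: c_def)
    have K0: "0 < cmod K" using \<tau> \<Lambda> s by (simp add: K_def)
    have "cmod (\<alpha> j) * cmod c ^ j \<le> cmod K * (cmod (p h\<^sub>0) / 2 * t)"
    proof (rule norm_coeff_le[OF f hol])
      show "0 < cmod c" using c0 by simp
      fix z assume z: "cmod z = cmod c"
      define w where "w = z / c"
      have w: "cmod w = 1" "w \<noteq> 0" using z c0 by (auto simp: w_def norm_divide)
      have "f (c * w) = (K * w ^ (n * T)) * theta_series \<tau> (v n) w"
        unfolding c_def K_def by (rule theta_rescaling[where \<alpha> = \<alpha> and \<beta> = \<beta>, OF \<tau> \<Lambda> s w(2) f \<alpha> v])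
      moreover have "c * w = z" using c0 by (simp add: w_def)
      ultimately have "cmod (f z) = cmod K * cmod (theta_series \<tau> (v n) w)"
        using w by (simp add: norm_mult norm_power)
      also have "cmod (theta_series \<tau> (v n) w) \<le> cmod (p h\<^sub>0) / 2 * t"
        using elim(1)[rule_format, of w] w zero[OF w(1)] by (simp add: dist_norm)
      finally show "cmod (f z) \<le> cmod K * (cmod (p h\<^sub>0) / 2 * t)"
        by (simp add: mult_left_mono)
    qed
    also have "cmod (\<alpha> j) * cmod c ^ j = cmod (\<alpha> j * (c * 1) ^ j)" by (simp add: norm_mult norm_power)
    also have "\<dots> = cmod (K * (v n h\<^sub>0 * \<tau> powi h\<^sub>0\<^sup>2))"
      unfolding c_def using theta_rescaling_term[where \<alpha> = \<alpha> and \<beta> = \<beta> and s = "s n",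
          OF \<tau> \<Lambda> s one_neq_zero \<alpha> j]
      by (simp add: K_def vj)
    also have "\<dots> = cmod K * (cmod (v n h\<^sub>0) * t)" by (simp add: norm_mult t_def)
    finally have "cmod (v n h\<^sub>0) * t \<le> cmod (p h\<^sub>0) / 2 * t" using K0 by simp
    then show False using elim(2) t by simp
  qed
  then show False by simp
qed

section \<open>Zeros of quasi-periodic functions\<close>

text \<open>
  Off \<open>Z\<close> the cofactor is a quotient of holomorphic functions; at a point of \<open>Z\<close> it agrees with
  the local cofactor \<open>zor_poly\<close> divided by the other linear factors.
\<close>

lemma zeros_factor_out:
  assumes f: "f holomorphic_on S" "open S" "connected S" "\<exists>w\<in>S. f w \<noteq> 0" and Z: "finite Z" "Z \<subseteq> S"
  obtains H where "H holomorphic_on S" "\<And>a. a \<in> Z \<Longrightarrow> H a \<noteq> 0"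
    "\<And>w. w \<in> S \<Longrightarrow> f w = (\<Prod>a\<in>Z. (w - a) ^ nat (zorder f a)) * H w"
proof -
  define n where "n = (\<lambda>a. nat (zorder f a))"
  define P where "P = (\<lambda>A w. \<Prod>a\<in>A. (w - a) ^ n a)"
  have P0: "P A w \<noteq> 0" if "w \<notin> A" "A \<subseteq> Z" for A w
    using that Z finite_subset[of A Z] by (auto simp: P_def)
  define H where "H = (\<lambda>w. if w \<in> Z then zor_poly f w w / P (Z - {w}) w else f w / P Z w)"
  have loc: "\<exists>r>0. cball a r \<subseteq> S \<and> zor_poly f a holomorphic_on cball a r \<and>
      (\<forall>w\<in>cball a r. f w = zor_poly f a w * (w - a) ^ n a \<and> zor_poly f a w \<noteq> 0)" if "a \<in> S" for a
    using zorder_exist_zero[OF f(1-3) that f(4)] unfolding n_def by blast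
  have split: "P Z w = (w - a) ^ n a * P (Z - {a}) w" if "a \<in> Z" for a w
    unfolding P_def using Z(1) that by (rule prod.remove)
  have fact: "f w = P Z w * H w" if w: "w \<in> S" for w
  proof (cases "w \<in> Z")
    case True
    obtain r where "r > 0" "\<forall>v\<in>cball w r. f v = zor_poly f w v * (v - w) ^ n w"
      using loc[OF w] by blast
    then have "f w = zor_poly f w w * (w - w) ^ n w" by simp
    also have "\<dots> = P Z w * H w"
      using True P0[of w "Z - {w}"] by (simp add: split[OF True] H_def)
    finally show ?thesis .
  next
    case False
    then show ?thesis using P0[of w Z] by (simp add: H_def)
  qed
  have "H a \<noteq> 0" if "a \<in> Z" for a
    using loc[of a] that Z P0[of a "Z - {a}"] by (fastforce simp: H_def)
  moreover have "H holomorphic_on S"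
  proof -
    have "H field_differentiable (at a)" if a: "a \<in> S" for a
    proof (cases "a \<in> Z")
      case True
      obtain r where r: "r > 0" "cball a r \<subseteq> S" "zor_poly f a holomorphic_on cball a r"
        "\<And>w. w \<in> cball a r \<Longrightarrow> f w = zor_poly f a w * (w - a) ^ n a"
        using loc[OF a] by blast
      define U where "U = ball a r - (Z - {a})"
      have U: "open U" "a \<in> U" using Z r by (auto simp: U_def intro!: open_Diff finite_imp_closed)
      have "(\<lambda>w. zor_poly f a w / P (Z - {a}) w) holomorphic_on U"
        unfolding P_def
      proof (intro holomorphic_intros)
        show "zor_poly f a holomorphic_on U"
          using r(3) by (rule holomorphic_on_subset) (auto simp: U_def)
      qed (use Z in \<open>auto simp: U_def\<close>)
      then have "H holomorphic_on U"
      proof (rule holomorphic_transform)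
        show "zor_poly f a w / P (Z - {a}) w = H w" if "w \<in> U" for w
      proof (cases "w = a")
        case False
        then have "w \<notin> Z" "w \<in> cball a r" using that by (auto simp: U_def)
        then show ?thesis using False r(4)[of w] by (simp add: H_def split[OF True])
      qed (use True in \<open>simp add: H_def\<close>)
      qed
      then show ?thesis using U holomorphic_on_imp_differentiable_at by blast
    next
      case False
      have "open (S - Z)" using f(2) Z(1) by (intro open_Diff finite_imp_closed)
      moreover have "H holomorphic_on (S - Z)"
      proof -
        have "(\<lambda>w. f w / P Z w) holomorphic_on (S - Z)"
          unfolding P_def
        proof (intro holomorphic_intros)
          show "f holomorphic_on S - Z" using f(1) by (rule holomorphic_on_subset) auto
        qed (use Z in auto)
        then show ?thesis by (rule holomorphic_transform) (auto simp: H_def)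
      qed
      ultimately show ?thesis using a False holomorphic_on_imp_differentiable_at by blast
    qed
    then show ?thesis using f(2) by (simp add: holomorphic_on_open field_differentiable_def)
  qed
  ultimately show thesis using that[of H] fact by (auto simp: P_def n_def)
qed

lemma has_field_derivative_prod_linear_powers:
  fixes n :: "complex \<Rightarrow> nat"
  assumes "finite Z" "w \<notin> Z"
  shows "((\<lambda>w. \<Prod>a\<in>Z. (w - a) ^ n a) has_field_derivative
           (\<Prod>a\<in>Z. (w - a) ^ n a) * (\<Sum>a\<in>Z. of_nat (n a) / (w - a))) (at w)"
  using assms
proof (induction Z rule: finite_induct)
  case (insert b Z)
  have wb: "w - b \<noteq> 0" using insert.prems by auto
  have "((\<lambda>w. (w - b) ^ n b) has_field_derivative (w - b) ^ n b * (of_nat (n b) / (w - b))) (at w)"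
  proof (cases "n b")
    case (Suc k)
    have "((\<lambda>w. w - b) has_field_derivative 1) (at w)" by (auto intro!: derivative_eq_intros)
    from DERIV_power[OF this, of "Suc k"] show ?thesis using wb by (simp add: Suc mult_ac)
  qed simp
  from DERIV_mult[OF this insert.IH] insert.hyps insert.prems
  show ?case by (simp add: algebra_simps)
qed simp

lemma log_deriv_zeros:
  assumes "open S" "w \<in> S" "H holomorphic_on S" "finite Z" "f w \<noteq> 0"
    and f: "\<And>w. w \<in> S \<Longrightarrow> f w = (\<Prod>a\<in>Z. (w - a) ^ n a) * H w" and n: "\<And>a. a \<in> Z \<Longrightarrow> 0 < n a"
  shows "deriv f w / f w = (\<Sum>a\<in>Z. of_nat (n a) / (w - a)) + deriv H w / H w"
proof -
  define P where "P = (\<Prod>a\<in>Z. (w - a) ^ n a)"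
  have PH: "P \<noteq> 0" "H w \<noteq> 0" using f[OF assms(2)] assms(5) by (auto simp: P_def)
  then have wZ: "w \<notin> Z" using n assms(4) by (fastforce simp: P_def power_0_left)
  have "(H has_field_derivative deriv H w) (at w)"
    using assms(1-3) by (rule holomorphic_derivI[rotated 1]) 
  from DERIV_mult[OF has_field_derivative_prod_linear_powers[OF assms(4) wZ] this]
  have "((\<lambda>w. (\<Prod>a\<in>Z. (w - a) ^ n a) * H w) has_field_derivative
      P * (\<Sum>a\<in>Z. of_nat (n a) / (w - a)) * H w + deriv H w * P) (at w)"
    by (simp add: P_def)
  then have "(f has_field_derivative P * (\<Sum>a\<in>Z. of_nat (n a) / (w - a)) * H w + deriv H w * P) (at w)"
    by (rule has_field_derivative_transform_within_open[OF _ assms(1,2)]) (simp add: f)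
  then have "deriv f w = P * (\<Sum>a\<in>Z. of_nat (n a) / (w - a)) * H w + deriv H w * P"
    by (rule DERIV_imp_deriv)
  then show ?thesis using PH by (simp add: f[OF assms(2)] P_def[symmetric] field_simps)
qed

text \<open>
  The argument principle for an annulus. The integral of \<open>\<Theta>'/\<Theta>\<close> over the outer boundary exceeds
  the one over the inner boundary by \<open>2\<pi>\<i>\<close> times the number of zeros; on the other hand the
  functional equation says that \<open>c (\<Theta>'/\<Theta>)(c w) = T/w + (\<Theta>'/\<Theta>)(w)\<close>, so that the excess is
  \<open>2\<pi>\<i> T\<close>. The outer circle is parametrised as \<open>c\<close> times the inner one, which turns this
  comparison into a substitution.
\<close>

lemma quasi_periodic_zero_count:
  fixes \<Theta> :: "complex \<Rightarrow> complex" and c C :: complex and R :: real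
  assumes hol: "\<Theta> holomorphic_on - {0}" and c: "1 < cmod c" and C: "C \<noteq> 0"
    and qp: "\<And>w. w \<noteq> 0 \<Longrightarrow> \<Theta> (c * w) = C * w ^ T * \<Theta> w"
    and R: "0 < R" and nz: "\<And>w. cmod w = R \<Longrightarrow> \<Theta> w \<noteq> 0"
  defines "Z \<equiv> {w. \<Theta> w = 0 \<and> R < cmod w \<and> cmod w < R * cmod c}"
  shows "finite Z" and "(\<Sum>a\<in>Z. nat (zorder \<Theta> a)) = T"
proof -
  define S where "S = - {0 :: complex}"
  have S: "open S" "connected S"
    unfolding S_def by (auto intro: connected_punctured_universe)
  define K where "K = cball 0 (R * cmod c) - ball (0::complex) R"
  have K: "compact K" "K \<subseteq> S" unfolding K_def S_def using R by (auto intro: compact_diff)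
  have c0: "c \<noteq> 0" using c by auto
  have nz': "\<Theta> w \<noteq> 0" if "cmod w = R * cmod c" for w
  proof -
    have "cmod (w / c) = R" using that c0 by (simp add: norm_divide)
    moreover have "w / c \<noteq> 0" using that R c0 by auto
    ultimately show ?thesis using qp[of "w / c"] nz[of "w / c"] C c0 by simp
  qed
  have ne: "\<exists>w\<in>S. \<Theta> w \<noteq> 0"
    using nz[of "of_real R"] R by (intro bexI[of _ "of_real R"]) (auto simp: S_def)
  have ZK: "Z \<subseteq> K" by (auto simp: Z_def K_def)
  show finZ: "finite Z"
  proof (cases "\<Theta> constant_on S")
    case True
    then have "Z = {}" using ne ZK K(2) by (auto simp: constant_on_def Z_def)
    then show ?thesis by simp
  next
    case False
    have "finite {w\<in>K. \<Theta> w = 0}"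
      by (rule holomorphic_compact_finite_zeros[OF _ S K False]) (use hol in \<open>simp add: S_def\<close>)
    then show ?thesis by (rule finite_subset[rotated]) (use ZK in \<open>auto simp: Z_def\<close>)
  qed
  have holS: "\<Theta> holomorphic_on S" using hol by (simp add: S_def)
  define n where "n = (\<lambda>a. nat (zorder \<Theta> a))"
  have npos: "0 < n a" if "a \<in> Z" for a
    using zorder_exist_zero[OF holS S _ ne, of a] that ZK K by (auto simp: n_def Z_def)
  obtain H where H: "H holomorphic_on S" "\<And>a. a \<in> Z \<Longrightarrow> H a \<noteq> 0"
    "\<And>w. w \<in> S \<Longrightarrow> \<Theta> w = (\<Prod>a\<in>Z. (w - a) ^ n a) * H w"
    using zeros_factor_out[OF holS S ne finZ] ZK K(2) unfolding n_def by blast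
  define S' where "S' = {w\<in>S. H w \<noteq> 0}"
  have S': "open S'"
  proof -
    have "open (S \<inter> H -` (- {0}))"
      by (rule continuous_open_preimage) (use H(1) S holomorphic_on_imp_continuous_on in auto)
    also have "S \<inter> H -` (- {0}) = S'" by (auto simp: S'_def)
    finally show ?thesis .
  qed
  have KS': "K \<subseteq> S'"
  proof
    fix w assume w: "w \<in> K"
    then have "R \<le> cmod w" "cmod w \<le> R * cmod c" by (auto simp: K_def)
    then consider "cmod w = R" | "cmod w = R * cmod c" | "R < cmod w" "cmod w < R * cmod c" by linarith
    then have "H w \<noteq> 0"
    proof cases
      case 3
      show ?thesis
      proof (cases "w \<in> Z")
        case False
        then have "\<Theta> w \<noteq> 0" using 3 by (auto simp: Z_def)
        then show ?thesis using H(3) w K by auto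
      qed (rule H(2))
    qed (use nz nz' H(3)[of w] w K in auto)
    then show "w \<in> S'" using w K by (auto simp: S'_def)
  qed
  \<comment> \<open>\<open>\<Theta>'/\<Theta>\<close> without its poles in the annulus; its integrals over the two circles agree\<close>
  define L where "L = (\<lambda>w. deriv H w / H w)"
  have L: "L holomorphic_on S'"
    unfolding L_def
    by (intro holomorphic_intros holomorphic_on_subset[OF holomorphic_deriv[OF H(1) S(1)]]
          holomorphic_on_subset[OF H(1)]) (auto simp: S'_def)
  define g0 where "g0 = circlepath 0 R"
  define g1 where "g1 = (\<lambda>w. c * w) \<circ> g0"
  have vp0: "valid_path g0" by (simp add: g0_def)
  have vp1: "valid_path g1"
    unfolding g1_def by (rule valid_path_compose_holomorphic[OF vp0, of _ UNIV]) (auto intro!: holomorphic_intros)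
  have im0: "cmod w = R" if "w \<in> path_image g0" for w
    using that R by (simp add: g0_def)
  have im1: "cmod w = R * cmod c" if "w \<in> path_image g1" for w
    using that im0 by (auto simp: g1_def path_image_compose norm_mult)
  have RK: "R \<le> R * cmod c" using R c by simp
  have imK: "path_image g0 \<subseteq> K" "path_image g1 \<subseteq> K"
    using im0 im1 RK by (force simp: K_def)+
  have hom: "homotopic_loops S' g0 g1"
    unfolding homotopic_loops
  proof (intro exI conjI ballI)
    \<comment> \<open>multiplication by the powers \<open>c\<^sup>s\<close> with \<open>0 \<le> s \<le> 1\<close> sweeps over the annulus\<close>
    let ?h = "\<lambda>x :: real \<times> real. exp (of_real (fst x) * Ln c) * g0 (snd x)"
    have "continuous_on {0..1} g0" using valid_path_imp_path[OF vp0] by (simp add: path_def)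
    then have "continuous_on ({0..1} \<times> {0..1}) (\<lambda>x :: real \<times> real. g0 (snd x))"
      by (rule continuous_on_compose2[OF _ continuous_on_snd[OF continuous_on_id]]) auto
    then show "continuous_on ({0..1} \<times> {0..1}) ?h"
      by (intro continuous_intros)
    show "?h \<in> {0..1} \<times> {0..1} \<rightarrow> S'"
    proof
      fix x :: "real \<times> real" assume x: "x \<in> {0..1} \<times> {0..1}"
      define s where "s = fst x"
      have s: "0 \<le> s" "s \<le> 1" using x by (auto simp: s_def)
      have "g0 (snd x) \<in> path_image g0" using x by (auto simp: path_image_def)
      then have "cmod (g0 (snd x)) = R" by (rule im0)
      then have "cmod (?h x) = R * exp (s * ln (cmod c))"
        using c0 by (simp add: norm_mult s_def)
      moreover have "1 \<le> exp (s * ln (cmod c))" using s c by simp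
      moreover have "exp (s * ln (cmod c)) \<le> exp (1 * ln (cmod c))"
        using s c by (subst exp_le_cancel_iff, intro mult_right_mono) auto
      then have "exp (s * ln (cmod c)) \<le> cmod c" using c0 by simp
      ultimately have "?h x \<in> K" using R by (simp add: K_def)
      then show "?h x \<in> S'" using KS' by blast
    qed
    show "?h (0, t) = g0 t" for t by simp
    show "?h (1, t) = g1 t" for t using c0 by (simp add: g1_def)
    show "pathfinish (?h \<circ> Pair t) = pathstart (?h \<circ> Pair t)" for t
      by (simp add: pathfinish_def pathstart_def g0_def circlepath)
  qed
  have Leq: "contour_integral g0 L = contour_integral g1 L"
    by (rule Cauchy_theorem_homotopic_loops[OF hom S' L vp0 vp1])
  have decomp: "contour_integral g (\<lambda>w. deriv \<Theta> w / \<Theta> w) =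
      (\<Sum>a\<in>Z. of_nat (n a) * contour_integral g (\<lambda>w. 1 / (w - a))) + contour_integral g L"
    if g: "valid_path g" "path_image g \<subseteq> K" "\<And>w. w \<in> path_image g \<Longrightarrow> \<Theta> w \<noteq> 0" for g
  proof (rule contour_integral_unique)
    have "(\<lambda>w. 1 / (w - a)) contour_integrable_on g" if "a \<in> Z" for a
      by (rule contour_integrable_holomorphic_simple[of _ "- {a}"])
        (use g that in \<open>auto intro!: holomorphic_intros simp: Z_def\<close>)
    moreover have "L contour_integrable_on g"
      by (rule contour_integrable_holomorphic_simple[OF L S' g(1)]) (use g(2) KS' in blast)
    ultimately have "((\<lambda>w. (\<Sum>a\<in>Z. of_nat (n a) * (1 / (w - a))) + L w) has_contour_integral
      (\<Sum>a\<in>Z. of_nat (n a) * contour_integral g (\<lambda>w. 1 / (w - a))) + contour_integral g L) g"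
      by (intro has_contour_integral_add has_contour_integral_sum has_contour_integral_lmul
            has_contour_integral_integral finZ)
    then show "((\<lambda>w. deriv \<Theta> w / \<Theta> w) has_contour_integral
      (\<Sum>a\<in>Z. of_nat (n a) * contour_integral g (\<lambda>w. 1 / (w - a))) + contour_integral g L) g"
    proof (rule has_contour_integral_eq)
      fix w assume w: "w \<in> path_image g"
      have "w \<in> S" using w g(2) K(2) by blast
      from log_deriv_zeros[OF S(1) this H(1) finZ g(3)[OF w] H(3) npos]
      show "(\<Sum>a\<in>Z. of_nat (n a) * (1 / (w - a))) + L w = deriv \<Theta> w / \<Theta> w"
        by (simp add: L_def)
    qed
  qed
  have comp: "contour_integral g1 \<phi> = contour_integral g0 (\<lambda>w. c * \<phi> (c * w))" for \<phi>
    unfolding g1_def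
    by (subst contour_integral_comp_analyticW[of _ UNIV]) (auto simp: vp0 intro!: analytic_intros)
  have circ: "contour_integral g0 (\<lambda>w. 1 / (w - a)) = 2 * of_real pi * \<i> * winding_number g0 a"
    if "cmod a \<noteq> R" for a
    using has_contour_integral_winding_number[OF vp0, of a] im0 that
    by (metis contour_integral_unique of_real_mult of_real_numeral)
  have out: "contour_integral g0 (\<lambda>w. 1 / (w - a)) = 0" if "a \<in> Z" for a
  proof -
    have a: "R < cmod a" using that by (simp add: Z_def)
    have "winding_number g0 a = 0"
      by (rule winding_number_zero_outside[of _ "cball 0 R"])
        (use a R in \<open>auto simp: g0_def\<close>)
    then show ?thesis using circ[of a] a by simp
  qed
  have ins: "contour_integral g1 (\<lambda>w. 1 / (w - a)) = 2 * of_real pi * \<i>" if "a \<in> Z" for a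
  proof -
    have "cmod a < R * cmod c" using that by (simp add: Z_def)
    then have a: "cmod (a / c) < R" using c0 by (simp add: norm_divide pos_divide_less_eq)
    have "c * (1 / (c * w - a)) = 1 / (w - a / c)" for w
      using c0 by (simp add: field_simps)
    then have "contour_integral g1 (\<lambda>w. 1 / (w - a)) = contour_integral g0 (\<lambda>w. 1 / (w - a / c))"
      unfolding comp by simp
    also have "winding_number g0 (a / c) = 1"
      unfolding g0_def by (rule winding_number_circlepath) (use a in simp)
    then have "contour_integral g0 (\<lambda>w. 1 / (w - a / c)) = 2 * of_real pi * \<i>"
      using circ[of "a / c"] a by simp
    finally show ?thesis .
  qed
  have ld: "c * (deriv \<Theta> (c * w) / \<Theta> (c * w)) = of_nat T * (1 / (w - 0)) + deriv \<Theta> w / \<Theta> w"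
    if w: "cmod w = R" for w
  proof -
    have w0: "w \<noteq> 0" "c * w \<noteq> 0" using w R c0 by auto
    have "(\<Theta> has_field_derivative deriv \<Theta> (c * w)) (at (c * w))"
      "(\<Theta> has_field_derivative deriv \<Theta> w) (at w)"
      using w0 by (auto intro!: holomorphic_derivI[OF holS S(1)] simp: S_def)
    note d = this
    have "((\<lambda>w. \<Theta> (c * w)) has_field_derivative deriv \<Theta> (c * w) * c) (at w)"
      by (rule DERIV_chain2[where f = \<Theta> and g = "\<lambda>w. c * w", OF d(1)]) (auto intro!: derivative_eq_intros)
    moreover have "((\<lambda>w. C * w ^ T * \<Theta> w) has_field_derivative
        C * w ^ T * (of_nat T / w * \<Theta> w + deriv \<Theta> w)) (at w)"
    proof -
      have "((\<lambda>w. w ^ T) has_field_derivative w ^ T * (of_nat T / w)) (at w)"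
        using has_field_derivative_prod_linear_powers[of "{0}" w "\<lambda>_. T"] w0 by simp
      from DERIV_cmult[OF DERIV_mult[OF this d(2)], of C] show ?thesis by (simp add: algebra_simps)
    qed
    then have "((\<lambda>w. \<Theta> (c * w)) has_field_derivative
        C * w ^ T * (of_nat T / w * \<Theta> w + deriv \<Theta> w)) (at w)"
      by (rule has_field_derivative_transform_within_open[OF _ S(1)]) (use w0 qp in \<open>auto simp: S_def\<close>)
    ultimately have "deriv \<Theta> (c * w) * c = C * w ^ T * (of_nat T / w * \<Theta> w + deriv \<Theta> w)"
      by (rule DERIV_unique)
    then show ?thesis using qp[OF w0(1)] nz[OF w] C w0 by (simp add: field_simps)
  qed
  have "contour_integral g1 (\<lambda>w. deriv \<Theta> w / \<Theta> w) =
      contour_integral g0 (\<lambda>w. of_nat T * (1 / (w - 0)) + deriv \<Theta> w / \<Theta> w)"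
    unfolding comp by (rule contour_integral_eq) (use ld im0 in blast)
  also have "\<dots> = of_nat T * (2 * of_real pi * \<i>) + contour_integral g0 (\<lambda>w. deriv \<Theta> w / \<Theta> w)"
  proof -
    have "winding_number g0 0 = 1" unfolding g0_def using R by (intro winding_number_circlepath) simp
    then have e: "contour_integral g0 (\<lambda>w. 1 / (w - 0)) = 2 * of_real pi * \<i>" using circ[of 0] R by simp
    have 1: "(\<lambda>w. 1 / (w - 0)) contour_integrable_on g0"
      by (rule contour_integrable_holomorphic_simple[of _ S])
        (use vp0 S imK K in \<open>auto intro!: holomorphic_intros simp: S_def\<close>)
    have 2: "(\<lambda>w. deriv \<Theta> w / \<Theta> w) contour_integrable_on g0"
    proof (rule contour_integrable_holomorphic_simple[OF _ _ vp0])
      show "open (S - {w\<in>S. \<Theta> w = 0})"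
      proof -
        have "open (S \<inter> \<Theta> -` (- {0}))"
          by (rule continuous_open_preimage) (use holS S holomorphic_on_imp_continuous_on in auto)
        also have "S \<inter> \<Theta> -` (- {0}) = S - {w\<in>S. \<Theta> w = 0}" by auto
        finally show ?thesis .
      qed
      show "path_image g0 \<subseteq> S - {w\<in>S. \<Theta> w = 0}" using imK K nz im0 by blast
      show "(\<lambda>w. deriv \<Theta> w / \<Theta> w) holomorphic_on S - {w\<in>S. \<Theta> w = 0}"
        by (intro holomorphic_intros holomorphic_on_subset[OF holomorphic_deriv[OF holS S(1)]]
          holomorphic_on_subset[OF holS]) auto
    qed
    show ?thesis
      using has_contour_integral_add[OF has_contour_integral_lmul[OF has_contour_integral_integral[OF 1]]
          has_contour_integral_integral[OF 2], of "of_nat T"] unfolding e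
      by (rule contour_integral_unique)
  qed
  also have "contour_integral g0 (\<lambda>w. deriv \<Theta> w / \<Theta> w) = contour_integral g0 L"
    using decomp[OF vp0 imK(1)] nz im0 out by simp
  finally have "of_nat T * (2 * of_real pi * \<i>) = contour_integral g1 (\<lambda>w. deriv \<Theta> w / \<Theta> w) - contour_integral g1 L"
    by (simp add: Leq)
  also have "\<dots> = (\<Sum>a\<in>Z. of_nat (n a) * (2 * of_real pi * \<i>))"
    using decomp[OF vp1 imK(2)] nz' im1 ins by simp
  also have "\<dots> = of_nat (\<Sum>a\<in>Z. n a) * (2 * of_real pi * \<i>)" by (simp add: sum_distrib_right)
  finally have "complex_of_nat T = of_nat (\<Sum>a\<in>Z. n a)" by simp
  then show "(\<Sum>a\<in>Z. nat (zorder \<Theta> a)) = T" unfolding n_def of_nat_eq_iff by simp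
qed

text \<open>
  Rouche's theorem counts the zeros of \<open>g\<close> in the disc with multiplicity, and their number is the
  multiplicity of \<open>a\<close>. Hence there is one, and there are at most that many different ones.
\<close>

lemma zeros_near_isolated_zero:
  fixes f g :: "complex \<Rightarrow> complex"
  assumes f: "f holomorphic_on ball a r'" and g: "g holomorphic_on ball a r'" and r: "0 < r" "r < r'"
    and fa: "f a = 0" and only: "\<And>w. w \<in> cball a r \<Longrightarrow> f w = 0 \<Longrightarrow> w = a"
    and close: "\<And>w. w \<in> sphere a r \<Longrightarrow> cmod (g w - f w) < cmod (f w)"
  defines "Z \<equiv> {w\<in>ball a r. g w = 0}"
  shows "finite Z" "Z \<noteq> {}" "card Z \<le> nat (zorder f a)"
proof -
  define s where "s = ball a ((r + r') / 2)"
  have s: "cball a r \<subseteq> s" "s \<subseteq> cball a ((r + r') / 2)" "cball a ((r + r') / 2) \<subseteq> ball a r'"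
    using r by (auto simp: s_def)
  have os: "open s" "connected s" by (simp_all add: s_def)
  have sub: "s \<subseteq> ball a r'" using s by blast
  define p where "p = a + of_real r"
  have p: "p \<in> sphere a r" "p \<in> s" "p \<in> ball a r'" using r s by (auto simp: p_def dist_norm s_def)
  have fp: "f p \<noteq> 0" and gp: "g p \<noteq> 0" using close[OF p(1)] by auto
  have fin: "finite {w\<in>s. h w = 0}" if h: "h holomorphic_on ball a r'" "h p \<noteq> 0" for h
  proof (cases "h constant_on ball a r'")
    case True
    then have e: "{w\<in>s. h w = 0} = {}" using h(2) p(3) sub by (auto simp: constant_on_def)
    show ?thesis unfolding e by simp
  next
    case False
    have "finite {w\<in>cball a ((r + r') / 2). h w = 0}"
      by (rule holomorphic_compact_finite_zeros[OF h(1) _ _ _ s(3) False]) auto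
    then show ?thesis by (rule finite_subset[rotated]) (use s(2) in auto)
  qed
  define \<gamma> where "\<gamma> = circlepath a r"
  have wn1: "winding_number \<gamma> w = 1" if "w \<in> ball a r" for w
    unfolding \<gamma>_def by (rule winding_number_circlepath) (use that in \<open>auto simp: dist_norm norm_minus_commute\<close>)
  have wn0: "winding_number \<gamma> w = 0" if "w \<notin> cball a r" for w
    by (rule winding_number_zero_outside[of _ "cball a r"])
      (use that r in \<open>auto simp: \<gamma>_def sphere_cball\<close>)
  have wn: "(\<Sum>w\<in>{w\<in>s. h w = 0}. winding_number \<gamma> w * zorder h w) = of_int (\<Sum>w\<in>{w\<in>ball a r. h w = 0}. zorder h w)"
    if h: "h holomorphic_on ball a r'" "h p \<noteq> 0" and sph: "\<And>w. w \<in> sphere a r \<Longrightarrow> h w \<noteq> 0" for h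
  proof -
    have "(\<Sum>w\<in>{w\<in>s. h w = 0}. winding_number \<gamma> w * zorder h w) =
        (\<Sum>w\<in>{w\<in>ball a r. h w = 0}. winding_number \<gamma> w * zorder h w)"
    proof (rule sum.mono_neutral_right[OF fin[OF h]])
      show "{w \<in> ball a r. h w = 0} \<subseteq> {w \<in> s. h w = 0}" using s(1) by auto
      show "\<forall>w\<in>{w \<in> s. h w = 0} - {w \<in> ball a r. h w = 0}. winding_number \<gamma> w * zorder h w = 0"
      proof
        fix w assume w: "w \<in> {w \<in> s. h w = 0} - {w \<in> ball a r. h w = 0}"
        then have "w \<notin> sphere a r" using sph by auto
        then have "w \<notin> cball a r" using w by auto
        then show "winding_number \<gamma> w * zorder h w = 0" by (simp add: wn0)
      qed
    qed
    also have "\<dots> = (\<Sum>w\<in>{w\<in>ball a r. h w = 0}. of_int (zorder h w))"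
      by (intro sum.cong refl) (simp add: wn1)
    finally show ?thesis by simp
  qed
  have gsph: "g w \<noteq> 0" "f w \<noteq> 0" if "w \<in> sphere a r" for w using close[OF that] by auto
  have rouche: "(\<Sum>w\<in>{w\<in>s. f w + (g w - f w) = 0}. winding_number \<gamma> w * zorder (\<lambda>w. f w + (g w - f w)) w) =
      (\<Sum>w\<in>{w\<in>s. f w = 0}. winding_number \<gamma> w * zorder f w)"
  proof (rule Rouche_theorem[OF os])
    show "finite {w \<in> s. f w + (g w - f w) = 0}" using fin[OF g gp] by simp
    show "finite {w \<in> s. f w = 0}" by (rule fin[OF f fp])
    show "f holomorphic_on s" "(\<lambda>w. g w - f w) holomorphic_on s"
      using f g sub by (auto intro!: holomorphic_intros intro: holomorphic_on_subset)
    show "\<forall>z. z \<notin> s \<longrightarrow> winding_number \<gamma> z = 0" using wn0 s(1) by blast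
    show "path_image \<gamma> \<subseteq> s" using s(1) r by (auto simp: \<gamma>_def)
    show "\<forall>z\<in>path_image \<gamma>. cmod (g z - f z) < cmod (f z)"
      using close r by (auto simp: \<gamma>_def)
  qed (simp_all add: \<gamma>_def)
  have "complex_of_int (\<Sum>w\<in>Z. zorder g w) = of_int (\<Sum>w\<in>{w\<in>ball a r. f w = 0}. zorder f w)"
    using rouche wn[OF g gp gsph(1)] wn[OF f fp gsph(2)] by (simp add: Z_def)
  then have "(\<Sum>w\<in>Z. zorder g w) = (\<Sum>w\<in>{w\<in>ball a r. f w = 0}. zorder f w)"
    by (simp only: of_int_eq_iff)
  also have "{w\<in>ball a r. f w = 0} = {a}" using fa only r by auto
  finally have eq: "(\<Sum>w\<in>Z. zorder g w) = zorder f a" by simp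
  show finZ: "finite Z" 
    by (rule finite_subset[OF _ fin[OF g gp]]) (use s(1) in \<open>auto simp: Z_def\<close>)
  have "zorder g w > 0" if "w \<in> Z" for w
    using zorder_exist_zero[OF g open_ball connected_ball, of w] bexI[of "\<lambda>w. g w \<noteq> 0", OF gp p(3)] that r
    by (auto simp: Z_def)
  then have "(\<Sum>w\<in>Z. 1) \<le> (\<Sum>w\<in>Z. zorder g w)" by (intro sum_mono) force
  then have "int (card Z) \<le> zorder f a" by (simp add: eq)
  then show "card Z \<le> nat (zorder f a)" by simp
  have "zorder f a > 0"
    using zorder_exist_zero[OF f open_ball connected_ball, of a] bexI[of "\<lambda>w. f w \<noteq> 0", OF fp p(3)] fa r by auto
  then show "Z \<noteq> {}" using eq by auto
qed

section \<open>Zeros of a function with a quasi-periodic rescaling limit\<close>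

lemma surjection_from_lessThan:
  assumes "finite S" "S \<noteq> {}" "card S \<le> N"
  obtains e :: "nat \<Rightarrow> 'a" where "e ` {..<N} = S"
proof -
  obtain h where h: "bij_betw h {0..<card S} S" using ex_bij_betw_nat_finite[OF assms(1)] by blast
  have hS: "h ` {0..<card S} = S" using h by (simp add: bij_betw_def)
  have pos: "0 < card S" using assms by (simp add: card_gt_0_iff)
  define e where "e = (\<lambda>i. if i < card S then h i else h 0)"
  have "e ` {..<N} \<subseteq> S" using hS pos by (auto simp: e_def)
  moreover have "S \<subseteq> e ` {..<N}"
  proof
    fix x assume "x \<in> S"
    then have "x \<in> h ` {0..<card S}" unfolding hS .
    then obtain i where "i < card S" "x = h i" by auto
    then show "x \<in> e ` {..<N}" using assms(3) by (auto simp: e_def intro!: image_eqI[of _ _ i])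
  qed
  ultimately show thesis using that by blast
qed

text \<open>
  If \<open>a\<close> is a zero, the last estimate converts small values of \<open>f\<close> into small distances from \<open>a\<close>.
  The larger radius leaves room for an application of Rouche's theorem to the smaller disc.
\<close>

lemma isolated_zero_lower_bound:
  assumes f: "f holomorphic_on S" "open S" "connected S" "a \<in> S" "\<exists>w\<in>S. f w \<noteq> 0"
    and V: "open V" "a \<in> V"
  obtains r r' \<epsilon> where "0 < r" "r < r'" "ball a r' \<subseteq> V" "ball a r' \<subseteq> S" "0 < \<epsilon>"
    "\<And>w. w \<in> cball a r \<Longrightarrow> f w = 0 \<Longrightarrow> w = a"
    "\<And>w. w \<in> cball a r \<Longrightarrow> \<epsilon> * cmod (w - a) ^ nat (zorder f a) \<le> cmod (f w)"
proof -
  define g where "g = zor_poly f a"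
  obtain s where s: "s > 0" "cball a s \<subseteq> S" "g holomorphic_on cball a s"
    "\<And>w. w \<in> cball a s \<Longrightarrow> f w = g w * (w - a) ^ nat (zorder f a) \<and> g w \<noteq> 0"
    using zorder_exist_zero[OF f] unfolding g_def by blast
  obtain t where t: "t > 0" "ball a t \<subseteq> V" using V openE by blast
  define r' where "r' = min s t"
  define r where "r = r' / 2"
  have r: "0 < r" "r < r'" "r' \<le> s" "r' \<le> t" using s(1) t(1) by (auto simp: r_def r'_def)
  have sub: "cball a r \<subseteq> cball a s" using r by auto
  have "continuous_on (cball a r) (\<lambda>w. cmod (g w))"
    using holomorphic_on_imp_continuous_on[OF s(3)] sub by (intro continuous_on_norm) (rule continuous_on_subset)
  then obtain x where x: "x \<in> cball a r" "\<And>w. w \<in> cball a r \<Longrightarrow> cmod (g x) \<le> cmod (g w)"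
    using continuous_attains_inf[of "cball a r" "\<lambda>w. cmod (g w)"] r by auto
  show thesis
  proof
    show "0 < r" "r < r'" by (fact r)+
    show "ball a r' \<subseteq> V" using r(4) t(2) by (auto simp: subset_iff)
    show "ball a r' \<subseteq> S" using r(3) s(2) by (auto simp: subset_iff)
    show "0 < cmod (g x)" using s(4) x(1) sub by auto
    show "w = a" if "w \<in> cball a r" "f w = 0" for w
      using s(4)[of w] that sub by (auto simp: subset_iff)
    show "cmod (g x) * cmod (w - a) ^ nat (zorder f a) \<le> cmod (f w)" if "w \<in> cball a r" for w
    proof -
      have "f w = g w * (w - a) ^ nat (zorder f a)" using s(4)[of w] that sub by blast
      then show ?thesis using x(2)[OF that] by (simp add: norm_mult norm_power mult_right_mono)
    qed
  qed
qed

text \<open>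
  All large zeros of \<open>F\<close> are of the form \<open>c\<^sup>n \<xi>\<close> with \<open>\<xi>\<close> a zero of \<open>G\<^sub>n\<close> in a fixed fundamental
  annulus, and these are close to the zeros of \<open>\<Theta>\<close>. Each zero \<open>a\<close> of \<open>\<Theta>\<close> receives as many of the
  indices \<open>1, \<dots>, T\<close> as its multiplicity; this suffices to list the different zeros of \<open>G\<^sub>n\<close>
  near \<open>a\<close>, with repetitions if there are fewer. The finitely many small zeros of \<open>F\<close> are put in
  front of the sequences.

  For the rate, a zero \<open>\<xi>\<close> near \<open>a\<close> satisfies \<open>\<epsilon> \<bar>\<xi> - a\<bar>\<^sup>r \<le> \<bar>\<Theta>(\<xi>)\<bar> = \<bar>\<Theta>(\<xi>) - G\<^sub>n(\<xi>)\<bar>\<close>, where \<open>r\<close> is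
  the multiplicity. Since \<open>r \<le> T\<close>, a bound by the \<open>T\<close>-th power of \<open>\<theta>\<^sup>n\<close> for the right-hand
  side suffices for \<open>\<bar>\<xi> - a\<bar> = O(\<theta>\<^sup>n)\<close>.
\<close>

lemma zeros_asymptotic_to_geometric:
  fixes F \<Theta> :: "complex \<Rightarrow> complex" and G K :: "nat \<Rightarrow> complex \<Rightarrow> complex" and c C :: complex
  assumes F: "F holomorphic_on UNIV" "\<exists>z. F z \<noteq> 0"
    and \<Theta>: "\<Theta> holomorphic_on - {0}" "\<exists>w. w \<noteq> 0 \<and> \<Theta> w \<noteq> 0"
    and c: "1 < cmod c" and C: "C \<noteq> 0" and T: "0 < T"
    and qp: "\<And>w. w \<noteq> 0 \<Longrightarrow> \<Theta> (c * w) = C * w ^ T * \<Theta> w"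
    and G: "\<And>n. G n holomorphic_on - {0}"
    and FG: "\<And>n w. w \<noteq> 0 \<Longrightarrow> F (c ^ n * w) = K n w * G n w" "\<And>n w. w \<noteq> 0 \<Longrightarrow> K n w \<noteq> 0"
    and lim: "\<And>Y. 1 \<le> Y \<Longrightarrow> uniform_limit {w. 1 / Y \<le> cmod w \<and> cmod w \<le> Y} G \<Theta> sequentially"
  obtains z :: "nat \<Rightarrow> nat \<Rightarrow> complex" and A :: "nat \<Rightarrow> complex"
  where "{w. F w = 0} = {z n \<nu> | n \<nu>. \<nu> \<in> {1..T}}"
    and "\<And>\<nu>. \<nu> \<in> {1..T} \<Longrightarrow> A \<nu> \<noteq> 0"
    and "\<And>\<nu>. \<nu> \<in> {1..T} \<Longrightarrow> (\<lambda>n. z n \<nu> / (A \<nu> * c ^ n)) \<longlonglongrightarrow> 1"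
    and "\<And>\<theta> \<nu>. \<lbrakk>0 < \<theta>; \<theta> < 1; \<nu> \<in> {1..T};
        \<And>Y. 1 \<le> Y \<Longrightarrow> \<exists>B. \<forall>n w. 1 / Y \<le> cmod w \<longrightarrow> cmod w \<le> Y \<longrightarrow> cmod (G n w - \<Theta> w) \<le> B * (\<theta> ^ T) ^ n\<rbrakk>
      \<Longrightarrow> (\<lambda>n. z n \<nu> / (A \<nu> * c ^ n) - 1) \<in> O(\<lambda>n. complex_of_real (\<theta> ^ n))"
proof -
  define S where "S = - {0 :: complex}"
  have S: "open S" "connected S" "\<Theta> holomorphic_on S" "\<exists>w\<in>S. \<Theta> w \<noteq> 0"
    using \<Theta> unfolding S_def by (auto intro: connected_punctured_universe)
  have c0: "c \<noteq> 0" using c by auto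
  \<comment> \<open>the functional equation at 1 and 2 would give \<open>2\<^sup>T = 1\<close>\<close>
  have noncon: "\<not> \<Theta> constant_on S"
  proof
    assume "\<Theta> constant_on S"
    then obtain y where y: "\<And>w. w \<in> S \<Longrightarrow> \<Theta> w = y" by (auto simp: constant_on_def)
    then have "y \<noteq> 0" using S(4) by auto
    then have "C * w ^ T = 1" if "w \<in> S" for w
      using qp[of w] y[of w] y[of "c * w"] that c0 by (auto simp: S_def)
    from this[of 1] this[of 2] have "(2 :: complex) ^ T = 1" by (auto simp: S_def)
    then have "cmod (2 ^ T) = 1" by simp
    then have "(2 :: real) ^ T = 1" by (simp add: norm_power)
    moreover have "(1 :: real) < 2 ^ T" using T by (intro one_less_power) auto
    ultimately show False by simp
  qed
  \<comment> \<open>a boundary circle for the fundamental annulus that avoids the zeros of \<open>\<Theta>\<close>\<close>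
  obtain R where R: "1 < R" "\<And>w. cmod w = R \<Longrightarrow> \<Theta> w \<noteq> 0"
  proof -
    let ?K = "cball 0 2 - ball (0::complex) 1"
    have "finite {w\<in>?K. \<Theta> w = 0}"
      by (rule holomorphic_compact_finite_zeros[OF S(3,1,2) _ _ noncon]) (auto intro: compact_diff simp: S_def)
    then have "infinite ({1<..<2 :: real} - cmod ` {w\<in>?K. \<Theta> w = 0})"
      by (intro Diff_infinite_finite finite_imageI infinite_Ioo) auto
    then obtain R where "R \<in> {1<..<2 :: real} - cmod ` {w\<in>?K. \<Theta> w = 0}"
      by (metis finite.emptyI equals0I)
    then have "1 < R" "\<And>w. cmod w = R \<Longrightarrow> \<Theta> w \<noteq> 0" by force+
    then show thesis using that by blast
  qed
  have Rpos: "0 < R" using R(1) by simp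
  define Z where "Z = {w. \<Theta> w = 0 \<and> R < cmod w \<and> cmod w < R * cmod c}"
  define N where "N = (\<lambda>a. nat (zorder \<Theta> a))"
  have finZ: "finite Z" and sumN: "(\<Sum>a\<in>Z. N a) = T"
    using quasi_periodic_zero_count[OF \<Theta>(1) c C qp Rpos R(2)] by (simp_all add: Z_def N_def)
  have ZS: "Z \<subseteq> S" using Rpos by (auto simp: Z_def S_def)
  have Npos: "0 < N a" if "a \<in> Z" for a
    using zorder_exist_zero[OF S(3,1,2) _ S(4), of a] that ZS by (auto simp: N_def Z_def)
  have NT: "N a \<le> T" if "a \<in> Z" for a
    unfolding sumN[symmetric] using that finZ by (intro member_le_sum) auto
  define V where "V = {w :: complex. R < cmod w \<and> cmod w < R * cmod c}"
  have V: "open V" unfolding V_def by (intro open_Collect_conj open_Collect_less continuous_intros)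
  define Kc where "Kc = cball 0 (R * cmod c) - ball (0::complex) R"
  have VK: "V \<subseteq> Kc" and KS: "Kc \<subseteq> S" using Rpos by (auto simp: V_def Kc_def S_def)
  have compK: "compact Kc" unfolding Kc_def by (auto intro: compact_diff)
  define Y where "Y = R * cmod c"
  have Y: "1 \<le> Y" unfolding Y_def using R(1) c by (metis less_imp_le mult_ge1_I)
  have KY: "Kc \<subseteq> {w. 1 / Y \<le> cmod w \<and> cmod w \<le> Y}"
  proof
    fix w assume w: "w \<in> Kc"
    have "1 / Y \<le> 1" using Y by simp
    moreover have "R \<le> cmod w" "cmod w \<le> Y" using w by (auto simp: Kc_def Y_def)
    ultimately show "w \<in> {w. 1 / Y \<le> cmod w \<and> cmod w \<le> Y}"
      unfolding mem_Collect_eq using R(1) by linarith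
  qed
  have close: "\<forall>\<^sub>F n in sequentially. \<forall>w\<in>Kc. cmod (G n w - \<Theta> w) < e" if "0 < e" for e
  proof -
    have "\<forall>\<^sub>F n in sequentially. \<forall>w\<in>{w. 1 / Y \<le> cmod w \<and> cmod w \<le> Y}. dist (G n w) (\<Theta> w) < e"
      using lim[OF Y] that unfolding uniform_limit_iff by blast
    then show ?thesis by (rule eventually_mono) (use KY in \<open>auto simp: dist_norm\<close>)
  qed
  define good where "good = (\<lambda>a r r' \<epsilon>. 0 < r \<and> r < r' \<and> ball a r' \<subseteq> V \<and> 0 < \<epsilon> \<and>
      (\<forall>w. w \<in> cball a r \<longrightarrow> \<Theta> w = 0 \<longrightarrow> w = a) \<and>
      (\<forall>w. w \<in> cball a r \<longrightarrow> \<epsilon> * cmod (w - a) ^ N a \<le> cmod (\<Theta> w)))"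
  have "\<forall>a\<in>Z. \<exists>r r' \<epsilon>. good a r r' \<epsilon>"
  proof
    fix a assume a: "a \<in> Z"
    then have "a \<in> S" "a \<in> V" using ZS by (auto simp: Z_def V_def)
    obtain r r' \<epsilon> where "0 < r" "r < r'" "ball a r' \<subseteq> V" "0 < \<epsilon>"
      "\<And>w. w \<in> cball a r \<Longrightarrow> \<Theta> w = 0 \<Longrightarrow> w = a"
      "\<And>w. w \<in> cball a r \<Longrightarrow> \<epsilon> * cmod (w - a) ^ N a \<le> cmod (\<Theta> w)"
      unfolding N_def
      by (rule isolated_zero_lower_bound[OF S(3,1,2) \<open>a \<in> S\<close> S(4) V \<open>a \<in> V\<close>]) blast
    then have "good a r r' \<epsilon>" by (simp add: good_def)
    then show "\<exists>r r' \<epsilon>. good a r r' \<epsilon>" by blast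
  qed
  then obtain r r' \<epsilon> where good: "\<And>a. a \<in> Z \<Longrightarrow> good a (r a) (r' a) (\<epsilon> a)" by metis
  have r: "0 < r a" "r a < r' a" "ball a (r' a) \<subseteq> V" and \<epsilon>: "0 < \<epsilon> a" if "a \<in> Z" for a
    using good[OF that] by (simp_all add: good_def)
  have only: "w = a" if "a \<in> Z" "w \<in> cball a (r a)" "\<Theta> w = 0" for a w
    using good[OF that(1)] that(2,3) unfolding good_def by blast
  have low: "\<epsilon> a * cmod (w - a) ^ N a \<le> cmod (\<Theta> w)" if "a \<in> Z" "w \<in> cball a (r a)" for a w
    using good[OF that(1)] that(2) unfolding good_def by blast
  have cballV: "cball a (r a) \<subseteq> V" if "a \<in> Z" for a
    using r(2,3)[OF that] by (auto simp: subset_iff)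
  \<comment> \<open>off the discs \<open>\<Theta>\<close> is bounded away from zero, so \<open>G n\<close> has no zeros there for large \<open>n\<close>\<close>
  define Kr where "Kr = Kc - (\<Union>a\<in>Z. ball a (r a))"
  have "compact Kr" unfolding Kr_def by (intro compact_diff compK) auto
  moreover have "of_real R \<in> Kr"
  proof -
    have "complex_of_real R \<in> Kc" using Rpos c by (auto simp: Kc_def)
    moreover have "complex_of_real R \<notin> ball a (r a)" if "a \<in> Z" for a
    proof
      assume "complex_of_real R \<in> ball a (r a)"
      then have "complex_of_real R \<in> V" using cballV[OF that] by auto
      then show False using Rpos by (simp add: V_def)
    qed
    ultimately show ?thesis by (auto simp: Kr_def)
  qed
  moreover have "continuous_on Kr (\<lambda>w. cmod (\<Theta> w))"
    using holomorphic_on_imp_continuous_on[OF S(3)] KS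
    by (intro continuous_on_norm) (auto simp: Kr_def elim!: continuous_on_subset)
  ultimately obtain x where x: "x \<in> Kr" "\<And>w. w \<in> Kr \<Longrightarrow> cmod (\<Theta> x) \<le> cmod (\<Theta> w)"
    using continuous_attains_inf[of Kr "\<lambda>w. cmod (\<Theta> w)"] by auto
  have \<Theta>x: "\<Theta> x \<noteq> 0"
  proof
    assume 0: "\<Theta> x = 0"
    have xK: "R \<le> cmod x" "cmod x \<le> R * cmod c" using x(1) by (auto simp: Kr_def Kc_def)
    have "cmod x \<noteq> R" using R(2) 0 by auto
    moreover have "cmod x \<noteq> R * cmod c"
    proof
      assume e: "cmod x = R * cmod c"
      have "cmod (x / c) = R" using e c0 by (simp add: norm_divide)
      moreover have "x / c \<noteq> 0" using e c0 Rpos by auto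
      ultimately show False using qp[of "x / c"] R(2)[of "x / c"] 0 C c0 by simp
    qed
    ultimately have "x \<in> Z" using xK 0 by (auto simp: Z_def)
    then show False using x(1) r(1) by (auto simp: Kr_def)
  qed
  have "\<forall>\<^sub>F n in sequentially. \<forall>a\<in>Z. \<forall>w\<in>Kc. cmod (G n w - \<Theta> w) < \<epsilon> a * r a ^ N a"
    using finZ r(1) \<epsilon> by (intro eventually_ball_finite ballI close) auto
  moreover have "\<forall>\<^sub>F n in sequentially. \<forall>w\<in>Kc. cmod (G n w - \<Theta> w) < cmod (\<Theta> x)"
    using \<Theta>x by (intro close) simp
  ultimately have "\<forall>\<^sub>F n in sequentially. (\<forall>a\<in>Z. \<forall>w\<in>Kc. cmod (G n w - \<Theta> w) < \<epsilon> a * r a ^ N a) \<and>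
      (\<forall>w\<in>Kc. cmod (G n w - \<Theta> w) < cmod (\<Theta> x))"
    by (rule eventually_conj)
  then obtain n0 where n0: "\<And>n a w. n \<ge> n0 \<Longrightarrow> a \<in> Z \<Longrightarrow> w \<in> Kc \<Longrightarrow> cmod (G n w - \<Theta> w) < \<epsilon> a * r a ^ N a"
    "\<And>n w. n \<ge> n0 \<Longrightarrow> w \<in> Kc \<Longrightarrow> cmod (G n w - \<Theta> w) < cmod (\<Theta> x)"
    unfolding eventually_sequentially by blast
  define X where "X = (\<lambda>n a. {w\<in>ball a (r a). G n w = 0})"
  have X: "finite (X n a)" "X n a \<noteq> {}" "card (X n a) \<le> N a" if "n \<ge> n0" "a \<in> Z" for n a
  proof -
    have "ball a (r' a) \<subseteq> S" using r(3)[OF that(2)] VK KS by blast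
    then have h: "\<Theta> holomorphic_on ball a (r' a)" "G n holomorphic_on ball a (r' a)"
      using S(3) G[of n] by (auto simp: S_def elim!: holomorphic_on_subset)
    have z: "\<Theta> a = 0" using that by (simp add: Z_def)
    have cl: "cmod (G n w - \<Theta> w) < cmod (\<Theta> w)" if w: "w \<in> sphere a (r a)" for w
    proof -
      have wc: "w \<in> cball a (r a)" using w by auto
      then have "w \<in> Kc" using cballV[OF \<open>a \<in> Z\<close>] VK by blast
      then have "cmod (G n w - \<Theta> w) < \<epsilon> a * r a ^ N a" using n0(1) \<open>n \<ge> n0\<close> \<open>a \<in> Z\<close> by blast
      also have "r a = cmod (w - a)" using w by (simp add: dist_norm norm_minus_commute)
      also have "\<epsilon> a * cmod (w - a) ^ N a \<le> cmod (\<Theta> w)" by (rule low[OF \<open>a \<in> Z\<close> wc])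
      finally show ?thesis .
    qed
    show "finite (X n a)" "X n a \<noteq> {}" "card (X n a) \<le> N a"
      using zeros_near_isolated_zero[OF h r(1,2)[OF that(2)] z only[OF that(2)] cl]
      by (simp_all add: X_def N_def)
  qed
  have cover: "\<exists>a\<in>Z. w \<in> X n a" if "n \<ge> n0" "w \<in> Kc" "G n w = 0" for n w
  proof (rule ccontr)
    assume "\<not> ?thesis"
    then have "w \<in> Kr" using that by (auto simp: Kr_def X_def)
    then have "cmod (\<Theta> x) \<le> cmod (\<Theta> w)" by (rule x(2))
    then show False using n0(2)[OF that(1,2)] that(3) by simp
  qed
  have "\<forall>n a. \<exists>e. n \<ge> n0 \<longrightarrow> a \<in> Z \<longrightarrow> e ` {..<N a} = X n a"
    using surjection_from_lessThan[OF X] by metis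
  then obtain e where e: "\<And>n a. n \<ge> n0 \<Longrightarrow> a \<in> Z \<Longrightarrow> e n a ` {..<N a} = X n a" by metis
  \<comment> \<open>index \<open>\<nu>\<close> stands for a pair of a zero of \<open>\<Theta>\<close> and a number below its multiplicity\<close>
  have "card {1..T} = card (SIGMA a:Z. {..<N a})" using sumN finZ by (simp add: card_SigmaI)
  then obtain \<phi> where \<phi>: "bij_betw \<phi> {1..T} (SIGMA a:Z. {..<N a})"
    using finite_same_card_bij[of "{1..T}" "SIGMA a:Z. {..<N a}"] finZ by auto
  define W where "W = (\<lambda>\<nu>. fst (\<phi> \<nu>))"
  define \<xi> where "\<xi> = (\<lambda>n \<nu>. e n (W \<nu>) (snd (\<phi> \<nu>)))"
  have \<phi>in: "\<phi> \<nu> \<in> (SIGMA a:Z. {..<N a})" if "\<nu> \<in> {1..T}" for \<nu>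
    using bij_betwE[OF \<phi>] that by blast
  have WZ: "W \<nu> \<in> Z" if "\<nu> \<in> {1..T}" for \<nu> using \<phi>in[OF that] by (auto simp: W_def)
  have W0: "W \<nu> \<noteq> 0" if "\<nu> \<in> {1..T}" for \<nu> using WZ[OF that] ZS by (auto simp: S_def)
  have \<xi>X: "\<xi> n \<nu> \<in> X n (W \<nu>)" if "n \<ge> n0" "\<nu> \<in> {1..T}" for n \<nu>
    using e[OF that(1) WZ[OF that(2)]] \<phi>in[OF that(2)] by (auto simp: \<xi>_def W_def)
  have \<xi>surj: "\<exists>\<nu>\<in>{1..T}. w = \<xi> n \<nu>" if nw: "n \<ge> n0" "a \<in> Z" "w \<in> X n a" for n a w
  proof -
    obtain i where i: "i < N a" "w = e n a i" using e[OF nw(1,2)] nw(3) by auto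
    then have "(a, i) \<in> \<phi> ` {1..T}" unfolding bij_betw_imp_surj_on[OF \<phi>] using nw(2) by simp
    then obtain \<nu> where \<nu>: "\<nu> \<in> {1..T}" "(a, i) = \<phi> \<nu>" by (rule imageE)
    then have "w = \<xi> n \<nu>" using i(2) \<nu>(2)[symmetric] by (simp add: \<xi>_def W_def)
    then show ?thesis using \<nu>(1) by blast
  qed
  have \<xi>K: "\<xi> n \<nu> \<in> Kc" "\<xi> n \<nu> \<in> cball (W \<nu>) (r (W \<nu>))" "G n (\<xi> n \<nu>) = 0" "\<xi> n \<nu> \<noteq> 0"
    if "n \<ge> n0" "\<nu> \<in> {1..T}" for n \<nu>
  proof -
    show 1: "\<xi> n \<nu> \<in> cball (W \<nu>) (r (W \<nu>))" "G n (\<xi> n \<nu>) = 0" using \<xi>X[OF that] by (auto simp: X_def)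
    then show "\<xi> n \<nu> \<in> Kc" using cballV[OF WZ[OF that(2)]] VK by blast
    then show "\<xi> n \<nu> \<noteq> 0" using KS by (auto simp: S_def)
  qed
  have \<xi>F: "F (c ^ n * \<xi> n \<nu>) = 0" if "n \<ge> n0" "\<nu> \<in> {1..T}" for n \<nu>
    using FG(1)[of "\<xi> n \<nu>" n] \<xi>K[OF that] by simp
  define B where "B = {z. F z = 0 \<and> cmod z < R * cmod c ^ n0}"
  have finB: "finite B"
  proof (cases "F constant_on UNIV")
    case True
    then have B: "B = {}" using F(2) by (auto simp: B_def constant_on_def)
    show ?thesis unfolding B by simp
  next
    case False
    have "finite {z\<in>cball 0 (R * cmod c ^ n0). F z = 0}"
      by (rule holomorphic_compact_finite_zeros[OF F(1) _ _ _ _ False]) auto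
    then show ?thesis by (rule finite_subset[rotated]) (auto simp: B_def)
  qed
  \<comment> \<open>one large zero is added to make the set of initial zeros nonempty\<close>
  define B' where "B' = insert (c ^ n0 * \<xi> n0 1) B"
  have B': "finite B'" "B' \<noteq> {}" "\<And>z. z \<in> B' \<Longrightarrow> F z = 0"
    using finB \<xi>F[of n0 1] T by (auto simp: B'_def B_def)
  define s where "s = card B'"
  obtain b where b: "b ` {..<s} = B'" using surjection_from_lessThan[OF B'(1,2)] s_def by blast
  define z where "z = (\<lambda>n \<nu>. if n < s then b n else c ^ (n0 + (n - s)) * \<xi> (n0 + (n - s)) \<nu>)"
  \<comment> \<open>the index shift between \<open>z\<close> and \<open>\<xi>\<close> is compensated by a power of \<open>c\<close>\<close>
  define A where "A = (\<lambda>\<nu>. W \<nu> * c ^ n0 / c ^ s)"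
  have ratio: "z (n + s) \<nu> / (A \<nu> * c ^ (n + s)) = \<xi> (n0 + n) \<nu> / W \<nu>" if "\<nu> \<in> {1..T}" for n \<nu>
    using c0 W0[OF that] by (simp add: z_def A_def power_add)
  have \<xi>_close: "\<epsilon> (W \<nu>) * cmod (\<xi> n \<nu> - W \<nu>) ^ N (W \<nu>) \<le> cmod (G n (\<xi> n \<nu>) - \<Theta> (\<xi> n \<nu>))"
    if "n \<ge> n0" "\<nu> \<in> {1..T}" for n \<nu>
    using low[OF WZ[OF that(2)] \<xi>K(2)[OF that]] \<xi>K(3)[OF that] by simp
  show thesis
  proof (rule that)
    show "{w. F w = 0} = {z n \<nu> |n \<nu>. \<nu> \<in> {1..T}}"
    proof
      show "{z n \<nu> |n \<nu>. \<nu> \<in> {1..T}} \<subseteq> {w. F w = 0}"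
      proof clarify
        fix n \<nu> assume \<nu>: "\<nu> \<in> {1..T}"
        have "b n \<in> B'" if "n < s" using b that by blast
        then show "F (z n \<nu>) = 0"
          using B'(3) \<xi>F[of "n0 + (n - s)" \<nu>] \<nu> by (cases "n < s") (simp_all add: z_def)
      qed
      show "{w. F w = 0} \<subseteq> {z n \<nu> |n \<nu>. \<nu> \<in> {1..T}}"
      proof
        fix w assume "w \<in> {w. F w = 0}"
        then have Fw: "F w = 0" by simp
        show "w \<in> {z n \<nu> |n \<nu>. \<nu> \<in> {1..T}}"
        proof (cases "cmod w < R * cmod c ^ n0")
          case True
          then have "w \<in> b ` {..<s}" using Fw unfolding b by (simp add: B'_def B_def)
          then obtain n where "n < s" "w = b n" by auto
          then have "w = z n 1" by (simp add: z_def)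
          moreover have "(1 :: nat) \<in> {1..T}" using T by simp
          ultimately show ?thesis by blast
        next
          case False
          obtain i where i: "cmod w / R < cmod c ^ i" using real_arch_pow[OF c] by blast
          define l where "l = (LEAST l. cmod w < R * cmod c ^ l)"
          have ex: "cmod w < R * cmod c ^ i" using i Rpos by (simp add: pos_divide_less_eq mult.commute)
          then have l: "cmod w < R * cmod c ^ l" unfolding l_def by (rule LeastI)
          have "n0 < l"
          proof (rule ccontr)
            assume "\<not> n0 < l"
            then have "cmod c ^ l \<le> cmod c ^ n0" using c by (intro power_increasing) auto
            then have "R * cmod c ^ l \<le> R * cmod c ^ n0" using Rpos by simp
            then show False using l False by simp
          qed
          then obtain n where n: "l = Suc n" "n \<ge> n0" by (cases l) auto
          have "\<not> cmod w < R * cmod c ^ n" 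
            by (rule not_less_Least) (use n(1) in \<open>simp flip: l_def\<close>)
          moreover define v where "v = w / c ^ n"
          ultimately have v: "v \<in> Kc"
            using l n(1) c0 by (simp add: Kc_def norm_divide norm_power pos_divide_less_eq pos_divide_le_eq mult_ac)
          have wv: "w = c ^ n * v" using c0 by (simp add: v_def)
          have "v \<noteq> 0" using v KS by (auto simp: S_def)
          then have "G n v = 0" using FG[of v n] Fw wv by simp
          then obtain a where "a \<in> Z" "v \<in> X n a" using cover[OF n(2) v] by blast
          then obtain \<nu> where \<nu>: "\<nu> \<in> {1..T}" "v = \<xi> n \<nu>" using \<xi>surj[OF n(2)] by blast
          obtain i where "n = n0 + i" using n(2) le_Suc_ex by blast
          then have "w = z (i + s) \<nu>" using wv \<nu>(2) by (simp add: z_def)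
          then show ?thesis using \<nu>(1) by blast
        qed
      qed
    qed
    fix \<nu> assume \<nu>: "\<nu> \<in> {1..T}"
    show "A \<nu> \<noteq> 0" using W0[OF \<nu>] c0 by (simp add: A_def)
    have "(\<lambda>n. \<xi> n \<nu>) \<longlonglongrightarrow> W \<nu>"
    proof (rule LIMSEQ_I)
      fix d :: real assume d: "0 < d"
      have "\<forall>\<^sub>F n in sequentially. (\<forall>w\<in>Kc. cmod (G n w - \<Theta> w) < \<epsilon> (W \<nu>) * d ^ N (W \<nu>)) \<and> n \<ge> n0"
        using d \<epsilon>[OF WZ[OF \<nu>]] by (intro eventually_conj close eventually_ge_at_top) simp
      then obtain n1 where n1: "\<And>n. n \<ge> n1 \<Longrightarrow> (\<forall>w\<in>Kc. cmod (G n w - \<Theta> w) < \<epsilon> (W \<nu>) * d ^ N (W \<nu>)) \<and> n \<ge> n0"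
        unfolding eventually_sequentially by blast
      have "norm (\<xi> n \<nu> - W \<nu>) < d" if "n \<ge> n1" for n
      proof -
        have n: "n \<ge> n0" using n1[OF that] by blast
        have "\<epsilon> (W \<nu>) * cmod (\<xi> n \<nu> - W \<nu>) ^ N (W \<nu>) < \<epsilon> (W \<nu>) * d ^ N (W \<nu>)"
          using \<xi>_close[OF n \<nu>] n1[OF that] \<xi>K(1)[OF n \<nu>] by (meson le_less_trans)
        then have "cmod (\<xi> n \<nu> - W \<nu>) ^ N (W \<nu>) < d ^ N (W \<nu>)" using \<epsilon>[OF WZ[OF \<nu>]] by simp
        then show ?thesis using d by (meson less_imp_le power_less_imp_less_base)
      qed
      then show "\<exists>n1. \<forall>n\<ge>n1. norm (\<xi> n \<nu> - W \<nu>) < d" by blast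
    qed
    then have "(\<lambda>n. \<xi> (n + n0) \<nu>) \<longlonglongrightarrow> W \<nu>" by (rule LIMSEQ_ignore_initial_segment)
    then have "(\<lambda>n. \<xi> (n0 + n) \<nu> / W \<nu>) \<longlonglongrightarrow> W \<nu> / W \<nu>"
      using W0[OF \<nu>] by (intro tendsto_intros) (simp_all add: add.commute)
    then have "(\<lambda>n. z (n + s) \<nu> / (A \<nu> * c ^ (n + s))) \<longlonglongrightarrow> 1"
      using W0[OF \<nu>] by (simp add: ratio[OF \<nu>])
    then show "(\<lambda>n. z n \<nu> / (A \<nu> * c ^ n)) \<longlonglongrightarrow> 1" by (rule LIMSEQ_offset)
  next
    fix \<theta> :: real and \<nu>
    assume \<theta>: "0 < \<theta>" "\<theta> < 1" and \<nu>: "\<nu> \<in> {1..T}"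
      and rate: "\<And>Y. 1 \<le> Y \<Longrightarrow> \<exists>B. \<forall>n w. 1 / Y \<le> cmod w \<longrightarrow> cmod w \<le> Y \<longrightarrow> cmod (G n w - \<Theta> w) \<le> B * (\<theta> ^ T) ^ n"
    obtain B where B: "\<And>n w. 1 / Y \<le> cmod w \<Longrightarrow> cmod w \<le> Y \<Longrightarrow> cmod (G n w - \<Theta> w) \<le> B * (\<theta> ^ T) ^ n"
      using rate[OF Y] by blast
    define a where "a = W \<nu>"
    have a: "a \<in> Z" "0 < \<epsilon> a" "0 < N a" "N a \<le> T" using WZ[OF \<nu>] \<epsilon> Npos NT by (auto simp: a_def)
    \<comment> \<open>at least 1, so that \<open>D\<close> is bounded by its own powers when the root is taken\<close>
    define D where "D = max 1 (B / \<epsilon> a)"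
    have D: "1 \<le> D" "B \<le> \<epsilon> a * D"
    proof -
      have "B / \<epsilon> a \<le> D" by (simp add: D_def)
      then show "B \<le> \<epsilon> a * D" using a(2) by (simp add: pos_divide_le_eq mult.commute)
    qed (simp add: D_def)
    have bound: "cmod (\<xi> n \<nu> - a) \<le> D * \<theta> ^ n" if n: "n \<ge> n0" for n
    proof -
      have "\<epsilon> a * cmod (\<xi> n \<nu> - a) ^ N a \<le> B * (\<theta> ^ T) ^ n"
        using \<xi>_close[OF n \<nu>] B[of "\<xi> n \<nu>" n] \<xi>K(1)[OF n \<nu>] KY unfolding a_def by fastforce
      also have "\<dots> \<le> \<epsilon> a * D * (\<theta> ^ T) ^ n" using D \<theta> by (intro mult_right_mono) auto
      finally have "cmod (\<xi> n \<nu> - a) ^ N a \<le> D * (\<theta> ^ n) ^ T"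
        using a(2) by (simp add: mult.assoc power_mult[symmetric] mult.commute[of n])
      also have "\<dots> \<le> D ^ N a * (\<theta> ^ n) ^ N a"
      proof (intro mult_mono)
        show "D \<le> D ^ N a" using D a(3) by (simp add: self_le_power)
        show "(\<theta> ^ n) ^ T \<le> (\<theta> ^ n) ^ N a" using \<theta> a(4) by (intro power_decreasing) (auto intro: power_le_one)
      qed (use D \<theta> in auto)
      also have "\<dots> = (D * \<theta> ^ n) ^ N a" by (simp add: power_mult_distrib)
      finally have le: "cmod (\<xi> n \<nu> - a) ^ N a \<le> (D * \<theta> ^ n) ^ N a" .
      have "0 \<le> D * \<theta> ^ n" using D \<theta> by simp
      then show ?thesis using le a(3) by (simp add: power_mono_iff)
    qed
    show "(\<lambda>n. z n \<nu> / (A \<nu> * c ^ n) - 1) \<in> O(\<lambda>n. complex_of_real (\<theta> ^ n))"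
    proof (rule bigoI)
      show "\<forall>\<^sub>F n in sequentially. norm (z n \<nu> / (A \<nu> * c ^ n) - 1) \<le>
          (D * \<theta> ^ n0 / \<theta> ^ s / cmod a) * norm (complex_of_real (\<theta> ^ n))"
        using eventually_ge_at_top[of s]
      proof eventually_elim
        case (elim n)
        then obtain i where i: "n = i + s" by (metis add.commute le_Suc_ex)
        have "z n \<nu> / (A \<nu> * c ^ n) - 1 = (\<xi> (n0 + i) \<nu> - a) / a"
          unfolding i ratio[OF \<nu>] using W0[OF \<nu>] by (simp add: a_def diff_divide_distrib)
        then have "norm (z n \<nu> / (A \<nu> * c ^ n) - 1) = cmod (\<xi> (n0 + i) \<nu> - a) / cmod a"
          by (simp add: norm_divide)
        also have "\<dots> \<le> D * \<theta> ^ (n0 + i) / cmod a" by (intro divide_right_mono bound) auto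
        also have "\<dots> = (D * \<theta> ^ n0 / \<theta> ^ s / cmod a) * norm (complex_of_real (\<theta> ^ n))"
          using \<theta> by (simp add: i power_add norm_power norm_mult)
        finally show ?case .
      qed
    qed
  qed
qed

section \<open>Limits of the recentred coefficients\<close>

text \<open>
  The Vandermonde argument: if all power sums vanished, then so would the weighted sum of the
  values of every polynomial, in particular of one that is zero at all points of \<open>X\<close> but one.
\<close>

lemma power_sums_not_all_zero:
  fixes X :: "complex set"
  assumes X: "finite X" and \<kappa>: "\<kappa> \<in> X" "c \<kappa> \<noteq> 0"
  shows "\<exists>h::nat. (\<Sum>\<kappa>\<in>X. c \<kappa> * \<kappa> ^ h) \<noteq> 0"
proof (rule ccontr)
  assume "\<not> ?thesis"
  then have zero: "(\<Sum>\<kappa>\<in>X. c \<kappa> * \<kappa> ^ h) = 0" for h :: nat by blast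
  have poly_zero: "(\<Sum>\<kappa>\<in>X. c \<kappa> * poly R \<kappa>) = 0" for R
  proof -
    have "(\<Sum>\<kappa>\<in>X. c \<kappa> * poly R \<kappa>) = (\<Sum>\<kappa>\<in>X. \<Sum>i\<le>degree R. coeff R i * (c \<kappa> * \<kappa> ^ i))"
      by (simp add: poly_altdef sum_distrib_left mult_ac)
    also have "\<dots> = (\<Sum>i\<le>degree R. coeff R i * (\<Sum>\<kappa>\<in>X. c \<kappa> * \<kappa> ^ i))"
      by (subst sum.swap) (simp add: sum_distrib_left)
    finally show ?thesis by (simp add: zero)
  qed
  define R where "R = (\<Prod>\<kappa>'\<in>X - {\<kappa>}. [:- \<kappa>', 1:])"
  have "(\<Sum>\<kappa>'\<in>X. c \<kappa>' * poly R \<kappa>') = c \<kappa> * poly R \<kappa> + (\<Sum>\<kappa>'\<in>X - {\<kappa>}. c \<kappa>' * poly R \<kappa>')"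
    using X \<kappa>(1) by (rule sum.remove)
  also have "(\<Sum>\<kappa>'\<in>X - {\<kappa>}. c \<kappa>' * poly R \<kappa>') = 0"
    by (intro sum.neutral) (use X in \<open>auto simp: R_def poly_prod\<close>)
  finally have "c \<kappa> * poly R \<kappa> = 0" using poly_zero by simp
  moreover have "poly R \<kappa> \<noteq> 0" using X by (auto simp: R_def poly_prod)
  ultimately show False using \<kappa>(2) by simp
qed

lemma poly_over_leading_power_tendsto:
  fixes Q :: "complex poly"
  assumes T: "0 < T" and D: "degree Q \<le> D"
  shows "(\<lambda>n. poly Q (of_int (int (n * T) + h)) / (of_nat (n * T) + 1) ^ D) \<longlonglongrightarrow> coeff Q D"
proof -
  define y where "y = (\<lambda>n. 1 / (of_nat (n * T) + 1) :: complex)"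
  have "strict_mono (\<lambda>n. n * T)" using T by (auto intro: strict_monoI)
  from LIMSEQ_subseq_LIMSEQ[OF LIMSEQ_inverse_real_of_nat this]
  have "(\<lambda>n. complex_of_real (inverse (real (Suc (n * T))))) \<longlonglongrightarrow> of_real 0"
    by (intro tendsto_of_real) (simp add: o_def)
  then have y: "y \<longlonglongrightarrow> 0" by (simp add: y_def divide_inverse add.commute)
  have nz: "complex_of_nat (n * T) + 1 \<noteq> 0" for n
    by (metis of_nat_Suc of_nat_eq_0_iff add.commute nat.distinct(1))
  have xy: "of_int (int (n * T) + h) * y n = 1 + (of_int h - 1) * y n" for n
    using nz[of n] by (simp add: y_def field_simps)
  have e: "poly Q (of_int (int (n * T) + h)) / (of_nat (n * T) + 1) ^ D =
      (\<Sum>i\<le>D. coeff Q i * (1 + (of_int h - 1) * y n) ^ i * y n ^ (D - i))" for n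
  proof -
    have "poly Q (of_int (int (n * T) + h)) = (\<Sum>i\<le>D. coeff Q i * of_int (int (n * T) + h) ^ i)"
      unfolding poly_altdef by (rule sum.mono_neutral_left) (use D in \<open>auto simp: coeff_eq_0\<close>)
    then have "poly Q (of_int (int (n * T) + h)) / (of_nat (n * T) + 1) ^ D =
        (\<Sum>i\<le>D. coeff Q i * of_int (int (n * T) + h) ^ i) * y n ^ D"
      by (simp add: y_def power_divide)
    also have "\<dots> = (\<Sum>i\<le>D. coeff Q i * (of_int (int (n * T) + h) * y n) ^ i * y n ^ (D - i))"
      unfolding sum_distrib_right
    proof (intro sum.cong refl)
      fix i assume "i \<in> {..D}"
      then have "y n ^ D = y n ^ i * y n ^ (D - i)" by (simp flip: power_add)
      then show "coeff Q i * of_int (int (n * T) + h) ^ i * y n ^ D =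
          coeff Q i * (of_int (int (n * T) + h) * y n) ^ i * y n ^ (D - i)"
        by (simp add: power_mult_distrib mult_ac)
    qed
    finally show ?thesis unfolding xy .
  qed
  have "(\<lambda>n. \<Sum>i\<le>D. coeff Q i * (1 + (of_int h - 1) * y n) ^ i * y n ^ (D - i)) \<longlonglongrightarrow>
      (\<Sum>i\<le>D. coeff Q i * (1 + (of_int h - 1) * 0) ^ i * 0 ^ (D - i))"
    by (intro tendsto_intros y)
  also have "(\<Sum>i\<le>D. coeff Q i * (1 + (of_int h - 1) * 0) ^ i * 0 ^ (D - i)) = (\<Sum>i\<le>D. if i = D then coeff Q D else 0)"
    by (intro sum.cong refl) (auto simp: power_0_left)
  also have "\<dots> = coeff Q D" by simp
  finally show ?thesis unfolding e .
qed

lemma norm_poly_le: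
  fixes Q :: "complex poly"
  assumes "degree Q \<le> D"
  shows "cmod (poly Q (of_nat j)) \<le> (\<Sum>i\<le>D. cmod (coeff Q i)) * (1 + real j) ^ D"
proof -
  have "poly Q (of_nat j) = (\<Sum>i\<le>D. coeff Q i * of_nat j ^ i)"
    unfolding poly_altdef by (rule sum.mono_neutral_left) (use assms in \<open>auto simp: coeff_eq_0\<close>)
  also have "cmod \<dots> \<le> (\<Sum>i\<le>D. cmod (coeff Q i) * (1 + real j) ^ D)"
  proof (rule sum_norm_le)
    fix i assume "i \<in> {..D}"
    then have "real j ^ i \<le> (1 + real j) ^ D"
      by (meson atMost_iff less_add_same_cancel2 less_imp_le of_nat_0_le_iff order_trans power_increasing
          power_mono le_add_same_cancel1 le_add_same_cancel2 zero_less_one)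
    then show "cmod (coeff Q i * of_nat j ^ i) \<le> cmod (coeff Q i) * (1 + real j) ^ D"
      by (simp add: norm_mult norm_power mult_left_mono)
  qed
  finally show ?thesis by (simp add: sum_distrib_right)
qed

lemma powi_shift_ratio:
  fixes \<kappa> \<Lambda> :: "'a :: field"
  assumes "\<kappa> \<noteq> 0" "\<kappa> ^ T = \<Lambda>" "int j = int (n * T) + h"
  shows "\<kappa> ^ j / \<Lambda> ^ n = \<kappa> powi h"
proof -
  have "\<kappa> ^ j = \<kappa> powi (int (n * T) + h)" by (simp only: power_int_of_nat flip: assms(3))
  also have "\<dots> = \<kappa> ^ (n * T) * \<kappa> powi h" using assms(1) by (simp only: power_int_add power_int_of_nat simp_thms)
  also have "\<kappa> ^ (n * T) = \<Lambda> ^ n" by (simp add: mult.commute[of n] power_mult flip: assms(2))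
  finally show ?thesis using assms(1,2) by auto
qed

lemma powi_le_power_abs:
  fixes \<mu> :: real
  assumes "0 < \<mu>"
  shows "\<mu> powi h \<le> max \<mu> (1 / \<mu>) ^ nat \<bar>h\<bar>"
proof (cases "0 \<le> h")
  case True
  then show ?thesis using assms by (simp add: power_int_def power_mono)
next
  case False
  then show ?thesis using assms by (simp add: power_int_def power_mono inverse_eq_divide)
qed

text \<open>
  The sequence \<open>\<beta>\<close> recentred at \<open>nT\<close> and divided by \<open>(nT + 1)\<^sup>D \<Lambda>\<^sup>n\<close>. Here \<open>nT + 1\<close> instead of \<open>nT\<close>
  avoids a zero denominator for \<open>n = 0\<close> and gives \<open>1 + nT + h \<le> (nT + 1)(1 + \<bar>h\<bar>)\<close> without
  exceptions. Dividing \<open>\<kappa>^(nT + h)\<close> by \<open>\<Lambda>\<^sup>n\<close> leaves \<open>\<kappa>\<^sup>h\<close>, so only the leading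
  coefficients of the \<open>Q\<^sub>\<kappa>\<close> survive in the limit.
\<close>

context
  fixes X :: "complex set" and Q :: "complex \<Rightarrow> complex poly" and \<beta> :: "nat \<Rightarrow> complex"
    and \<mu> \<delta> :: real and \<Lambda> :: complex and T D :: nat and p :: "int \<Rightarrow> complex" and v :: "nat \<Rightarrow> int \<Rightarrow> complex"
  assumes X: "finite X" "\<And>\<kappa>. \<kappa> \<in> X \<Longrightarrow> cmod \<kappa> = \<mu>" "\<And>\<kappa>. \<kappa> \<in> X \<Longrightarrow> \<kappa> ^ T = \<Lambda>" "X \<noteq> {}"
    and \<mu>: "0 < \<delta>" "\<delta> < \<mu>" and T: "0 < T"
    and Q: "\<And>\<kappa>. \<kappa> \<in> X \<Longrightarrow> degree (Q \<kappa>) \<le> D"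
    and err: "geometrically_bounded \<delta> (\<lambda>n. \<beta> n - (\<Sum>\<kappa>\<in>X. poly (Q \<kappa>) (of_nat n) * \<kappa> ^ n))"
    and p: "\<And>h. p h = (\<Sum>\<kappa>\<in>X. coeff (Q \<kappa>) D * \<kappa> powi h)"
    and v: "\<And>n h. v n h = (if 0 \<le> int (n * T) + h
        then \<beta> (nat (int (n * T) + h)) / ((of_nat (n * T) + 1) ^ D * \<Lambda> ^ n) else 0)"
begin

lemma norm_\<Lambda>: "cmod \<Lambda> = \<mu> ^ T" and \<Lambda>_nonzero: "\<Lambda> \<noteq> 0"
proof -
  obtain \<kappa> where "\<kappa> \<in> X" using X(4) by blast
  then show "cmod \<Lambda> = \<mu> ^ T" using X(2,3) norm_power by metis
  then show "\<Lambda> \<noteq> 0" using \<mu> by auto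
qed

lemma norm_p_le: "cmod (p h) \<le> (\<Sum>\<kappa>\<in>X. cmod (coeff (Q \<kappa>) D)) * \<mu> powi h"
  unfolding p sum_distrib_right by (rule sum_norm_le) (simp add: norm_mult norm_power_int X(2))

lemma norm_shift_ratio: "int j = int (n * T) + h \<Longrightarrow> \<delta> ^ j / cmod \<Lambda> ^ n = ((\<delta> / \<mu>) ^ T) ^ n * \<delta> powi h"
proof -
  assume j: "int j = int (n * T) + h"
  have "\<delta> ^ j / (\<delta> ^ T) ^ n = \<delta> powi h" by (rule powi_shift_ratio) (use \<mu> j in auto)
  then show ?thesis using \<mu> by (simp add: norm_\<Lambda> power_divide field_simps)
qed

lemma coefficient_tendsto: "(\<lambda>n. v n h) \<longlonglongrightarrow> p h"
proof -
  obtain C where C: "\<And>n. cmod (\<beta> n - (\<Sum>\<kappa>\<in>X. poly (Q \<kappa>) (of_nat n) * \<kappa> ^ n)) \<le> C * \<delta> ^ n"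
    using err by (auto simp: geometrically_bounded_def)
  have C0: "0 \<le> C" using order_trans[OF norm_ge_zero C[of 0]] by simp
  define m where "m = (\<lambda>n. \<Sum>\<kappa>\<in>X. poly (Q \<kappa>) (of_int (int (n * T) + h)) / (of_nat (n * T) + 1) ^ D * \<kappa> powi h)"
  have "m \<longlonglongrightarrow> p h"
    unfolding m_def p by (intro tendsto_intros poly_over_leading_power_tendsto T Q)
  moreover have "(\<lambda>n. v n h - m n) \<longlonglongrightarrow> 0"
  proof (rule Lim_null_comparison)
    have "(\<delta> / \<mu>) ^ T < 1" using \<mu> T by (intro power_Suc_less_one[of _ "T - 1", simplified Suc_diff_1[OF T]]) auto
    then have "(\<lambda>n. C * (((\<delta> / \<mu>) ^ T) ^ n * \<delta> powi h)) \<longlonglongrightarrow> C * (0 * \<delta> powi h)"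
      using \<mu> by (intro tendsto_intros LIMSEQ_power_zero) auto
    then show "(\<lambda>n. C * (((\<delta> / \<mu>) ^ T) ^ n * \<delta> powi h)) \<longlonglongrightarrow> 0" by simp
    show "\<forall>\<^sub>F n in sequentially. norm (v n h - m n) \<le> C * (((\<delta> / \<mu>) ^ T) ^ n * \<delta> powi h)"
      using eventually_ge_at_top[of "nat \<bar>h\<bar>"]
    proof eventually_elim
      case (elim n)
      define s where "s = (complex_of_nat (n * T) + 1) ^ D"
      have s: "1 \<le> cmod s"
      proof -
        have "complex_of_nat (n * T) + 1 = of_real (real (n * T) + 1)" by simp
        then have "cmod s = (real (n * T) + 1) ^ D" unfolding s_def norm_power by (simp only: norm_of_real)
        then show ?thesis by (simp add: one_le_power)
      qed
      define j where "j = nat (int (n * T) + h)"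
      have "n \<le> n * T" using T by simp
      then have nn: "0 \<le> int (n * T) + h" using elim by linarith
      then have j: "int j = int (n * T) + h" by (simp add: j_def)
      have jc: "complex_of_int (int (n * T) + h) = of_nat j" unfolding j[symmetric] by simp
      have vj: "v n h = \<beta> j / (s * \<Lambda> ^ n)" unfolding v j_def s_def using nn by (simp only: if_True simp_thms)
      have mj: "m n = (\<Sum>\<kappa>\<in>X. poly (Q \<kappa>) (of_nat j) * \<kappa> ^ j) / (s * \<Lambda> ^ n)"
        unfolding m_def jc sum_divide_distrib
      proof (intro sum.cong refl)
        fix \<kappa> assume \<kappa>: "\<kappa> \<in> X"
        then have "\<kappa> \<noteq> 0" using X(2) \<mu> by force
        note ratio = powi_shift_ratio[OF this X(3)[OF \<kappa>] j]
        show "poly (Q \<kappa>) (of_nat j) / (of_nat (n * T) + 1) ^ D * \<kappa> powi h = poly (Q \<kappa>) (of_nat j) * \<kappa> ^ j / (s * \<Lambda> ^ n)"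
          unfolding ratio[symmetric] s_def by simp
      qed
      have "norm (v n h - m n) = cmod (\<beta> j - (\<Sum>\<kappa>\<in>X. poly (Q \<kappa>) (of_nat j) * \<kappa> ^ j)) / (cmod s * cmod \<Lambda> ^ n)"
        unfolding vj mj by (simp add: norm_divide norm_mult norm_power flip: diff_divide_distrib)
      also have "\<dots> \<le> (C * \<delta> ^ j) / (1 * cmod \<Lambda> ^ n)"
        using C s C0 \<mu> \<Lambda>_nonzero by (intro frac_le mult_right_mono) auto
      also have "\<dots> = C * (((\<delta> / \<mu>) ^ T) ^ n * \<delta> powi h)"
        unfolding norm_shift_ratio[OF j, symmetric] by simp
      finally show ?case .
    qed
  qed
  ultimately have "(\<lambda>n. m n + (v n h - m n)) \<longlonglongrightarrow> p h + 0" by (rule tendsto_add)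
  then show ?thesis by simp
qed

text \<open>
  The polynomial growth of \<open>\<beta>\<^sub>n / \<mu>\<^sup>n\<close> costs at most \<open>(1 + \<bar>h\<bar>)\<^sup>D\<close> after recentring, which is bounded
  by the \<open>\<bar>h\<bar>\<close>-th power of \<open>2\<^sup>D\<close>.
\<close>

lemma coefficients_bounded: "\<exists>C B. 0 \<le> B \<and> coeff_bounded C B p \<and> (\<forall>n. coeff_bounded C B (v n))"
proof -
  obtain C where C: "\<And>n. cmod (\<beta> n - (\<Sum>\<kappa>\<in>X. poly (Q \<kappa>) (of_nat n) * \<kappa> ^ n)) \<le> C * \<delta> ^ n"
    using err by (auto simp: geometrically_bounded_def)
  have C0: "0 \<le> C" using order_trans[OF norm_ge_zero C[of 0]] by simp
  define q where "q = (\<Sum>\<kappa>\<in>X. \<Sum>i\<le>D. cmod (coeff (Q \<kappa>) i))"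
  define C1 where "C1 = q + C"
  have q0: "0 \<le> q" unfolding q_def by (intro sum_nonneg) auto
  have C1: "0 \<le> C1" using q0 C0 by (simp add: C1_def)
  have \<beta>: "cmod (\<beta> j) \<le> C1 * (1 + real j) ^ D * \<mu> ^ j" for j
  proof -
    define u where "u = (\<Sum>\<kappa>\<in>X. poly (Q \<kappa>) (of_nat j) * \<kappa> ^ j)"
    have "cmod u \<le> (\<Sum>\<kappa>\<in>X. (\<Sum>i\<le>D. cmod (coeff (Q \<kappa>) i)) * (1 + real j) ^ D * \<mu> ^ j)"
      unfolding u_def
    proof (rule sum_norm_le)
      fix \<kappa> assume \<kappa>: "\<kappa> \<in> X"
      show "cmod (poly (Q \<kappa>) (of_nat j) * \<kappa> ^ j) \<le> (\<Sum>i\<le>D. cmod (coeff (Q \<kappa>) i)) * (1 + real j) ^ D * \<mu> ^ j"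
        using norm_poly_le[OF Q[OF \<kappa>], of j] \<mu> by (simp add: norm_mult norm_power X(2)[OF \<kappa>] mult_right_mono)
    qed
    also have "\<dots> = q * (1 + real j) ^ D * \<mu> ^ j" by (simp add: q_def sum_distrib_right)
    finally have 1: "cmod u \<le> q * (1 + real j) ^ D * \<mu> ^ j" .
    have "\<delta> ^ j \<le> \<mu> ^ j" using \<mu> by (intro power_mono) auto
    also have "\<dots> \<le> (1 + real j) ^ D * \<mu> ^ j"
      using \<mu> one_le_power[of "1 + real j" D] by (intro mult_le_cancel_right1[THEN iffD2]) auto
    finally have 2: "C * \<delta> ^ j \<le> C * ((1 + real j) ^ D * \<mu> ^ j)" using C0 by (rule mult_left_mono)
    have "cmod (\<beta> j) \<le> cmod u + cmod (\<beta> j - u)" by (metis add.commute diff_add_cancel norm_triangle_ineq)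
    also have "\<dots> \<le> q * (1 + real j) ^ D * \<mu> ^ j + C * ((1 + real j) ^ D * \<mu> ^ j)"
      using 1 2 C[of j] unfolding u_def by linarith
    finally show ?thesis by (simp add: C1_def algebra_simps)
  qed
  define Y where "Y = max \<mu> (1 / \<mu>)"
  define B where "B = 2 ^ D * Y"
  have Y: "0 < Y" using \<mu> by (simp add: Y_def less_max_iff_disj)
  have YB: "Y ^ i \<le> B ^ i" for i using Y by (intro power_mono) (auto simp: B_def one_le_power)
  have "coeff_bounded C1 B p"
    unfolding coeff_bounded_def
  proof
    fix h
    have "(\<Sum>\<kappa>\<in>X. cmod (coeff (Q \<kappa>) D)) \<le> q"
      unfolding q_def by (intro sum_mono member_le_sum) auto
    also have "\<dots> \<le> C1" using C0 by (simp add: C1_def)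
    finally have "(\<Sum>\<kappa>\<in>X. cmod (coeff (Q \<kappa>) D)) * \<mu> powi h \<le> C1 * B ^ nat \<bar>h\<bar>"
      using powi_le_power_abs[of \<mu> h] YB[of "nat \<bar>h\<bar>"] \<mu> C1 unfolding Y_def
      by (intro mult_mono) auto
    then show "cmod (p h) \<le> C1 * B ^ nat \<bar>h\<bar>" using norm_p_le[of h] by linarith
  qed
  moreover have "coeff_bounded C1 B (v n)" for n
    unfolding coeff_bounded_def
  proof
    fix h
    show "cmod (v n h) \<le> C1 * B ^ nat \<bar>h\<bar>"
    proof (cases "0 \<le> int (n * T) + h")
      case False
      then show ?thesis unfolding v using C1 Y by (simp add: B_def)
    next
      case True
      define j where "j = nat (int (n * T) + h)"
      have j: "int j = int (n * T) + h" using True by (simp add: j_def)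
      define s where "s = 1 + real (n * T)"
      have s: "1 \<le> s" by (simp add: s_def)
      have "complex_of_nat (n * T) + 1 = of_real s" by (simp add: s_def)
      then have ns: "cmod ((complex_of_nat (n * T) + 1) ^ D) = s ^ D"
        using s by (simp only: norm_power norm_of_real)
      have "cmod (v n h) = cmod (\<beta> j) / (s ^ D * cmod \<Lambda> ^ n)"
        unfolding v j_def using True by (simp only: if_True norm_divide norm_mult ns) (simp add: norm_power)
      also have "\<dots> \<le> C1 * (1 + real j) ^ D * \<mu> ^ j / (s ^ D * cmod \<Lambda> ^ n)"
        using \<beta> s by (intro divide_right_mono) auto
      also have "\<dots> = C1 * ((1 + real j) / s) ^ D * (\<mu> ^ j / cmod \<Lambda> ^ n)"
        by (simp add: power_divide)
      also have "\<mu> ^ j / cmod \<Lambda> ^ n = \<mu> powi h"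
        by (rule powi_shift_ratio) (use \<mu> norm_\<Lambda> j in auto)
      also have "C1 * ((1 + real j) / s) ^ D * \<mu> powi h \<le> C1 * (2 ^ D) ^ nat \<bar>h\<bar> * Y ^ nat \<bar>h\<bar>"
      proof (intro mult_mono mult_left_mono)
        have "real j = real_of_int (int (n * T) + h)" unfolding j[symmetric] by simp
        then have "1 + real j \<le> s + real (nat \<bar>h\<bar>)" by (simp add: s_def)
        also have "\<dots> \<le> s * (1 + real (nat \<bar>h\<bar>))" using s by (simp add: algebra_simps mult_le_cancel_right1)
        also have "1 + real (nat \<bar>h\<bar>) \<le> 2 ^ nat \<bar>h\<bar>"
        proof -
          have "Suc (nat \<bar>h\<bar>) \<le> 2 ^ nat \<bar>h\<bar>" by (rule Suc_leI) (rule less_exp)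
          then have "real (Suc (nat \<bar>h\<bar>)) \<le> real (2 ^ nat \<bar>h\<bar>)" by (rule of_nat_mono)
          then show ?thesis by simp
        qed
        finally have "(1 + real j) / s \<le> 2 ^ nat \<bar>h\<bar>" using s by (simp add: pos_divide_le_eq mult.commute)
        then have "((1 + real j) / s) ^ D \<le> (2 ^ nat \<bar>h\<bar>) ^ D" using s by (intro power_mono) auto
        also have "\<dots> = (2 ^ D) ^ nat \<bar>h\<bar>" by (simp add: mult.commute flip: power_mult)
        finally show "((1 + real j) / s) ^ D \<le> (2 ^ D) ^ nat \<bar>h\<bar>" .
        show "\<mu> powi h \<le> Y ^ nat \<bar>h\<bar>" unfolding Y_def by (rule powi_le_power_abs) (use \<mu> in simp)
      qed (use C1 \<mu> s in auto)
      also have "\<dots> = C1 * B ^ nat \<bar>h\<bar>" by (simp add: B_def power_mult_distrib)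
      finally show ?thesis .
    qed
  qed
  moreover have "0 \<le> B" using Y by (simp add: B_def)
  ultimately show ?thesis by blast
qed

text \<open>
  For \<open>D = 0\<close> the limit is exact up to the error term of \<open>\<beta>\<close>, whose index \<open>nT + h\<close> accounts for the
  \<open>T\<close>-th power. Where \<open>nT + h < 0\<close> the difference is \<open>- p\<^sub>h\<close>, and the bound holds because
  \<open>\<delta>/\<mu>\<close> then occurs with a negative exponent.
\<close>

lemma coefficient_rate:
  assumes "D = 0"
  shows "\<exists>K. \<forall>n h. cmod (v n h - p h) \<le> K * ((\<delta> / \<mu>) ^ T) ^ n * \<delta> powi h"
proof -
  obtain C where C: "\<And>n. cmod (\<beta> n - (\<Sum>\<kappa>\<in>X. poly (Q \<kappa>) (of_nat n) * \<kappa> ^ n)) \<le> C * \<delta> ^ n"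
    using err by (auto simp: geometrically_bounded_def)
  define C2 where "C2 = (\<Sum>\<kappa>\<in>X. cmod (coeff (Q \<kappa>) D))"
  define K where "K = max C C2"
  have C20: "0 \<le> C2" by (simp add: C2_def sum_nonneg)
  have Qc: "poly (Q \<kappa>) x = coeff (Q \<kappa>) D" if \<kappa>: "\<kappa> \<in> X" for \<kappa> x
  proof -
    obtain c where "Q \<kappa> = [:c:]" using Q[OF \<kappa>] assms by (auto elim: degree_eq_zeroE)
    then show ?thesis using assms by simp
  qed
  have "cmod (v n h - p h) \<le> K * ((\<delta> / \<mu>) ^ T) ^ n * \<delta> powi h" for n h
  proof (cases "0 \<le> int (n * T) + h")
    case True
    define j where "j = nat (int (n * T) + h)"
    have j: "int j = int (n * T) + h" using True by (simp add: j_def)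
    have vj: "v n h = \<beta> j / \<Lambda> ^ n"
      unfolding v j_def using True assms by (simp only: if_True power_0 mult_1)
    have pj: "p h = (\<Sum>\<kappa>\<in>X. poly (Q \<kappa>) (of_nat j) * \<kappa> ^ j) / \<Lambda> ^ n"
      unfolding p sum_divide_distrib
    proof (intro sum.cong refl)
      fix \<kappa> assume \<kappa>: "\<kappa> \<in> X"
      then have "\<kappa> \<noteq> 0" using X(2) \<mu> by force
      from powi_shift_ratio[OF this X(3)[OF \<kappa>] j]
      show "coeff (Q \<kappa>) D * \<kappa> powi h = poly (Q \<kappa>) (of_nat j) * \<kappa> ^ j / \<Lambda> ^ n"
        using Qc[OF \<kappa>] by (simp flip: times_divide_eq_right)
    qed
    have "cmod (v n h - p h) = cmod (\<beta> j - (\<Sum>\<kappa>\<in>X. poly (Q \<kappa>) (of_nat j) * \<kappa> ^ j)) / cmod \<Lambda> ^ n"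
      unfolding vj pj by (simp add: norm_divide norm_power flip: diff_divide_distrib)
    also have "\<dots> \<le> (C * \<delta> ^ j) / cmod \<Lambda> ^ n" by (intro divide_right_mono C) simp
    also have "\<dots> = C * (((\<delta> / \<mu>) ^ T) ^ n * \<delta> powi h)" unfolding norm_shift_ratio[OF j, symmetric] by simp
    also have "\<dots> \<le> K * (((\<delta> / \<mu>) ^ T) ^ n * \<delta> powi h)" using \<mu> by (intro mult_right_mono) (auto simp: K_def)
    finally show ?thesis by (simp add: mult_ac)
  next
    case False
    define i where "i = nat (- (int (n * T) + h))"
    have i: "int (n * T) + int i = - h" using False by (simp add: i_def)
    have "\<mu> powi h = inverse (\<mu> ^ (n * T + i))"
    proof -
      have h: "h = - int (n * T + i)" using i by simp
      show ?thesis unfolding h by (simp only: power_int_minus power_int_of_nat)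
    qed
    also have "\<dots> \<le> ((\<delta> / \<mu>) ^ T) ^ n * inverse (\<delta> ^ (n * T + i))"
    proof -
      have "\<delta> ^ i \<le> \<mu> ^ i" using \<mu> by (intro power_mono) auto
      moreover have "((\<delta> / \<mu>) ^ T) ^ n * inverse (\<delta> ^ (n * T + i)) = inverse (\<mu> ^ (n * T)) * inverse (\<delta> ^ i)"
        using \<mu> by (simp add: power_mult_distrib power_add divide_inverse power_inverse mult.commute[of T] flip: power_mult)
      moreover have "inverse (\<mu> ^ (n * T + i)) = inverse (\<mu> ^ (n * T)) * inverse (\<mu> ^ i)" by (simp add: power_add)
      ultimately show ?thesis using \<mu> by (auto intro!: mult_left_mono le_imp_inverse_le)
    qed
    also have "inverse (\<delta> ^ (n * T + i)) = \<delta> powi h"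
    proof -
      have h: "h = - int (n * T + i)" using i by simp
      show ?thesis unfolding h by (simp only: power_int_minus power_int_of_nat)
    qed
    finally have le: "\<mu> powi h \<le> ((\<delta> / \<mu>) ^ T) ^ n * \<delta> powi h" .
    have "cmod (v n h - p h) = cmod (p h)" unfolding v using False by simp
    also have "\<dots> \<le> C2 * \<mu> powi h" unfolding C2_def by (rule norm_p_le)
    also have "\<dots> \<le> C2 * (((\<delta> / \<mu>) ^ T) ^ n * \<delta> powi h)" using le C20 by (rule mult_left_mono)
    also have "\<dots> \<le> K * (((\<delta> / \<mu>) ^ T) ^ n * \<delta> powi h)" using \<mu> by (intro mult_right_mono) (auto simp: K_def)
    finally show ?thesis by (simp add: mult_ac)
  qed
  then show ?thesis by blast
qed

end

section \<open>Zeros of solutions of linear q-difference equations\<close>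

text \<open>
  The rescaling limit of \<open>f\<close> is the theta series whose coefficients are the power sums of the
  \<open>\<kappa>\<close>, weighted by the coefficients of the largest degree \<open>D\<close> that occurs among the \<open>Q\<^sub>\<kappa>\<close>.
\<close>

lemma zeros_of_gaussian_series:
  fixes f :: "complex \<Rightarrow> complex" and \<tau> \<Lambda> :: complex and X :: "complex set"
    and Q :: "complex \<Rightarrow> complex poly" and \<mu> \<delta>\<^sub>0 :: real and T :: nat
  assumes f: "f holomorphic_on UNIV" "\<exists>z. f z \<noteq> 0" "\<And>z. (\<lambda>n. \<alpha> n * z ^ n) sums f z"
    and \<tau>: "0 < cmod \<tau>" "cmod \<tau> < 1" and \<alpha>: "\<And>j. \<alpha> j = \<beta> j * \<tau> ^ j\<^sup>2"
    and X: "finite X" "\<And>\<kappa>. \<kappa> \<in> X \<Longrightarrow> cmod \<kappa> = \<mu>" "\<And>\<kappa>. \<kappa> \<in> X \<Longrightarrow> \<kappa> ^ T = \<Lambda>"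
    and T: "0 < T" and Q: "\<kappa>\<^sub>0 \<in> X" "Q \<kappa>\<^sub>0 \<noteq> 0"
    and \<delta>\<^sub>0: "0 < \<delta>\<^sub>0" "\<delta>\<^sub>0 < \<mu>"
    and err: "geometrically_bounded \<delta>\<^sub>0 (\<lambda>n. \<beta> n - (\<Sum>\<kappa>\<in>X. poly (Q \<kappa>) (of_nat n) * \<kappa> ^ n))"
  obtains z :: "nat \<Rightarrow> nat \<Rightarrow> complex" and A :: "nat \<Rightarrow> complex"
  where "{w. f w = 0} = {z n \<nu> | n \<nu>. \<nu> \<in> {1..T}}"
    and "\<And>\<nu>. \<nu> \<in> {1..T} \<Longrightarrow> A \<nu> \<noteq> 0"
    and "\<And>\<nu>. \<nu> \<in> {1..T} \<Longrightarrow> (\<lambda>n. z n \<nu> / (A \<nu> * (\<tau> powi (- 2 * int T)) ^ n)) \<longlonglongrightarrow> 1"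
    and "\<And>\<delta> \<nu>. \<lbrakk>0 < \<delta>; \<delta> < \<mu>; \<nu> \<in> {1..T}; \<And>\<kappa>. \<kappa> \<in> X \<Longrightarrow> degree (Q \<kappa>) = 0;
        geometrically_bounded \<delta> (\<lambda>n. \<beta> n - (\<Sum>\<kappa>\<in>X. poly (Q \<kappa>) (of_nat n) * \<kappa> ^ n))\<rbrakk>
      \<Longrightarrow> (\<lambda>n. z n \<nu> / (A \<nu> * (\<tau> powi (- 2 * int T)) ^ n) - 1) \<in> O(\<lambda>n. complex_of_real ((\<delta> / \<mu>) ^ n))"
proof -
  define D where "D = Max ((\<lambda>\<kappa>. degree (Q \<kappa>)) ` {\<kappa>\<in>X. Q \<kappa> \<noteq> 0})"
  have finX': "finite ((\<lambda>\<kappa>. degree (Q \<kappa>)) ` {\<kappa>\<in>X. Q \<kappa> \<noteq> 0})" using X(1) by simp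
  have degD: "degree (Q \<kappa>) \<le> D" if "\<kappa> \<in> X" for \<kappa>
    using finX' that by (cases "Q \<kappa> = 0") (auto simp: D_def intro!: Max_ge)
  have "D \<in> (\<lambda>\<kappa>. degree (Q \<kappa>)) ` {\<kappa>\<in>X. Q \<kappa> \<noteq> 0}"
    unfolding D_def using Q by (intro Max_in finX') auto
  then obtain \<kappa>' where \<kappa>': "\<kappa>' \<in> X" "Q \<kappa>' \<noteq> 0" "degree (Q \<kappa>') = D" by auto
  have Xne: "X \<noteq> {}" using Q(1) by blast
  define s where "s = (\<lambda>n. (complex_of_nat (n * T) + 1) ^ D)"
  have s: "s n \<noteq> 0" for n
    unfolding s_def by (metis of_nat_Suc of_nat_eq_0_iff add.commute nat.distinct(1) power_not_zero)
  define p where "p = (\<lambda>h. \<Sum>\<kappa>\<in>X. coeff (Q \<kappa>) D * \<kappa> powi h)"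
  define v where "v = (\<lambda>n h. if 0 \<le> int (n * T) + h then \<beta> (nat (int (n * T) + h)) / (s n * \<Lambda> ^ n) else 0)"
  have p_eq: "p h = (\<Sum>\<kappa>\<in>X. coeff (Q \<kappa>) D * \<kappa> powi h)" for h by (simp add: p_def)
  have v_eq: "v n h = (if 0 \<le> int (n * T) + h
      then \<beta> (nat (int (n * T) + h)) / ((of_nat (n * T) + 1) ^ D * \<Lambda> ^ n) else 0)" for n h
    unfolding v_def s_def ..
  note setting = X(1-3) Xne \<delta>\<^sub>0 T degD err p_eq v_eq
  note lim = coefficient_tendsto[OF setting]
  have \<Lambda>0: "\<Lambda> \<noteq> 0" by (rule \<Lambda>_nonzero[OF setting])
  obtain C B where B: "0 \<le> B" and bp: "coeff_bounded C B p" and bv: "\<And>n. coeff_bounded C B (v n)"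
    using coefficients_bounded[OF setting] by blast
  have \<tau>0: "\<tau> \<noteq> 0" using \<tau> by auto
  define c where "c = \<tau> powi (- 2 * int T)"
  define G where "G = (\<lambda>n. theta_series \<tau> (v n))"
  define \<Theta> where "\<Theta> = theta_series \<tau> p"
  define K where "K = (\<lambda>n w. s n * \<Lambda> ^ n * \<tau> powi (- (int (n * T))\<^sup>2) * w ^ (n * T))"
  have unif: "uniform_limit {w. 1 / Y \<le> cmod w \<and> cmod w \<le> Y} G \<Theta> sequentially" if "1 \<le> Y" for Y
    unfolding G_def \<Theta>_def by (rule theta_series_uniform_limit[OF \<tau> B bp bv lim that])
  have fG: "f (c ^ n * w) = K n w * G n w" if "w \<noteq> 0" for n w
    unfolding c_def K_def G_def
    by (rule theta_rescaling[where \<alpha> = \<alpha> and \<beta> = \<beta>, OF \<tau>0 \<Lambda>0 s that f(3) \<alpha>]) (simp only: v_def)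
  have K0: "K n w \<noteq> 0" if "w \<noteq> 0" for n w
    using that \<tau>0 \<Lambda>0 s by (simp add: K_def)
  have holG: "G n holomorphic_on - {0}" for n
  proof -
    have "(\<lambda>w. f (c ^ n * w) / K n w) holomorphic_on - {0}"
    proof (rule holomorphic_on_divide)
      show "(\<lambda>w. f (c ^ n * w)) holomorphic_on - {0}"
        by (rule holomorphic_on_compose_gen[OF _ f(1), unfolded o_def]) (auto intro!: holomorphic_intros)
      show "K n holomorphic_on - {0}" unfolding K_def by (intro holomorphic_intros)
    qed (use K0 in auto)
    then show ?thesis by (rule holomorphic_transform) (use fG K0 in auto)
  qed
  have hol\<Theta>: "\<Theta> holomorphic_on - {0}"
  proof (rule holomorphic_uniform_sequence[where f = G])
    fix x :: complex assume x: "x \<in> - {0}"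
    \<comment> \<open>the disc of radius \<open>\<bar>x\<bar>/2\<close> around \<open>x\<close> lies in the annulus from \<open>1/Y\<close> to \<open>Y\<close>\<close>
    define Y where "Y = max (2 * cmod x) (2 / cmod x)"
    have xp: "0 < cmod x" using x by simp
    have Y: "2 * cmod x \<le> Y" "2 / cmod x \<le> Y" by (simp_all add: Y_def)
    then have Yx: "2 \<le> Y * cmod x" using xp by (simp add: pos_divide_le_eq)
    have Y1: "1 \<le> Y"
    proof (rule ccontr)
      assume "\<not> 1 \<le> Y"
      then have "Y * cmod x \<le> 1 * cmod x" using xp by (intro mult_right_mono) auto
      then show False using Yx Y(1) \<open>\<not> 1 \<le> Y\<close> by linarith
    qed
    have sub: "cball x (cmod x / 2) \<subseteq> {w. 1 / Y \<le> cmod w \<and> cmod w \<le> Y}"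
    proof
      fix w assume "w \<in> cball x (cmod x / 2)"
      then have d: "cmod (x - w) \<le> cmod x / 2" by (simp add: dist_norm)
      have "cmod w \<le> cmod x + cmod (x - w)" by (metis norm_minus_commute norm_triangle_sub)
      then have "cmod w \<le> Y" using d Y(1) xp by linarith
      moreover have "cmod x / 2 \<le> cmod w" using norm_triangle_sub[of x w] d by linarith
      moreover have "1 / Y \<le> cmod x / 2" using Yx Y1 by (simp add: pos_divide_le_eq mult.commute)
      ultimately show "w \<in> {w. 1 / Y \<le> cmod w \<and> cmod w \<le> Y}" by simp
    qed
    have "0 \<notin> cball x (cmod x / 2)" using xp by (simp add: dist_norm)
    then have "cball x (cmod x / 2) \<subseteq> - {0}" by auto
    moreover have "uniform_limit (cball x (cmod x / 2)) G \<Theta> sequentially"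
      by (rule uniform_limit_on_subset[OF unif[OF Y1] sub])
    ultimately show "\<exists>d>0. cball x d \<subseteq> - {0} \<and> uniform_limit (cball x d) G \<Theta> sequentially"
      using xp by (intro exI[of _ "cmod x / 2"]) simp
  qed (use holG in auto)
  obtain h :: nat where "(\<Sum>\<kappa>\<in>X. coeff (Q \<kappa>) D * \<kappa> ^ h) \<noteq> 0"
    using power_sums_not_all_zero[OF X(1) \<kappa>'(1), of "\<lambda>\<kappa>. coeff (Q \<kappa>) D"] \<kappa>'(2,3) by auto
  then have ph: "p (int h) \<noteq> 0" by (simp add: p_def)
  have "sphere 0 1 = {w :: complex. 1 / 1 \<le> cmod w \<and> cmod w \<le> 1}" by auto
  then have "uniform_limit (sphere 0 1) G \<Theta> sequentially" using unif[of 1] by simp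
  then have \<Theta>0: "\<exists>w. w \<noteq> 0 \<and> \<Theta> w \<noteq> 0"
    unfolding G_def \<Theta>_def
    by (intro theta_series_nonzero[where v = v and \<alpha> = \<alpha> and \<beta> = \<beta> and s = s and \<Lambda> = \<Lambda> and p = p,
          OF \<tau>0 \<Lambda>0 s T f(3,1) \<alpha> _ lim ph]) (simp_all only: v_def)
  have c1: "1 < cmod c"
  proof -
    have "cmod c = (1 / cmod \<tau>) ^ (2 * T)"
    proof -
      have "c = inverse (\<tau> ^ (2 * T))"
      proof -
        have e: "- 2 * int T = - int (2 * T)" by simp
        show ?thesis unfolding c_def e by (simp only: power_int_minus power_int_of_nat)
      qed
      then show ?thesis by (simp add: norm_divide norm_power power_one_over inverse_eq_divide)
    qed
    also have "1 < \<dots>" using \<tau> T by (intro one_less_power) auto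
    finally show ?thesis .
  qed
  have qp: "\<Theta> (c * w) = (\<tau> powi (- (int T)\<^sup>2) * \<Lambda>) * w ^ T * \<Theta> w" if "w \<noteq> 0" for w
    unfolding c_def \<Theta>_def
  proof (rule theta_quasi_periodic[OF \<tau>0 that])
    fix h
    have "\<kappa> powi (h + int T) = \<Lambda> * \<kappa> powi h" if "\<kappa> \<in> X" for \<kappa>
    proof -
      have "\<kappa> \<noteq> 0" using X(2)[OF that] \<delta>\<^sub>0 by auto
      then show ?thesis using X(3)[OF that] by (simp add: power_int_add)
    qed
    then show "p (h + int T) = \<Lambda> * p h" by (simp add: p_def sum_distrib_left mult_ac)
  qed
  have C0: "\<tau> powi (- (int T)\<^sup>2) * \<Lambda> \<noteq> 0" using \<tau>0 \<Lambda>0 by simp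
  show thesis
  proof (rule zeros_asymptotic_to_geometric[OF f(1,2) hol\<Theta> \<Theta>0 c1 C0 T qp holG fG K0 unif])
    fix z :: "nat \<Rightarrow> nat \<Rightarrow> complex" and A :: "nat \<Rightarrow> complex"
    assume zA: "{w. f w = 0} = {z n \<nu> | n \<nu>. \<nu> \<in> {1..T}}"
      "\<And>\<nu>. \<nu> \<in> {1..T} \<Longrightarrow> A \<nu> \<noteq> 0"
      "\<And>\<nu>. \<nu> \<in> {1..T} \<Longrightarrow> (\<lambda>n. z n \<nu> / (A \<nu> * c ^ n)) \<longlonglongrightarrow> 1"
    and rate: "\<And>\<theta> \<nu>. \<lbrakk>0 < \<theta>; \<theta> < 1; \<nu> \<in> {1..T};
        \<And>Y. 1 \<le> Y \<Longrightarrow> \<exists>B. \<forall>n w. 1 / Y \<le> cmod w \<longrightarrow> cmod w \<le> Y \<longrightarrow> cmod (G n w - \<Theta> w) \<le> B * (\<theta> ^ T) ^ n\<rbrakk>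
      \<Longrightarrow> (\<lambda>n. z n \<nu> / (A \<nu> * c ^ n) - 1) \<in> O(\<lambda>n. complex_of_real (\<theta> ^ n))"
    show thesis
    proof (rule that[of z A])
      fix \<delta> :: real and \<nu>
      assume \<delta>: "0 < \<delta>" "\<delta> < \<mu>" and \<nu>: "\<nu> \<in> {1..T}" and deg0: "\<And>\<kappa>. \<kappa> \<in> X \<Longrightarrow> degree (Q \<kappa>) = 0"
        and err': "geometrically_bounded \<delta> (\<lambda>n. \<beta> n - (\<Sum>\<kappa>\<in>X. poly (Q \<kappa>) (of_nat n) * \<kappa> ^ n))"
      have D0: "D = 0" using deg0[OF \<kappa>'(1)] \<kappa>'(3) by simp
      obtain L where L: "\<And>n h. cmod (v n h - p h) \<le> L * ((\<delta> / \<mu>) ^ T) ^ n * \<delta> powi h"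
        using coefficient_rate[OF X(1-3) Xne \<delta> T degD err' p_eq v_eq D0] by blast
      show "(\<lambda>n. z n \<nu> / (A \<nu> * (\<tau> powi (- 2 * int T)) ^ n) - 1) \<in> O(\<lambda>n. complex_of_real ((\<delta> / \<mu>) ^ n))"
        unfolding c_def[symmetric]
      proof (rule rate)
        show "\<exists>B. \<forall>n w. 1 / Y \<le> cmod w \<longrightarrow> cmod w \<le> Y \<longrightarrow> cmod (G n w - \<Theta> w) \<le> B * ((\<delta> / \<mu>) ^ T) ^ n"
          if "1 \<le> Y" for Y
          unfolding G_def \<Theta>_def by (rule theta_series_rate[OF \<tau> B bp bv L \<delta>(1) that])
      qed (use \<delta> \<nu> in auto)
    qed (use zA in \<open>auto simp: c_def\<close>)
  qed assumption+
qed

text \<open>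
  The constant \<open>Q\<^sub>\<kappa>\<close> make the main term an exact solution of the recurrence, so the error term
  satisfies the perturbed recurrence of \<open>\<beta>\<close>. It is smaller than \<open>\<mu>\<^sup>n\<close> and therefore only sees the
  roots of modulus below \<open>\<delta>\<close>.
\<close>

lemma characteristic_error_bounded:
  fixes q \<rho> :: complex and \<beta> :: "nat \<Rightarrow> complex" and \<mu> \<delta> \<delta>\<^sub>0 :: real
  assumes k: "k \<in> {1..newton_K m a}" and q: "q \<noteq> 0" "cmod q < 1"
    and rho: "\<rho> ^ (2 * edge_M m a k) = q"
    and f: "\<And>z. (\<lambda>n. \<alpha> n * z ^ n) sums f z"
    and eq: "\<And>z. (\<Sum>j\<le>m. poly (a j) z * f (q ^ j * z)) = poly b z"
    and \<beta>: "\<And>n. \<alpha> n = \<beta> n * \<rho> ^ (edge_N m a k * n\<^sup>2)"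
  defines "X \<equiv> {\<kappa> \<in> char_roots q \<rho> m a k. cmod \<kappa> = \<mu>}"
  assumes deg: "\<And>\<kappa>. \<kappa> \<in> X \<Longrightarrow> degree (Q \<kappa>) = 0"
    and \<delta>\<^sub>0: "0 < \<delta>\<^sub>0" "\<delta>\<^sub>0 < \<mu>"
    and err: "geometrically_bounded \<delta>\<^sub>0 (\<lambda>n. \<beta> n - (\<Sum>\<kappa>\<in>X. poly (Q \<kappa>) (of_nat n) * \<kappa> ^ n))"
    and \<delta>: "\<delta> < \<mu>" "(cmod \<rho>)\<^sup>2 * \<mu> < \<delta>" "\<And>\<kappa>. \<kappa> \<in> char_roots q \<rho> m a k \<Longrightarrow> cmod \<kappa> < \<mu> \<Longrightarrow> cmod \<kappa> < \<delta>"
  shows "geometrically_bounded \<delta> (\<lambda>n. \<beta> n - (\<Sum>\<kappa>\<in>X. poly (Q \<kappa>) (of_nat n) * \<kappa> ^ n))"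
proof -
  have rho0: "\<rho> \<noteq> 0" using rho q newton_edge(3)[OF k] by (auto simp: power_0_left)
  define R where "R = reflect_poly (char_poly q \<rho> m a k)"
  have R0: "R \<noteq> 0" using coeff_char_poly_0[OF k q(1) rho0] by (auto simp: R_def)
  have roots: "poly R \<kappa> = 0 \<longleftrightarrow> \<kappa> \<in> char_roots q \<rho> m a k" for \<kappa>
    unfolding R_def using char_roots_iff[OF k q(1) rho0] by simp
  have finX: "finite X" unfolding X_def using finite_char_roots[OF k q(1) rho0] by simp
  have \<mu>0: "0 < \<mu>" using \<delta>\<^sub>0 by linarith
  have r0: "0 < (cmod \<rho>)\<^sup>2 * \<mu>" using rho0 \<mu>0 by simp
  then have \<delta>pos: "0 < \<delta>" using \<delta>(2) by linarith
  define c where "c = (\<lambda>\<kappa>. coeff (Q \<kappa>) 0)"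
  have Qc: "poly (Q \<kappa>) x = c \<kappa>" if \<kappa>: "\<kappa> \<in> X" for \<kappa> x
  proof -
    obtain y where "Q \<kappa> = [:y:]" using deg[OF \<kappa>] by (auto elim: degree_eq_zeroE)
    then show ?thesis by (simp add: c_def)
  qed
  define g where "g = (\<lambda>n. \<Sum>\<kappa>\<in>X. c \<kappa> * \<kappa> ^ n)"
  define \<gamma> where "\<gamma> = (\<lambda>n. \<beta> n - g n)"
  have \<gamma>_eq: "(\<lambda>n. \<beta> n - (\<Sum>\<kappa>\<in>X. poly (Q \<kappa>) (of_nat n) * \<kappa> ^ n)) = \<gamma>"
    by (simp add: \<gamma>_def g_def Qc)
  have err\<gamma>: "geometrically_bounded \<delta>\<^sub>0 \<gamma>" using err unfolding \<gamma>_eq .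
  have "geometrically_bounded \<mu> g"
    unfolding geometrically_bounded_def
  proof (intro exI allI)
    fix n
    have "cmod (g n) \<le> (\<Sum>\<kappa>\<in>X. cmod (c \<kappa>) * \<mu> ^ n)"
      unfolding g_def by (rule sum_norm_le) (auto simp: norm_mult norm_power X_def)
    then show "cmod (g n) \<le> (\<Sum>\<kappa>\<in>X. cmod (c \<kappa>)) * \<mu> ^ n" by (simp add: sum_distrib_right)
  qed
  then have "geometrically_bounded \<mu> (\<lambda>n. 1 * g n + 1 * \<gamma> n)"
    using geometrically_bounded_mono[OF err\<gamma> \<delta>\<^sub>0(1)] \<delta>\<^sub>0(2) \<mu>0 by (intro geometrically_bounded_lincomb) auto
  then have "geometrically_bounded \<mu> \<beta>" by (simp add: \<gamma>_def)
  from char_poly_recurrence[OF k q rho f eq \<beta> \<mu>0 this]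
  have "geometrically_bounded ((cmod \<rho>)\<^sup>2 * \<mu>) (shift_operator R \<beta>)" unfolding R_def .
  moreover have "shift_operator R \<beta> = shift_operator R \<gamma>"
  proof
    fix n
    have "shift_operator R g n = (\<Sum>\<kappa>\<in>X. shift_operator R (\<lambda>n. c \<kappa> * \<kappa> ^ n) n)"
      unfolding shift_operator_def g_def by (subst sum.swap) (simp add: sum_distrib_left)
    also have "\<dots> = 0"
      by (rule sum.neutral) (use roots in \<open>auto simp: shift_operator_geometric X_def\<close>)
    finally show "shift_operator R \<beta> n = shift_operator R \<gamma> n"
      by (simp add: \<gamma>_def shift_operator_def algebra_simps sum_subtractf)
  qed
  ultimately have "geometrically_bounded \<delta> (shift_operator R \<gamma>)"
    using geometrically_bounded_mono[OF _ r0] \<delta>(2) by simp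
  then have "geometrically_bounded \<delta> \<gamma>"
  proof (rule linear_recurrence_bounded[OF R0 err\<gamma> \<delta>pos \<delta>\<^sub>0(1)])
    fix \<kappa> assume "poly R \<kappa> = 0"
    then show "cmod \<kappa> < \<delta> \<or> \<delta> < cmod \<kappa> \<and> \<delta>\<^sub>0 < cmod \<kappa>"
      using \<delta>(1,3) \<delta>\<^sub>0(2) by (cases "cmod \<kappa> < \<mu>") (auto simp: roots)
  qed
  then show ?thesis unfolding \<gamma>_eq .
qed

lemma common_power_if_roots_of_unity:
  fixes X :: "complex set"
  assumes X: "finite X" "0 \<notin> X" and u: "\<And>\<kappa> \<kappa>'. \<kappa> \<in> X \<Longrightarrow> \<kappa>' \<in> X \<Longrightarrow> \<exists>n>0. (\<kappa> / \<kappa>') ^ n = 1"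
  shows "\<exists>L>0. \<forall>\<kappa>\<in>X. \<forall>\<kappa>'\<in>X. \<kappa> ^ L = \<kappa>' ^ L"
proof -
  have "\<forall>x. \<exists>n. x \<in> X \<times> X \<longrightarrow> 0 < n \<and> (fst x / snd x) ^ n = 1" using u by fastforce
  then obtain n where n: "\<And>x. x \<in> X \<times> X \<Longrightarrow> 0 < n x \<and> (fst x / snd x) ^ n x = 1" by metis
  define L where "L = (\<Prod>x\<in>X \<times> X. n x)"
  have "\<kappa> ^ L = \<kappa>' ^ L" if k: "\<kappa> \<in> X" "\<kappa>' \<in> X" for \<kappa> \<kappa>'
  proof -
    have x: "(\<kappa>, \<kappa>') \<in> X \<times> X" using k by simp
    have "n (\<kappa>, \<kappa>') dvd L" unfolding L_def by (rule dvd_prodI) (use X x in auto)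
    then obtain i where "L = n (\<kappa>, \<kappa>') * i" ..
    then have "(\<kappa> / \<kappa>') ^ L = 1" using n[OF x] by (simp add: power_mult)
    moreover have "\<kappa>' \<noteq> 0" using k X by auto
    ultimately show ?thesis by (simp add: power_divide)
  qed
  moreover have "0 < L" unfolding L_def using n by (intro prod_pos) blast
  ultimately show ?thesis by blast
qed

theorem theorem1p2:
  fixes q \<rho> :: complex and m k :: nat
    and a :: "nat \<Rightarrow> complex poly" and b :: "complex poly"
    and f :: "complex \<Rightarrow> complex" and \<alpha> :: "nat \<Rightarrow> complex" and \<mu> :: real
  assumes q: "0 < cmod q" "cmod q < 1"
    and a0: "a 0 \<noteq> 0"
    and f_entire: "transcendental_entire f"
    and f_series: "\<And>z. (\<lambda>n. \<alpha> n * z ^ n) sums f z"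
    and f_eq: "\<And>z. (\<Sum>j\<le>m. poly (a j) z * f (q ^ j * z)) = poly b z"
    and k: "k \<in> {1..newton_K m a}"
    and growth: "(\<lambda>r. ln (max_modulus f r)) \<sim>[at_top]
                   (\<lambda>r. edge_slope m a k / (- 2 * ln (cmod q)) * (ln r)\<^sup>2)"
    and rho: "\<rho> ^ (2 * edge_M m a k) = q"
    and mu: "dominant_modulus q \<rho> m a k \<alpha> \<mu>"
    and unity: "\<And>\<kappa> \<kappa>'. \<lbrakk>\<kappa> \<in> char_roots q \<rho> m a k; \<kappa>' \<in> char_roots q \<rho> m a k;
                  cmod \<kappa> = \<mu>; cmod \<kappa>' = \<mu>\<rbrakk> \<Longrightarrow> \<exists>n>0. (\<kappa> / \<kappa>') ^ n = 1"
  shows "asymptotic_to_geometric_progressions {z. f z = 0} \<and>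
    (\<forall>L::nat. L > 0 \<longrightarrow>
      (\<forall>\<kappa>\<in>char_roots q \<rho> m a k. \<forall>\<kappa>'\<in>char_roots q \<rho> m a k.
         cmod \<kappa> = \<mu> \<longrightarrow> cmod \<kappa>' = \<mu> \<longrightarrow> \<kappa> ^ (L * edge_M m a k) = \<kappa>' ^ (L * edge_M m a k)) \<longrightarrow>
      (\<exists>(z :: nat \<Rightarrow> nat \<Rightarrow> complex) (A :: nat \<Rightarrow> complex).
         {w. f w = 0} = {z n \<nu> | n \<nu>. \<nu> \<in> {1..L * edge_M m a k}} \<and>
         (\<forall>\<nu>\<in>{1..L * edge_M m a k}. A \<nu> \<noteq> 0 \<and>
            (\<lambda>n. z n \<nu>) \<sim>[sequentially] (\<lambda>n. A \<nu> * q powi (- int (L * edge_N m a k * n)))) \<and>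
         ((\<forall>\<kappa>\<in>char_roots q \<rho> m a k. cmod \<kappa> = \<mu> \<longrightarrow> char_mult q \<rho> m a k \<kappa> = 1) \<longrightarrow>
            (\<forall>\<delta>::real. (\<forall>\<kappa>\<in>char_roots q \<rho> m a k. cmod \<kappa> < \<mu> \<longrightarrow> cmod \<kappa> < \<delta>) \<longrightarrow>
                 (cmod \<rho>)\<^sup>2 * \<mu> < \<delta> \<longrightarrow>
               (\<forall>\<nu>\<in>{1..L * edge_M m a k}. \<exists>e :: nat \<Rightarrow> complex.
                  e \<in> O(\<lambda>n. complex_of_real ((\<delta> / \<mu>) ^ n)) \<and>
                  (\<forall>n. z n \<nu> = A \<nu> * q powi (- int (L * edge_N m a k * n)) * (1 + e n)))))))"
    (is "_ \<and> (\<forall>L. L > 0 \<longrightarrow> ?common L \<longrightarrow> ?progressions L)")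
proof -
  define M N where "M = edge_M m a k" and "N = edge_N m a k"
  have MN: "0 < M" "0 < N" using newton_edge(3,4)[OF k] by (simp_all add: M_def N_def)
  have q0: "q \<noteq> 0" using q by auto
  have rho': "\<rho> ^ (2 * M) = q" using rho by (simp add: M_def)
  have rho0: "\<rho> \<noteq> 0" using rho' q0 MN by (auto simp: power_0_left)
  have "cmod \<rho> ^ (2 * M) < 1" using q(2) rho' by (simp flip: norm_power)
  then have rho1: "cmod \<rho> < 1" using MN by (simp add: power_less_one_iff)
  define \<tau> where "\<tau> = \<rho> ^ N"
  have \<tau>: "0 < cmod \<tau>" "cmod \<tau> < 1"
    using rho0 rho1 MN by (auto simp: \<tau>_def norm_power power_less_one_iff)
  define X where "X = {\<kappa> \<in> char_roots q \<rho> m a k. cmod \<kappa> = \<mu>}"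
  have finX: "finite X" unfolding X_def using finite_char_roots[OF k q0 rho0] by simp
  have X0: "0 \<notin> X" by (simp add: X_def char_roots_def)
  define \<beta> where "\<beta> = (\<lambda>n. \<alpha> n * \<rho> powi (- int (N * n\<^sup>2)))"
  have \<beta>: "\<alpha> n = \<beta> n * \<rho> ^ (N * n\<^sup>2)" for n
    using rho0 by (simp add: \<beta>_def power_int_minus flip: of_nat_power of_nat_mult)
  have \<beta>\<tau>: "\<alpha> n = \<beta> n * \<tau> ^ n\<^sup>2" for n using \<beta> by (simp add: \<tau>_def power_mult)
  obtain Q \<delta>\<^sub>0 where Q: "\<And>\<kappa>. \<kappa> \<in> X \<Longrightarrow> degree (Q \<kappa>) \<le> char_mult q \<rho> m a k \<kappa> - 1" "\<exists>\<kappa>\<in>X. Q \<kappa> \<noteq> 0"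
    and \<delta>\<^sub>0: "0 < \<delta>\<^sub>0" "\<delta>\<^sub>0 < \<mu>"
    and bigo: "(\<lambda>n. \<beta> n - (\<Sum>\<kappa>\<in>X. poly (Q \<kappa>) (of_nat n) * \<kappa> ^ n)) \<in> O(\<lambda>n. complex_of_real (\<delta>\<^sub>0 ^ n))"
    using mu unfolding dominant_modulus_def X_def \<beta>_def N_def by blast
  obtain \<kappa>\<^sub>0 where \<kappa>\<^sub>0: "\<kappa>\<^sub>0 \<in> X" "Q \<kappa>\<^sub>0 \<noteq> 0" using Q(2) by blast
  have err: "geometrically_bounded \<delta>\<^sub>0 (\<lambda>n. \<beta> n - (\<Sum>\<kappa>\<in>X. poly (Q \<kappa>) (of_nat n) * \<kappa> ^ n))"
    using bigo geometrically_bounded_iff_bigo[OF \<delta>\<^sub>0(1)] by blast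
  have f: "f holomorphic_on UNIV" "\<exists>z. f z \<noteq> 0"
  proof -
    show "f holomorphic_on UNIV" using f_entire by (simp add: transcendental_entire_def)
    have "\<not> (\<forall>z. f z = poly 0 z)" using f_entire unfolding transcendental_entire_def by blast
    then show "\<exists>z. f z \<noteq> 0" by simp
  qed
  have progressions: "?progressions L" if L: "L > 0" and common: "?common L" for L
  proof -
    define T where "T = L * M"
    have T: "0 < T" using L MN by (simp add: T_def)
    have XT: "\<kappa> ^ T = \<kappa>\<^sub>0 ^ T" if "\<kappa> \<in> X" for \<kappa>
      using common that \<kappa>\<^sub>0(1) unfolding X_def T_def M_def by blast
    have base: "(\<tau> powi (- 2 * int T)) ^ n = q powi (- int (L * N * n))" for n
    proof -
      have "(\<tau> powi (- 2 * int T)) ^ n = \<rho> powi (int N * ((- 2 * int T) * int n))"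
        by (simp only: \<tau>_def power_int_mult power_int_of_nat)
      also have "int N * ((- 2 * int T) * int n) = int (2 * M) * (- int (L * N * n))"
        by (simp add: T_def)
      also have "\<rho> powi \<dots> = q powi (- int (L * N * n))"
        unfolding power_int_mult power_int_of_nat rho' ..
      finally show ?thesis .
    qed
    show ?thesis
    proof (rule zeros_of_gaussian_series[OF f f_series \<tau> \<beta>\<tau> finX _ XT T \<kappa>\<^sub>0 \<delta>\<^sub>0 err], unfold base)
      show "cmod \<kappa> = \<mu>" if "\<kappa> \<in> X" for \<kappa> using that by (simp add: X_def)
    next
      fix z :: "nat \<Rightarrow> nat \<Rightarrow> complex" and A :: "nat \<Rightarrow> complex"
      assume zA: "{w. f w = 0} = {z n \<nu> | n \<nu>. \<nu> \<in> {1..T}}"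
        "\<And>\<nu>. \<nu> \<in> {1..T} \<Longrightarrow> A \<nu> \<noteq> 0"
        "\<And>\<nu>. \<nu> \<in> {1..T} \<Longrightarrow> (\<lambda>n. z n \<nu> / (A \<nu> * q powi (- int (L * N * n)))) \<longlonglongrightarrow> 1"
      and rate: "\<And>\<delta> \<nu>. \<lbrakk>0 < \<delta>; \<delta> < \<mu>; \<nu> \<in> {1..T}; \<And>\<kappa>. \<kappa> \<in> X \<Longrightarrow> degree (Q \<kappa>) = 0;
          geometrically_bounded \<delta> (\<lambda>n. \<beta> n - (\<Sum>\<kappa>\<in>X. poly (Q \<kappa>) (of_nat n) * \<kappa> ^ n))\<rbrakk>
        \<Longrightarrow> (\<lambda>n. z n \<nu> / (A \<nu> * q powi (- int (L * N * n))) - 1) \<in> O(\<lambda>n. complex_of_real ((\<delta> / \<mu>) ^ n))"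
      have qn: "q powi (- int (L * N * n)) \<noteq> 0" for n using q0 by simp
      have improved: "\<exists>e. e \<in> O(\<lambda>n. complex_of_real ((\<delta> / \<mu>) ^ n)) \<and>
            (\<forall>n. z n \<nu> = A \<nu> * q powi (- int (L * N * n)) * (1 + e n))"
        if simple: "\<forall>\<kappa>\<in>char_roots q \<rho> m a k. cmod \<kappa> = \<mu> \<longrightarrow> char_mult q \<rho> m a k \<kappa> = 1"
          and \<delta>: "\<forall>\<kappa>\<in>char_roots q \<rho> m a k. cmod \<kappa> < \<mu> \<longrightarrow> cmod \<kappa> < \<delta>" "(cmod \<rho>)\<^sup>2 * \<mu> < \<delta>"
          and \<nu>: "\<nu> \<in> {1..T}" for \<delta> \<nu>
      proof (intro exI conjI allI)
        let ?e = "\<lambda>n. z n \<nu> / (A \<nu> * q powi (- int (L * N * n))) - 1"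
        show "z n \<nu> = A \<nu> * q powi (- int (L * N * n)) * (1 + ?e n)" for n
          using zA(2)[OF \<nu>] qn[of n] by simp
        have \<mu>0: "0 < \<mu>" using \<delta>\<^sub>0 by linarith
        then have \<delta>0: "0 < \<delta>" using \<delta>(2) rho0 by (smt (verit) mult_pos_pos zero_less_norm_iff zero_less_power)
        show "?e \<in> O(\<lambda>n. complex_of_real ((\<delta> / \<mu>) ^ n))"
        \<comment> \<open>for \<open>\<delta> \<ge> \<mu>\<close> the bound is at least 1, and the convergence of the quotient suffices\<close>
        proof (cases "\<delta> < \<mu>")
          case True
          have deg: "degree (Q \<kappa>) = 0" if "\<kappa> \<in> X" for \<kappa>
            using Q(1)[OF that] simple that by (simp add: X_def)
          show ?thesis
          proof (rule rate[OF \<delta>0 True \<nu> deg])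
            show "geometrically_bounded \<delta> (\<lambda>n. \<beta> n - (\<Sum>\<kappa>\<in>X. poly (Q \<kappa>) (of_nat n) * \<kappa> ^ n))"
              unfolding X_def
              by (rule characteristic_error_bounded[OF k q0 q(2) rho f_series f_eq _ _ \<delta>\<^sub>0 _ True \<delta>(2)])
                (use \<beta> deg err \<delta>(1) in \<open>auto simp: X_def N_def\<close>)
          qed
        next
          case False
          have "?e \<longlonglongrightarrow> 1 - 1" by (intro tendsto_diff zA(3)[OF \<nu>] tendsto_const)
          then have "\<forall>\<^sub>F n in sequentially. cmod (?e n) < 1"
            using tendsto_norm[of ?e 0 sequentially] by (intro order_tendstoD(2)[of _ 0]) auto
          then show ?thesis
          proof (intro bigoI[of _ 1], elim eventually_mono)
            fix n assume "cmod (?e n) < 1"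
            moreover have "1 \<le> (\<delta> / \<mu>) ^ n" using False \<mu>0 by (intro one_le_power) simp
            ultimately show "norm (?e n) \<le> 1 * norm (complex_of_real ((\<delta> / \<mu>) ^ n))"
              unfolding norm_of_real by linarith
          qed
        qed
      qed
      have "(\<lambda>n. z n \<nu>) \<sim>[sequentially] (\<lambda>n. A \<nu> * q powi (- int (L * N * n)))" if "\<nu> \<in> {1..T}" for \<nu>
        using zA(3)[OF that] by (rule asymp_equivI')
      note asymp = this
      show "?progressions L"
        unfolding M_def[symmetric] N_def[symmetric] T_def[symmetric]
        by (rule exI[of _ z], rule exI[of _ A], intro conjI ballI impI allI)
          (fact zA(1), erule zA(2), erule asymp, rule improved)
    qed assumption+
  qed
  have "asymptotic_to_geometric_progressions {z. f z = 0}"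
  proof -
    have "\<exists>L>0. \<forall>\<kappa>\<in>X. \<forall>\<kappa>'\<in>X. \<kappa> ^ L = \<kappa>' ^ L"
      by (rule common_power_if_roots_of_unity[OF finX X0]) (use unity in \<open>simp add: X_def\<close>)
    then obtain L where L: "L > 0" "\<And>\<kappa> \<kappa>'. \<kappa> \<in> X \<Longrightarrow> \<kappa>' \<in> X \<Longrightarrow> \<kappa> ^ L = \<kappa>' ^ L" by blast
    have "?common L"
    proof (intro ballI impI)
      fix \<kappa> \<kappa>'
      assume "\<kappa> \<in> char_roots q \<rho> m a k" "\<kappa>' \<in> char_roots q \<rho> m a k" "cmod \<kappa> = \<mu>" "cmod \<kappa>' = \<mu>"
      then have "\<kappa> ^ L = \<kappa>' ^ L" by (intro L(2)) (simp_all add: X_def)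
      then show "\<kappa> ^ (L * edge_M m a k) = \<kappa>' ^ (L * edge_M m a k)" by (simp only: power_mult)
    qed
    from progressions[OF L(1) this] obtain z A where
      zA: "{w. f w = 0} = {z n \<nu> | n \<nu>. \<nu> \<in> {1..L * M}}"
        "\<forall>\<nu>\<in>{1..L * M}. A \<nu> \<noteq> 0 \<and> (\<lambda>n. z n \<nu>) \<sim>[sequentially] (\<lambda>n. A \<nu> * q powi (- int (L * N * n)))"
      unfolding M_def N_def by blast
    define r where "r = q powi (- int (L * N))"
    have "q powi (- int (L * N * n)) = r ^ n" for n
      unfolding r_def by (simp add: power_int_minus power_mult power_inverse flip: of_nat_mult)
    moreover have "cmod r > 1"
    proof -
      have "r = inverse (q ^ (L * N))" unfolding r_def by (simp only: power_int_minus power_int_of_nat)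
      then have "cmod r = inverse (cmod q ^ (L * N))" by (simp add: norm_inverse norm_power)
      moreover have "cmod q ^ (L * N) < 1" using q L(1) MN by (simp add: power_less_one_iff)
      ultimately show ?thesis using q by (simp add: one_less_inverse)
    qed
    ultimately show ?thesis
      unfolding asymptotic_to_geometric_progressions_def
      using zA by (intro exI[of _ "L * M"] exI[of _ z] exI[of _ A] exI[of _ "\<lambda>_. r"]) simp
  qed
  then show ?thesis using progressions by (intro conjI allI impI)
qed

end
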